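(* Let $X$ be one of the classes $W^r_{r-1}(M)$, $W^r_{r-2}(M)$, $W^r_{r-1,r-2}(M,N)$. Let $n\in\mathbb N$, let $0\le u_1<u_2<\dots<u_{2n}<2\pi$, $u=(u_1,\dots,u_{2n})$, and let $p\in[1,\infty]$. Let $\phi=\phi(X,u;\cdot)$ be an $X$-ideal spline with $2n$ knots which vanishes at $u_1,\dots,u_{2n}$, and let $\Delta_{2n}$ be the partition formed by its knots. For $v=(v_1,\dots,v_{2n})\in\mathbb R^{2n}$ let $s(X',u,v;\cdot)$ be the (unique) spline in $S(X',\Delta_{2n})$ with $s(X',u,v;u_k)=v_k$, $k=1,\dots,2n$. Then $$E(X,u,\|\cdot\|_p)=\|\phi(X,u;\cdot)\|_p,$$ and the method $\tilde\Psi(v_1,\dots,v_{2n})=s(X',u,v;\cdot)$ is a best recovery method, i.e. $e(X,u,\tilde\Psi,\|\cdot\|_p)=E(X,u,\|\cdot\|_p)$.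
   Context: All functions are real-valued and $2\pi$-periodic on $\mathbb R$. For $m\ge 1$, $L^m_\infty$ is the set of $2\pi$-periodic functions $f$ such that $f^{(m-1)}$ is (locally) absolutely continuous and $f^{(m)}\in L_\infty$; $\|\cdot\|_p$ is the $L_p$ norm over a period, $\|\cdot\|_\infty$ the (essential) sup norm; $C$ is the space of continuous $2\pi$-periodic functions. $M,N>0$ are fixed. Classes: for $r\ge 2$, $W^r_{r-1}(M)=\{x\in L^r_\infty:\|x^{(r)}\|_\infty\le 1,\ \|x^{(r-1)}\|_\infty\le M\}$; for $r\ge 3$, $W^r_{r-2}(M)=\{x\in L^r_\infty:\|x^{(r)}\|_\infty\le 1,\ \|x^{(r-2)}\|_\infty\le M\}$ and $W^r_{r-1,r-2}(M,N)=\{x\in L^r_\infty:\|x^{(r)}\|_\infty\le1,\ \|x^{(r-1)}\|_\infty\le N,\ \|x^{(r-2)}\|_\infty\le M\}$. Ideal splines. A function $x\in X$ is an $X$-ideal spline with ($2n$) knots $t_1<t_2<\dots<t_{2n+1}:=t_1+2\pi$ if for each $k=1,\dots,2n$ there are $\varepsilon_k\in\{1,-1\}$ and $\alpha_k\in[0,t_{k+1}-t_k]$ (and, for $X=W^r_{r-1,r-2}(M,N)$, also $\beta_k\in[0,\alpha_k]$) such that: - if $X=W^r_{r-1}(M)$: $x^{(r)}=\varepsilon_k$ on $(t_k,t_k+\alpha_k)$; $x^{(r)}=0$ and $x^{(r-1)}=\varepsilon_kM$ on $(t_k+\alpha_k,t_{k+1})$; - if $X=W^r_{r-2}(M)$: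 $x^{(r)}=\varepsilon_k$ on $(t_k,t_k+\alpha_k/2)$; $x^{(r)}=-\varepsilon_k$ on $(t_k+\alpha_k/2,t_k+\alpha_k)$; $x^{(r)}=0$ and $x^{(r-2)}=\varepsilon_kM$ on $(t_k+\alpha_k,t_{k+1})$; - if $X=W^r_{r-1,r-2}(M,N)$: $x^{(r)}=\varepsilon_k$ on $(t_k,t_k+\beta_k/2)$; $x^{(r)}=0$ and $x^{(r-1)}=\varepsilon_kN$ on $(t_k+\beta_k/2,t_k+\alpha_k-\beta_k/2)$; $x^{(r)}=-\varepsilon_k$ on $(t_k+\alpha_k-\beta_k/2,t_k+\alpha_k)$; $x^{(r)}=0$ and $x^{(r-2)}=\varepsilon_kM$ on $(t_k+\alpha_k,t_{k+1})$. For every $u$ as in the claim, an $X$-ideal spline with $2n$ knots vanishing at $u_1,\dots,u_{2n}$ exists; $\phi(X,u;\cdot)$ denotes such a spline. The space $S(X',\Delta_{2n})$, where $X'=\{x':x\in X\}$. Let $t_1<t_2<\dots<t_{2n+1}=t_1+2\pi$ be the knots of the $X$-ideal spline $\phi=\phi(X,u;\cdot)$, and let $\alpha_k\in[0,t_{k+1}-t_k]$ (and, for $X=W^r_{r-1,r-2}(M,N)$, $\beta_k\in[0,\alpha_k]$), $k=1,\dots,2n$, be the numbers with which $x=\phi$ satisfies the conditions defining an $X$-ideal spline with these knots; indices are taken cyclically ($t_{k+2n}=t_k+2\pi$, etc.). Then $S(X',\Delta_{2n})$ is the set of $s\in L^{r-1}_\infty$ such that, for all $k=1,\dots,2n$: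 - if $X=W^r_{r-1}(M)$: $s^{(r-1)}=c_k$ on $(t_k,t_k+\alpha_k)$ for some $c_k\in\mathbb R$, and $s^{(r-1)}=0$ on $(t_k+\alpha_k,t_{k+1})$; - if $X=W^r_{r-2}(M)$: for some $c_k^1,c_k^2\in\mathbb R$, $s^{(r-1)}=c_k^1$ on $(t_k,t_k+\alpha_k/2)$, $s^{(r-1)}=c_k^2$ on $(t_k+\alpha_k/2,t_k+\alpha_k)$, $s^{(r-1)}=0$ on $(t_k+\alpha_k,t_{k+1})$; moreover $s^{(r-2)}(t_k)=0$ whenever $|\phi^{(r-2)}(t_k)|=M$, and $c_k^2=c_{k+1}^1$ whenever $|\phi^{(r-2)}(t_{k+1})|<M$; - if $X=W^r_{r-1,r-2}(M,N)$: for some $c_k^1,c_k^2\in\mathbb R$, $s^{(r-1)}=c_k^1$ on $(t_k,t_k+\beta_k/2)$, $s^{(r-1)}=c_k^2$ on $(t_k+\alpha_k-\beta_k/2,t_k+\alpha_k)$, $s^{(r-1)}=0$ on $(t_k+\beta_k/2,t_k+\alpha_k-\beta_k/2)$ and on $(t_k+\alpha_k,t_{k+1})$; moreover $s^{(r-2)}(t_k)=0$ whenever $|\phi^{(r-2)}(t_k)|=M$, and $c_k^2=c_{k+1}^1$ whenever $|\phi^{(r-2)}(t_{k+1})|<M$. For every $v\in\mathbb R^{2n}$ there is exactly one $s\in S(X',\Delta_{2n})$ with $s(u_k)=v_k$, $k=1,\dots,2n$. Recovery problem. A recovery method is an arbitrary function $\Psi:\mathbb R^{2n}\to C$; for a norm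 $\|\cdot\|$ on $C$ its error is $e(X,u,\Psi,\|\cdot\|)=\sup_{x\in X}\|x-\Psi(x(u_1),\dots,x(u_{2n}))\|$; the best error is $E(X,u,\|\cdot\|)=\inf_\Psi e(X,u,\Psi,\|\cdot\|)$.
   Formalization: For the classes W^r_{r-2}(M) and W^r_{r-1,r-2}(M,N), the signs of the ideal spline are required to alternate, ε_{k+1} = −ε_k; without this the claim is false (e.g. r=3, n=1, M large, ε_1=ε_2=1, equidistant knots, u=(π/4,3π/4)). *)

theory Defs
  imports "HOL-Analysis.Analysis" "HOL-Probability.Essential_Supremum"
begin

section \<open>Periodic functions, norms and smoothness\<close>

text \<open>The k-th derivative of f is \<open>(deriv ^^ k) f\<close>. Where a derivative does not exist, \<open>deriv\<close> is an
  unspecified constant. For the functions below this concerns only the highest derivative, on a null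
  set, and it does not affect an equation \<open>f\<^sup>(\<^sup>m\<^sup>) = c\<close> on an open interval: there \<open>f\<^sup>(\<^sup>m\<^sup>-\<^sup>1\<^sup>)\<close> is
  absolutely continuous with derivative c almost everywhere, hence affine.\<close>

abbreviation nderiv :: "nat \<Rightarrow> (real \<Rightarrow> real) \<Rightarrow> real \<Rightarrow> real" where
  "nderiv k f \<equiv> (deriv ^^ k) f"

definition periodic :: "(real \<Rightarrow> real) \<Rightarrow> bool" where
  "periodic f \<longleftrightarrow> (\<forall>t. f (t + 2 * pi) = f t)"

definition C_per :: "(real \<Rightarrow> real) set" where
  "C_per = {f. periodic f \<and> continuous_on UNIV f}"

definition abs_cont_on :: "real \<Rightarrow> real \<Rightarrow> (real \<Rightarrow> real) \<Rightarrow> bool" where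
  "abs_cont_on a b f \<longleftrightarrow>
     (\<forall>e>0. \<exists>d>0. \<forall>(m::nat) p q.
        (\<forall>i<m. a \<le> p i \<and> p i \<le> q i \<and> q i \<le> b) \<longrightarrow>
        (\<forall>i<m. \<forall>j<m. i \<noteq> j \<longrightarrow> {p i<..<q i} \<inter> {p j<..<q j} = {}) \<longrightarrow>
        (\<Sum>i<m. q i - p i) < d \<longrightarrow>
        (\<Sum>i<m. \<bar>f (q i) - f (p i)\<bar>) < e)"

definition loc_abs_cont :: "(real \<Rightarrow> real) \<Rightarrow> bool" where
  "loc_abs_cont f \<longleftrightarrow> (\<forall>a b. a < b \<longrightarrow> abs_cont_on a b f)"

definition Lp_norm :: "ennreal \<Rightarrow> (real \<Rightarrow> real) \<Rightarrow> ennreal" where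
  "Lp_norm p f =
     (if p = \<infinity> then esssup (lebesgue_on {0..2*pi}) (\<lambda>t. ennreal \<bar>f t\<bar>)
      else let I = (\<integral>\<^sup>+ t. ennreal (\<bar>f t\<bar> powr enn2real p) \<partial>lebesgue_on {0..2*pi})
           in if I = \<infinity> then \<infinity> else ennreal (enn2real I powr (1 / enn2real p)))"

text \<open>The space \<open>L\<^sup>m\<^sub>\<infinity>\<close>; it is only used for m at least 1.\<close>

definition L_inf :: "nat \<Rightarrow> (real \<Rightarrow> real) set" where
  "L_inf m = {f. periodic f \<and>
                 (\<forall>k<m - 1. \<forall>t. nderiv k f differentiable (at t)) \<and>
                 loc_abs_cont (nderiv (m - 1) f) \<and>
                 Lp_norm \<infinity> (nderiv m f) < \<infinity>}"


section \<open>The function classes\<close>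

text \<open>\<open>W1 r M\<close>, \<open>W2 r M\<close> and \<open>W12 r M N\<close> stand for \<open>W\<^sup>r\<^bsub>r-1\<^esub>(M)\<close>, \<open>W\<^sup>r\<^bsub>r-2\<^esub>(M)\<close> and \<open>W\<^sup>r\<^bsub>r-1,r-2\<^esub>(M,N)\<close>.
  In \<open>W12 r M N\<close> the number N bounds the derivative of order r-1 and M that of order r-2.\<close>

datatype fun_class = W1 nat real | W2 nat real | W12 nat real real

fun admissible :: "fun_class \<Rightarrow> bool" where
  "admissible (W1 r M) \<longleftrightarrow> r \<ge> 2 \<and> M > 0"
| "admissible (W2 r M) \<longleftrightarrow> r \<ge> 3 \<and> M > 0"
| "admissible (W12 r M N) \<longleftrightarrow> r \<ge> 3 \<and> M > 0 \<and> N > 0"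

fun class_set :: "fun_class \<Rightarrow> (real \<Rightarrow> real) set" where
  "class_set (W1 r M) =
     {x \<in> L_inf r. Lp_norm \<infinity> (nderiv r x) \<le> 1 \<and> Lp_norm \<infinity> (nderiv (r - 1) x) \<le> ennreal M}"
| "class_set (W2 r M) =
     {x \<in> L_inf r. Lp_norm \<infinity> (nderiv r x) \<le> 1 \<and> Lp_norm \<infinity> (nderiv (r - 2) x) \<le> ennreal M}"
| "class_set (W12 r M N) =
     {x \<in> L_inf r. Lp_norm \<infinity> (nderiv r x) \<le> 1 \<and> Lp_norm \<infinity> (nderiv (r - 1) x) \<le> ennreal N
                 \<and> Lp_norm \<infinity> (nderiv (r - 2) x) \<le> ennreal M}"


section \<open>Ideal splines\<close>

definition const_on :: "(real \<Rightarrow> real) \<Rightarrow> real \<Rightarrow> real \<Rightarrow> real \<Rightarrow> bool" where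
  "const_on f c a b \<longleftrightarrow> (\<forall>\<tau>\<in>{a<..<b}. f \<tau> = c)"

text \<open>The conditions on one knot interval from a to b, with sign e and parameters \<open>\<alpha>\<close>, \<open>\<beta>\<close>;
  \<open>\<beta>\<close> plays a role only for \<open>W12\<close>.\<close>

fun ideal_piece ::
    "fun_class \<Rightarrow> (real \<Rightarrow> real) \<Rightarrow> real \<Rightarrow> real \<Rightarrow> real \<Rightarrow> real \<Rightarrow> real \<Rightarrow> bool" where
  "ideal_piece (W1 r M) x a b e \<alpha> \<beta> \<longleftrightarrow>
     0 \<le> \<alpha> \<and> \<alpha> \<le> b - a \<and>
     const_on (nderiv r x) e a (a + \<alpha>) \<and>
     const_on (nderiv r x) 0 (a + \<alpha>) b \<and> const_on (nderiv (r - 1) x) (e * M) (a + \<alpha>) b"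
| "ideal_piece (W2 r M) x a b e \<alpha> \<beta> \<longleftrightarrow>
     0 \<le> \<alpha> \<and> \<alpha> \<le> b - a \<and>
     const_on (nderiv r x) e a (a + \<alpha>/2) \<and>
     const_on (nderiv r x) (- e) (a + \<alpha>/2) (a + \<alpha>) \<and>
     const_on (nderiv r x) 0 (a + \<alpha>) b \<and> const_on (nderiv (r - 2) x) (e * M) (a + \<alpha>) b"
| "ideal_piece (W12 r M N) x a b e \<alpha> \<beta> \<longleftrightarrow>
     0 \<le> \<alpha> \<and> \<alpha> \<le> b - a \<and> 0 \<le> \<beta> \<and> \<beta> \<le> \<alpha> \<and>
     const_on (nderiv r x) e a (a + \<beta>/2) \<and>
     const_on (nderiv r x) 0 (a + \<beta>/2) (a + \<alpha> - \<beta>/2) \<and>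
     const_on (nderiv (r - 1) x) (e * N) (a + \<beta>/2) (a + \<alpha> - \<beta>/2) \<and>
     const_on (nderiv r x) (- e) (a + \<alpha> - \<beta>/2) (a + \<alpha>) \<and>
     const_on (nderiv r x) 0 (a + \<alpha>) b \<and> const_on (nderiv (r - 2) x) (e * M) (a + \<alpha>) b"

text \<open>For \<open>W2\<close> and \<open>W12\<close> the signs of consecutive knot intervals are understood to alternate, so
  that the derivative of order r does not change sign at a knot where the derivative of order r-2
  is below M in modulus; the rule \<open>c\<^sub>k\<^sup>2 = c\<^sub>k\<^sub>+\<^sub>1\<^sup>1\<close> in the definition of the space S presupposes
  this. Without it, for large M, a perfect spline with 4n sign changes (all signs 1,
  \<open>\<alpha>\<^sub>k = t\<^sub>k\<^sub>+\<^sub>1 - t\<^sub>k\<close>, equidistant knots) would count as an ideal spline with 2n knots, and it may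
  vanish at all the points \<open>u\<^sub>k\<close> although its norm is smaller than the best error. For \<open>W1\<close>,
  alternation need not be required: it follows from the 2n zeros by Rolle's theorem.\<close>

fun sign_rule :: "fun_class \<Rightarrow> nat \<Rightarrow> (nat \<Rightarrow> real) \<Rightarrow> bool" where
  "sign_rule (W1 r M) n \<epsilon> \<longleftrightarrow> True"
| "sign_rule (W2 r M) n \<epsilon> \<longleftrightarrow> (\<forall>k\<in>{1..<2*n}. \<epsilon> (k + 1) = - \<epsilon> k)"
| "sign_rule (W12 r M N) n \<epsilon> \<longleftrightarrow> (\<forall>k\<in>{1..<2*n}. \<epsilon> (k + 1) = - \<epsilon> k)"

definition ideal_spline ::
    "fun_class \<Rightarrow> nat \<Rightarrow> (nat \<Rightarrow> real) \<Rightarrow> (nat \<Rightarrow> real) \<Rightarrow> (nat \<Rightarrow> real) \<Rightarrow> (nat \<Rightarrow> real)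
       \<Rightarrow> (real \<Rightarrow> real) \<Rightarrow> bool" where
  "ideal_spline X n t \<epsilon> \<alpha> \<beta> x \<longleftrightarrow>
     x \<in> class_set X \<and>
     strict_mono_on {1..2*n + 1} t \<and> t (2*n + 1) = t 1 + 2 * pi \<and>
     (\<forall>k\<in>{1..2*n}. \<epsilon> k \<in> {1, -1} \<and> ideal_piece X x (t k) (t (k + 1)) (\<epsilon> k) (\<alpha> k) (\<beta> k)) \<and>
     sign_rule X n \<epsilon>"


section \<open>The spline space S(X', Delta)\<close>

text \<open>The equation \<open>c1 (2n+1) = c1 1\<close> expresses the cyclic indexing of the constants.\<close>

fun spline_space ::
    "fun_class \<Rightarrow> nat \<Rightarrow> (real \<Rightarrow> real) \<Rightarrow> (nat \<Rightarrow> real) \<Rightarrow> (nat \<Rightarrow> real) \<Rightarrow> (nat \<Rightarrow> real)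
       \<Rightarrow> (real \<Rightarrow> real) set" where
  "spline_space (W1 r M) n \<phi> t \<alpha> \<beta> =
     {s \<in> L_inf (r - 1). \<forall>k\<in>{1..2*n}.
        (\<exists>c. const_on (nderiv (r - 1) s) c (t k) (t k + \<alpha> k)) \<and>
        const_on (nderiv (r - 1) s) 0 (t k + \<alpha> k) (t (k + 1))}"
| "spline_space (W2 r M) n \<phi> t \<alpha> \<beta> =
     {s \<in> L_inf (r - 1). \<exists>c1 c2. c1 (2*n + 1) = c1 1 \<and> (\<forall>k\<in>{1..2*n}.
        const_on (nderiv (r - 1) s) (c1 k) (t k) (t k + \<alpha> k/2) \<and>
        const_on (nderiv (r - 1) s) (c2 k) (t k + \<alpha> k/2) (t k + \<alpha> k) \<and>
        const_on (nderiv (r - 1) s) 0 (t k + \<alpha> k) (t (k + 1)) \<and>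
        (\<bar>nderiv (r - 2) \<phi> (t k)\<bar> = M \<longrightarrow> nderiv (r - 2) s (t k) = 0) \<and>
        (\<bar>nderiv (r - 2) \<phi> (t (k + 1))\<bar> < M \<longrightarrow> c2 k = c1 (k + 1)))}"
| "spline_space (W12 r M N) n \<phi> t \<alpha> \<beta> =
     {s \<in> L_inf (r - 1). \<exists>c1 c2. c1 (2*n + 1) = c1 1 \<and> (\<forall>k\<in>{1..2*n}.
        const_on (nderiv (r - 1) s) (c1 k) (t k) (t k + \<beta> k/2) \<and>
        const_on (nderiv (r - 1) s) (c2 k) (t k + \<alpha> k - \<beta> k/2) (t k + \<alpha> k) \<and>
        const_on (nderiv (r - 1) s) 0 (t k + \<beta> k/2) (t k + \<alpha> k - \<beta> k/2) \<and>
        const_on (nderiv (r - 1) s) 0 (t k + \<alpha> k) (t (k + 1)) \<and>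
        (\<bar>nderiv (r - 2) \<phi> (t k)\<bar> = M \<longrightarrow> nderiv (r - 2) s (t k) = 0) \<and>
        (\<bar>nderiv (r - 2) \<phi> (t (k + 1))\<bar> < M \<longrightarrow> c2 k = c1 (k + 1)))}"

definition interp_spline ::
    "(real \<Rightarrow> real) set \<Rightarrow> nat \<Rightarrow> (nat \<Rightarrow> real) \<Rightarrow> (nat \<Rightarrow> real) \<Rightarrow> real \<Rightarrow> real" where
  "interp_spline S n u v = (THE s. s \<in> S \<and> (\<forall>k\<in>{1..2*n}. s (u k) = v k))"


section \<open>Optimal recovery\<close>

text \<open>The space of 2n-vectors is \<open>{1..2n} \<rightarrow>\<^sub>E UNIV\<close>; a method sees nothing of x but its values at
  \<open>u\<^sub>1, \<dots>, u\<^sub>2\<^sub>n\<close>.\<close>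

definition samples :: "nat \<Rightarrow> (nat \<Rightarrow> real) \<Rightarrow> (real \<Rightarrow> real) \<Rightarrow> nat \<Rightarrow> real" where
  "samples n u x = restrict (\<lambda>k. x (u k)) {1..2*n}"

definition recovery_methods :: "nat \<Rightarrow> ((nat \<Rightarrow> real) \<Rightarrow> real \<Rightarrow> real) set" where
  "recovery_methods n = ({1..2*n} \<rightarrow>\<^sub>E UNIV) \<rightarrow> C_per"

definition recovery_error ::
    "(real \<Rightarrow> real) set \<Rightarrow> nat \<Rightarrow> (nat \<Rightarrow> real) \<Rightarrow> ((nat \<Rightarrow> real) \<Rightarrow> real \<Rightarrow> real)
       \<Rightarrow> ((real \<Rightarrow> real) \<Rightarrow> ennreal) \<Rightarrow> ennreal" where
  "recovery_error X n u \<Psi> nrm = (SUP x\<in>X. nrm (\<lambda>\<tau>. x \<tau> - \<Psi> (samples n u x) \<tau>))"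

definition best_error ::
    "(real \<Rightarrow> real) set \<Rightarrow> nat \<Rightarrow> (nat \<Rightarrow> real) \<Rightarrow> ((real \<Rightarrow> real) \<Rightarrow> ennreal) \<Rightarrow> ennreal" where
  "best_error X n u nrm = (INF \<Psi>\<in>recovery_methods n. recovery_error X n u \<Psi> nrm)"

end

theory Submission
  imports Defs
begin

text \<open>The lower bound holds because \<open>\<phi>\<close> and \<open>-\<phi>\<close> belong to the class and have the same samples. For
  the upper bound one shows \<open>\<bar>x - s\<bar> \<le> \<bar>\<phi>\<bar>\<close> pointwise, where s interpolates x: if this failed at a
  point, a combination \<open>\<phi> - \<gamma> (x - s)\<close> with \<open>\<bar>\<gamma>\<bar> < 1\<close> would have 2n+1 zeros in a period, and
  by Rolle's theorem so would its derivative of order \<open>r - 2\<close>. But this derivative is strictly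
  monotone on 2n arcs and has no zero on the gaps between them. The inequality for \<open>x = 0\<close> and all
  multiples of s gives uniqueness of the interpolating spline, and existence follows by counting
  linear equations.

  Since \<open>deriv\<close> has junk values, all this relies on the fact that an absolutely continuous function is
  differentiable almost everywhere and controlled by its derivative, proved from Vitali's covering theorem.\<close>

section \<open>Absolutely continuous functions\<close>

text \<open>Order r - 2 is the last one that Rolle's theorem can reach: there s is only Lipschitz,
  and its slope jumps. Convexity replaces the missing derivatives. Where the r-th derivative of
  \<phi> is 1 or -1, it outweighs \<gamma> times that of x, and s contributes only a constant to the
  slope, so the combination is strictly convex or strictly concave. The space S is shaped for this.
  At a knot where the derivative of \<phi> of order r - 2 stays below M in modulus, the slopes of s
  on both sides agree and convexity continues across the knot. Where the value M is attained, s
  vanishes at that order, and the combination keeps the sign of \<phi> because \<gamma> times the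
  derivative of x is smaller than M in modulus.

  The bounds of a class are used only at such peaks and on the parts where the derivative of order r
  - 1 is constant and equal to N in modulus. Hence a class lacking one of the two bounds fits the
  same frame once a suitable constant is put in the empty place.\<close>

definition nonoverlapping :: "real \<Rightarrow> real \<Rightarrow> (real \<times> real) set \<Rightarrow> bool" where
  "nonoverlapping a b C \<longleftrightarrow> finite C \<and> (\<forall>I\<in>C. a \<le> fst I \<and> fst I < snd I \<and> snd I \<le> b) \<and>
     pairwise (\<lambda>I J. snd I \<le> fst J \<or> snd J \<le> fst I) C"

abbreviation increment :: "(real \<Rightarrow> real) \<Rightarrow> (real \<times> real) set \<Rightarrow> real" where
  "increment h C \<equiv> (\<Sum>I\<in>C. h (snd I) - h (fst I))"

text \<open>By induction on the number of intervals: the one with the largest right end lies behind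
  all others, so it is split off together with the gap behind it, if any. The identity is claimed
  for all functions at once because it is needed both for lengths and for f.\<close>

lemma nonoverlapping_complement:
  assumes "nonoverlapping a b C" "a \<le> b"
  obtains G where "nonoverlapping a b (C \<union> G)" "C \<inter> G = {}"
    "\<And>h. increment h C + increment h G = h b - h a"
proof -
  have "\<exists>G. nonoverlapping a b (C \<union> G) \<and> C \<inter> G = {} \<and> (\<forall>h. increment h C + increment h G = h b - h a)"
    using assms
  proof (induction "card C" arbitrary: C b)
    case 0
    then have C: "C = {}" by (auto simp: nonoverlapping_def)
    show ?case
      by (rule exI[of _ "if a < b then {(a, b)} else {}"])
        (use \<open>a \<le> b\<close> C in \<open>auto simp: nonoverlapping_def\<close>)
  next
    case (Suc m)
    have fin: "finite C" and ne: "C \<noteq> {}" using Suc.hyps(2) card.infinite by fastforce+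
    have "Max (snd ` C) \<in> snd ` C" using fin ne by (intro Max_in) auto
    then obtain I where I0: "I \<in> C" "snd I = Max (snd ` C)" by force
    have I: "I \<in> C" "\<And>J. J \<in> C \<Longrightarrow> snd J \<le> snd I"
      unfolding I0(2) using fin I0(1) by (auto intro: Max_ge)
    let ?C = "C - {I}"
    have J: "snd J \<le> fst I" if "J \<in> ?C" for J
    proof -
      have "fst J < snd J" "snd I \<le> fst J \<or> snd J \<le> fst I"
        using Suc.prems(1) that I(1) by (auto simp: nonoverlapping_def pairwise_def)
      then show ?thesis using I(2)[of J] that by auto
    qed
    have bI: "a \<le> fst I" "fst I < snd I" "snd I \<le> b"
      using Suc.prems(1) I(1) by (auto simp: nonoverlapping_def)
    have "nonoverlapping a (fst I) ?C"
      using Suc.prems(1) J unfolding nonoverlapping_def by (auto simp: pairwise_def)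
    moreover have "m = card ?C" using Suc.hyps(2) I(1) fin by simp
    ultimately obtain G where G: "nonoverlapping a (fst I) (?C \<union> G)" "?C \<inter> G = {}"
      "\<And>h. increment h ?C + increment h G = h (fst I) - h a"
      using Suc.hyps(1)[of ?C "fst I"] bI by blast
    have finG: "finite G" using G(1) by (simp add: nonoverlapping_def)
    have GI: "\<And>J. J \<in> G \<Longrightarrow> fst J < snd J \<and> snd J \<le> fst I"
      using G(1) by (auto simp: nonoverlapping_def)
    let ?E = "if snd I < b then {(snd I, b)} else {}"
    have dis: "G \<inter> ?E = {}" "I \<notin> G" "C \<inter> ?E = {}" using GI bI I(2) by (fastforce split: if_splits)+
    show ?case
    proof (intro exI conjI allI)
      show "nonoverlapping a b (C \<union> (G \<union> ?E))"
        unfolding nonoverlapping_def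
      proof (intro conjI)
        show "finite (C \<union> (G \<union> ?E))" using fin finG by simp
        have "a \<le> fst J \<and> fst J < snd J \<and> snd J \<le> b" if "J \<in> G" for J
          using G(1) bI that by (force simp: nonoverlapping_def)
        then show "\<forall>I\<in>C \<union> (G \<union> ?E). a \<le> fst I \<and> fst I < snd I \<and> snd I \<le> b"
          using Suc.prems(1) bI by (auto simp: nonoverlapping_def)
        have *: "C \<union> (G \<union> ?E) = insert I (?E \<union> (?C \<union> G))" using I(1) by auto
        have **: "snd K \<le> fst I" if "K \<in> ?C \<union> G" for K using J[of K] GI[of K] that by blast
        have "pairwise (\<lambda>I J. snd I \<le> fst J \<or> snd J \<le> fst I) (?C \<union> G)"
          using G(1) by (auto simp: nonoverlapping_def)
        moreover have "snd K \<le> snd I" if "K \<in> ?C \<union> G" for K using **[OF that] bI by simp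
        ultimately have "pairwise (\<lambda>I J. snd I \<le> fst J \<or> snd J \<le> fst I) (?E \<union> (?C \<union> G))"
          by (simp add: pairwise_insert)
        moreover have "snd K \<le> fst I \<or> snd I \<le> fst K" if "K \<in> ?E \<union> (?C \<union> G)" "K \<noteq> I" for K
          using **[of K] that by (cases "K \<in> ?C \<union> G") (auto split: if_splits)
        ultimately show "pairwise (\<lambda>I J. snd I \<le> fst J \<or> snd J \<le> fst I) (C \<union> (G \<union> ?E))"
          unfolding * pairwise_insert by blast
      qed
      show "C \<inter> (G \<union> ?E) = {}" using dis G(2) by blast
      fix h :: "real \<Rightarrow> real"
      have "increment h C = increment h ?C + (h (snd I) - h (fst I))"
        using I(1) fin by (simp add: sum.remove)
      moreover have "increment h (G \<union> ?E) = increment h G + increment h ?E"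
        using finG dis(1) by (intro sum.union_disjoint) auto
      moreover have "increment h ?E = h b - h (snd I)" using bI by auto
      ultimately show "increment h C + increment h (G \<union> ?E) = h b - h a" using G(3)[of h] by simp
    qed
  qed
  then show thesis using that by blast
qed

text \<open>Sets of pairs take the place of the indexed families in the definition, so that unions
  and complements need no renumbering.\<close>

lemma abs_cont_on_nonoverlapping:
  assumes "abs_cont_on a b f" "e > 0"
  obtains d where "d > 0"
    "\<And>C. nonoverlapping a b C \<Longrightarrow> increment (\<lambda>x. x) C < d \<Longrightarrow> (\<Sum>I\<in>C. \<bar>f (snd I) - f (fst I)\<bar>) < e"
proof -
  obtain d where d: "d > 0" and *: "\<forall>(m::nat) p q. (\<forall>i<m. a \<le> p i \<and> p i \<le> q i \<and> q i \<le> b) \<longrightarrow>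
        (\<forall>i<m. \<forall>j<m. i \<noteq> j \<longrightarrow> {p i<..<q i} \<inter> {p j<..<q j} = {}) \<longrightarrow>
        (\<Sum>i<m. q i - p i) < d \<longrightarrow> (\<Sum>i<m. \<bar>f (q i) - f (p i)\<bar>) < e"
    using assms(1)[unfolded abs_cont_on_def, rule_format, OF assms(2)] by (elim exE conjE) (rule that)
  show thesis
  proof (rule that[OF d])
    fix C assume C: "nonoverlapping a b C" "increment (\<lambda>x. x) C < d"
    then have fin: "finite C" by (simp add: nonoverlapping_def)
    then obtain g where g: "bij_betw g {..<card C} C"
      using ex_bij_betw_nat_finite by (metis atLeast0LessThan)
    have gC: "g i \<in> C" if "i < card C" for i using g that by (auto simp: bij_betw_def)
    have "(\<Sum>i<card C. \<bar>f (snd (g i)) - f (fst (g i))\<bar>) < e"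
    proof (rule *[THEN spec, THEN spec, THEN spec, THEN mp, THEN mp, THEN mp])
      show "\<forall>i<card C. a \<le> fst (g i) \<and> fst (g i) \<le> snd (g i) \<and> snd (g i) \<le> b"
        using C gC by (force simp: nonoverlapping_def)
      show "\<forall>i<card C. \<forall>j<card C. i \<noteq> j \<longrightarrow>
        {fst (g i)<..<snd (g i)} \<inter> {fst (g j)<..<snd (g j)} = {}"
      proof (intro allI impI)
        fix i j assume ij: "i < card C" "j < card C" "i \<noteq> j"
        then have "g i \<noteq> g j" using g by (auto simp: bij_betw_def inj_on_def)
        then have "snd (g i) \<le> fst (g j) \<or> snd (g j) \<le> fst (g i)"
          using C(1) gC ij by (auto simp: nonoverlapping_def pairwise_def)
        then show "{fst (g i)<..<snd (g i)} \<inter> {fst (g j)<..<snd (g j)} = {}" by auto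
      qed
      show "(\<Sum>i<card C. snd (g i) - fst (g i)) < d"
        using C(2) sum.reindex_bij_betw[OF g, of "\<lambda>I. snd I - fst I"] by simp
    qed
    then show "(\<Sum>I\<in>C. \<bar>f (snd I) - f (fst I)\<bar>) < e"
      using sum.reindex_bij_betw[OF g, of "\<lambda>I. \<bar>f (snd I) - f (fst I)\<bar>"] by simp
  qed
qed

text \<open>Vitali's theorem yields a countable disjoint family. Absolute continuity speaks about
  finite ones, so only finitely many intervals are kept and the lost measure goes into T. S may be
  non-measurable, and x may be an end point of its interval, so one-sided covers are
  allowed.\<close>

lemma vitali_nonoverlapping:
  assumes U: "open U" "U \<subseteq> {a<..<b}" "S \<subseteq> U"
    and P: "\<And>x d. x \<in> S \<Longrightarrow> 0 < d \<Longrightarrow> \<exists>l u. l < u \<and> l \<le> x \<and> x \<le> u \<and> u - l < d \<and> P l u"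
    and e: "e > 0"
  obtains C T where "nonoverlapping a b C" "\<And>I. I \<in> C \<Longrightarrow> {fst I..snd I} \<subseteq> U \<and> P (fst I) (snd I)"
    "T \<in> lmeasurable" "S \<subseteq> (\<Union>I\<in>C. {fst I..snd I}) \<union> T" "measure lebesgue T < e"
    "increment (\<lambda>x. x) C \<le> measure lebesgue U"
proof -
  define K where "K = {I::real\<times>real. fst I < snd I \<and> {fst I..snd I} \<subseteq> U \<and> P (fst I) (snd I)}"
  define c where "c = (\<lambda>I::real\<times>real. (fst I + snd I) / 2)"
  define r where "r = (\<lambda>I::real\<times>real. (snd I - fst I) / 2)"
  have cb: "cball (c I) (r I) = {fst I..snd I}" for I
    by (auto simp: cball_eq_atLeastAtMost c_def r_def field_simps)
  obtain C where C: "countable C" "C \<subseteq> K"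
     "pairwise (\<lambda>i j. disjnt (cball (c i) (r i)) (cball (c j) (r j))) C"
     "negligible(S - (\<Union>i \<in> C. cball (c i) (r i)))"
  proof (rule Vitali_covering_theorem_cballs[of K r S c])
    show "0 < r i" if "i \<in> K" for i using that by (auto simp: K_def r_def)
    fix x d :: real assume x: "x \<in> S" "0 < d"
    then obtain d' where d': "d' > 0" "ball x d' \<subseteq> U" using U open_contains_ball by blast
    obtain l u where lu: "l < u" "l \<le> x" "x \<le> u" "u - l < min d d'" "P l u"
      using P[of x "min d d'"] x d' by auto
    have "{l..u} \<subseteq> ball x d'" using lu by (auto simp: dist_real_def)
    then have "(l, u) \<in> K" using lu d' by (auto simp: K_def)
    moreover have "x \<in> cball (c (l, u)) (r (l, u))" using lu by (simp add: cb)
    moreover have "r (l, u) < d" using lu by (simp add: r_def)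
    ultimately show "\<exists>i. i \<in> K \<and> x \<in> cball (c i) (r i) \<and> r i < d" by blast
  qed
  have Um: "U \<in> lmeasurable"
    using U(1,2) bounded_subset[of "{a<..<b}" U] by (intro lmeasurable_open) auto
  let ?D = "(\<lambda>I. {fst I..snd I}) ` C"
  have DU: "\<Union>?D \<subseteq> U" using C(2) by (auto simp: K_def)
  have UDm: "\<Union>?D \<in> sets lebesgue" using C(1) by auto
  obtain D' where D': "D' \<subseteq> ?D" "finite D'" "measure lebesgue (\<Union>?D) - e < measure lebesgue (\<Union>D')"
  proof (rule measure_countable_Union_approachable[of ?D e "measure lebesgue U"])
    show "measure lebesgue (\<Union>D') \<le> measure lebesgue U" if "D' \<subseteq> ?D" "finite D'" for D'
      using that DU Um by (intro measure_mono_fmeasurable) (auto intro!: sets.finite_Union)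
  qed (use C e in auto)
  then obtain C' where C': "C' \<subseteq> C" "finite C'" "D' = (\<lambda>I. {fst I..snd I}) ` C'"
    using finite_subset_image[OF D'(2,1)] by blast
  have C'K: "fst I < snd I \<and> {fst I..snd I} \<subseteq> U \<and> P (fst I) (snd I)" if "I \<in> C'" for I
    using C'(1) C(2) that by (auto simp: K_def)
  have C'b: "a < fst I \<and> snd I < b" if "I \<in> C'" for I
  proof -
    have "{fst I, snd I} \<subseteq> U" using C'K[OF that] by auto
    then show ?thesis using U(2) by auto
  qed
  have dis: "{fst I..snd I} \<inter> {fst J..snd J} = {}" if "I \<in> C'" "J \<in> C'" "I \<noteq> J" for I J
    using C(3) C'(1) that unfolding pairwise_def cb disjnt_def by blast
  have non: "nonoverlapping a b C'"
    unfolding nonoverlapping_def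
  proof (intro conjI ballI)
    show "pairwise (\<lambda>I J. snd I \<le> fst J \<or> snd J \<le> fst I) C'"
    proof (rule pairwiseI)
      fix I J assume IJ: "I \<in> C'" "J \<in> C'" "I \<noteq> J"
      have "max (fst I) (fst J) \<in> {fst I..snd I} \<inter> {fst J..snd J}"
        if "\<not> (snd I \<le> fst J \<or> snd J \<le> fst I)"
        using that C'K[OF IJ(1)] C'K[OF IJ(2)] by (auto simp: max_def)
      then show "snd I \<le> fst J \<or> snd J \<le> fst I" using dis[OF IJ] by blast
    qed
  qed (use C'(2) C'K C'b in \<open>auto simp: less_imp_le\<close>)
  have inc: "increment (\<lambda>x. x) C' = measure lebesgue (\<Union>D')"
  proof -
    have "measure lebesgue (\<Union>D') = (\<Sum>I\<in>C'. measure lebesgue {fst I..snd I})"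
      unfolding C'(3)
    proof (rule measure_negligible_finite_Union_image[OF C'(2)])
      show "pairwise (\<lambda>x y. negligible ({fst x..snd x} \<inter> {fst y..snd y})) C'"
        by (rule pairwiseI, subst dis) auto
    qed auto
    also have "\<dots> = increment (\<lambda>x. x) C'" using C'K by (intro sum.cong) (auto simp: less_imp_le)
    finally show ?thesis by simp
  qed
  \<comment> \<open>The discarded intervals together with the null set missed by the whole
    family.\<close>
  let ?T = "(\<Union>?D - \<Union>D') \<union> (S - \<Union>?D)"
  have D'm: "\<Union>D' \<in> sets lebesgue" using D' by (intro sets.finite_Union) auto
  have D'D: "\<Union>D' \<subseteq> \<Union>?D" using D'(1) by blast
  have fm: "\<Union>?D \<in> lmeasurable" using DU UDm Um fmeasurableI2 by blast
  have neg: "negligible (S - \<Union>?D)" using C(4) by (simp add: cb)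
  have T1: "\<Union>?D - \<Union>D' \<in> lmeasurable" by (rule fmeasurable_Diff[OF fm D'm])
  have mT: "measure lebesgue ?T = measure lebesgue (\<Union>?D - \<Union>D')"
    by (rule measure_negligible_symdiff[OF T1]) (rule negligible_subset[OF neg], auto)
  have mT2: "measure lebesgue (\<Union>?D - \<Union>D') = measure lebesgue (\<Union>?D) - measure lebesgue (\<Union>D')"
    using fm D'm D'D by (intro measurable_measure_Diff) auto
  show thesis
  proof (rule that[of C' ?T])
    show "?T \<in> lmeasurable" using T1 neg by (simp add: fmeasurable.Un negligible_imp_measurable)
    show "S \<subseteq> (\<Union>I\<in>C'. {fst I..snd I}) \<union> ?T" using C'(3) by auto
    show "measure lebesgue ?T < e" using mT mT2 D'(3) by linarith
    show "increment (\<lambda>x. x) C' \<le> measure lebesgue U"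
      unfolding inc using D'D DU Um D'm by (intro measure_mono_fmeasurable) auto
  qed (use non C'K in auto)
qed

text \<open>m is the outer measure of S. It stands in for the measure, so that the exceptional sets
  below need not be shown measurable.\<close>

lemma not_negligible_outer:
  fixes S :: "real set"
  assumes "\<not> negligible S" "S \<subseteq> {a<..<b}"
  obtains m where "m > 0" "\<And>T. T \<in> lmeasurable \<Longrightarrow> S \<subseteq> T \<Longrightarrow> m \<le> measure lebesgue T"
    "\<And>e. e > 0 \<Longrightarrow> \<exists>U. open U \<and> S \<subseteq> U \<and> U \<subseteq> {a<..<b} \<and> measure lebesgue U < m + e"
proof -
  let ?M = "measure lebesgue ` {T \<in> lmeasurable. S \<subseteq> T}"
  define m where "m = Inf ?M"
  have "{a<..<b} \<in> {T \<in> lmeasurable. S \<subseteq> T}" using assms(2) by auto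
  then have ne: "?M \<noteq> {}" by blast
  have bdd: "bdd_below ?M" by (rule bdd_belowI[of _ 0]) auto
  have less: "\<exists>T \<in> lmeasurable. S \<subseteq> T \<and> measure lebesgue T < y" if "m < y" for y
    using that cInf_less_iff[OF ne bdd, of y] unfolding m_def by blast
  have "m > 0"
  proof (rule ccontr)
    assume "\<not> m > 0"
    have "negligible S" unfolding negligible_outer
    proof (intro allI impI)
      fix e :: real assume "0 < e"
      then have "m < e" using \<open>\<not> m > 0\<close> by simp
      then show "\<exists>T. S \<subseteq> T \<and> T \<in> lmeasurable \<and> measure lebesgue T < e" using less by blast
    qed
    then show False using assms by simp
  qed
  then show thesis
  proof (rule that)
    show "m \<le> measure lebesgue T" if "T \<in> lmeasurable" "S \<subseteq> T" for T
      unfolding m_def using that bdd by (intro cInf_lower) auto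
    fix e :: real assume e: "e > 0"
    then obtain T where T: "T \<in> lmeasurable" "S \<subseteq> T" "measure lebesgue T < m + e / 2"
      using less[of "m + e / 2"] by auto
    obtain V where V: "open V" "T \<subseteq> V" "V - T \<in> lmeasurable" "emeasure lebesgue (V - T) < ennreal (e / 2)"
      using sets_lebesgue_outer_open[of T "e / 2"] T(1) e by auto
    have mVT: "measure lebesgue (V - T) < e / 2"
      using V(3,4) e by (simp add: emeasure_eq_measure2 ennreal_less_iff)
    have VT: "T \<union> (V - T) = V" using V(2) by auto
    have "V \<in> lmeasurable" using fmeasurable.Un[OF T(1) V(3)] by (simp only: VT)
    then have "measure lebesgue (V \<inter> {a<..<b}) \<le> measure lebesgue V"
      using V(1) by (intro measure_mono_fmeasurable) auto
    also have "\<dots> \<le> measure lebesgue T + measure lebesgue (V - T)"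
      using measure_Un_le[of T lebesgue "V - T"] T(1) V(3) VT by (simp add: fmeasurableD)
    also have "\<dots> < m + e" using T(3) mVT by simp
    finally show "\<exists>U. open U \<and> S \<subseteq> U \<and> U \<subseteq> {a<..<b} \<and> measure lebesgue U < m + e"
      using V T assms(2) by (intro exI[of _ "V \<inter> {a<..<b}"]) auto
  qed
qed

lemma measure_nonoverlapping_le:
  assumes "nonoverlapping a b C"
  shows "measure lebesgue (\<Union>I\<in>C. {fst I..snd I}) \<le> increment (\<lambda>x. x) C"
proof -
  have "measure lebesgue (\<Union>I\<in>C. {fst I..snd I}) \<le> (\<Sum>I\<in>C. measure lebesgue {fst I..snd I})"
    using assms by (intro measure_UNION_le) (auto simp: nonoverlapping_def)
  also have "\<dots> = increment (\<lambda>x. x) C"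
    using assms by (intro sum.cong) (auto simp: nonoverlapping_def less_imp_le)
  finally show ?thesis .
qed

text \<open>Two nested Vitali covers: passing from the intervals of slope below p to the intervals of
  slope above q inside them removes little length but a definite amount of increment.\<close>

lemma abs_cont_on_oscillation_negligible:
  assumes f: "abs_cont_on a b f" and "a \<le> b" "p < q"
  shows "negligible {x\<in>{a<..<b}. \<forall>d>0.
     (\<exists>l u. l < u \<and> l \<le> x \<and> x \<le> u \<and> u - l < d \<and> f u - f l < p * (u - l)) \<and>
     (\<exists>l u. l < u \<and> l \<le> x \<and> x \<le> u \<and> u - l < d \<and> f u - f l > q * (u - l))}" (is "negligible ?S")
proof (rule ccontr)
  assume "\<not> negligible ?S"
  then obtain m where m: "m > 0" "\<And>T. T \<in> lmeasurable \<Longrightarrow> ?S \<subseteq> T \<Longrightarrow> m \<le> measure lebesgue T"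
    "\<And>e. e > 0 \<Longrightarrow> \<exists>U. open U \<and> ?S \<subseteq> U \<and> U \<subseteq> {a<..<b} \<and> measure lebesgue U < m + e"
    by (rule not_negligible_outer[of ?S a b]) auto
  define c where "c = q - p"
  have c: "c > 0" using assms by (simp add: c_def)
  obtain d where d: "d > 0" "\<And>C. nonoverlapping a b C \<Longrightarrow> increment (\<lambda>x. x) C < d
      \<Longrightarrow> (\<Sum>I\<in>C. \<bar>f (snd I) - f (fst I)\<bar>) < c * m / 4"
    using abs_cont_on_nonoverlapping[OF f, of "c * m / 4"] c m(1) by auto
  \<comment> \<open>The three bounds serve in turn: the length removed, at most
    \<open>3 * \<eta>\<close>, stays below d; the second family keeps length at least 3/4 of m; and
    \<open>\<bar>p\<bar> * (3 * \<eta>)\<close> is at most \<open>c * m / 4\<close>.\<close>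
  define \<eta> where "\<eta> = min (d / 4) (min (m / 8) (c * m / (12 * (\<bar>p\<bar> + 1))))"
  have \<eta>0: "\<eta> > 0" using d(1) m(1) c by (auto simp: \<eta>_def)
  have \<eta>: "\<eta> > 0" "\<eta> \<le> d / 4" "\<eta> \<le> m / 8" "\<eta> \<le> c * m / (12 * (\<bar>p\<bar> + 1))"
    by (rule \<eta>0) (simp_all only: \<eta>_def min.cobounded1 min.coboundedI2 min.cobounded2)
  obtain U where U: "open U" "?S \<subseteq> U" "U \<subseteq> {a<..<b}" "measure lebesgue U < m + \<eta>"
    using m(3)[OF \<eta>(1)] by auto
  obtain C1 T1 where C1: "nonoverlapping a b C1"
      "\<And>I. I \<in> C1 \<Longrightarrow> {fst I..snd I} \<subseteq> U \<and> f (snd I) - f (fst I) < p * (snd I - fst I)"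
      "T1 \<in> lmeasurable" "?S \<subseteq> (\<Union>I\<in>C1. {fst I..snd I}) \<union> T1" "measure lebesgue T1 < \<eta>"
      "increment (\<lambda>x. x) C1 \<le> measure lebesgue U"
  proof (rule vitali_nonoverlapping[where U = U and S = ?S and a = a and b = b and e = \<eta>
        and P = "\<lambda>l u. f u - f l < p * (u - l)"])
    show "\<exists>l u. l < u \<and> l \<le> x \<and> x \<le> u \<and> u - l < e \<and> f u - f l < p * (u - l)"
      if "x \<in> ?S" "0 < e" for x e using that by blast
  qed (use U \<eta>(1) in blast)+
  have fin1: "finite C1" using C1(1) by (simp add: nonoverlapping_def)
  define V where "V = (\<Union>I\<in>C1. {fst I<..<snd I})"
  have V: "open V" "V \<subseteq> {a<..<b}"
  proof -
    show "open V" unfolding V_def by (intro open_UN) auto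
    have "{fst I<..<snd I} \<subseteq> {a<..<b}" if "I \<in> C1" for I
      using C1(1) that by (auto simp: nonoverlapping_def)
    then show "V \<subseteq> {a<..<b}" unfolding V_def by blast
  qed
  \<comment> \<open>Intervals of the second family lie strictly inside one of the first, so they do
    not overlap the gaps \<open>G1\<close> left by \<open>C1\<close>.\<close>
  define Q where "Q = (\<lambda>l u. f u - f l > q * (u - l) \<and> (\<exists>I\<in>C1. fst I < l \<and> u < snd I))"
  have Q: "\<exists>l u. l < u \<and> l \<le> x \<and> x \<le> u \<and> u - l < e \<and> Q l u" if x: "x \<in> ?S \<inter> V" "0 < e" for x e
  proof -
    obtain I where I: "I \<in> C1" "fst I < x" "x < snd I" using x(1) by (auto simp: V_def)
    obtain l u where lu: "l < u" "l \<le> x" "x \<le> u" "u - l < min e (min (x - fst I) (snd I - x))"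
       "f u - f l > q * (u - l)"
      using x I by (auto dest: spec[of _ "min e (min (x - fst I) (snd I - x))"])
    then show ?thesis using I by (intro exI[of _ l] exI[of _ u]) (auto simp: Q_def intro!: bexI[of _ I])
  qed
  obtain C2 T2 where C2: "nonoverlapping a b C2"
      "\<And>I. I \<in> C2 \<Longrightarrow> {fst I..snd I} \<subseteq> V \<and> Q (fst I) (snd I)"
      "T2 \<in> lmeasurable" "?S \<inter> V \<subseteq> (\<Union>I\<in>C2. {fst I..snd I}) \<union> T2" "measure lebesgue T2 < \<eta>"
      "increment (\<lambda>x. x) C2 \<le> measure lebesgue V"
  proof (rule vitali_nonoverlapping[where U = V and S = "?S \<inter> V" and a = a and b = b and e = \<eta>
        and P = Q])
  qed (use V Q \<eta>(1) in blast)+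
  have fin2: "finite C2" using C2(1) by (simp add: nonoverlapping_def)
  obtain G1 where G1: "nonoverlapping a b (C1 \<union> G1)" "C1 \<inter> G1 = {}"
    "\<And>h. increment h C1 + increment h G1 = h b - h a"
    using nonoverlapping_complement[OF C1(1) \<open>a \<le> b\<close>] by blast
  have fing: "finite G1" using G1(1) by (simp add: nonoverlapping_def)
  have sep: "snd J \<le> fst K \<or> snd K \<le> fst J" if JK: "J \<in> C2" "K \<in> G1" for J K
  proof -
    obtain I where I: "I \<in> C1" "fst I < fst J" "snd J < snd I" using C2(2)[OF JK(1)] by (auto simp: Q_def)
    then have "I \<noteq> K" using G1(2) JK by auto
    then have "snd I \<le> fst K \<or> snd K \<le> fst I"
      using G1(1) I(1) JK(2) by (auto simp: nonoverlapping_def pairwise_def)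
    then show ?thesis using I by linarith
  qed
  have nd2: "fst J < snd J" if "J \<in> C2" for J using C2(1) that by (auto simp: nonoverlapping_def)
  have dis: "C2 \<inter> G1 = {}" using sep nd2 by fastforce
  have "nonoverlapping a b (C2 \<union> G1)"
    using C2(1) G1(1) sep unfolding nonoverlapping_def pairwise_def by blast
  \<comment> \<open>R fills what \<open>C2\<close> and the gaps leave, that is, \<open>C1\<close>
    minus \<open>C2\<close>; hence its increment is the difference of theirs.\<close>
  then obtain R where R: "nonoverlapping a b ((C2 \<union> G1) \<union> R)" "(C2 \<union> G1) \<inter> R = {}"
    "\<And>h. increment h (C2 \<union> G1) + increment h R = h b - h a"
    using nonoverlapping_complement[of a b "C2 \<union> G1"] \<open>a \<le> b\<close> by blast
  have nR: "nonoverlapping a b R" using R(1) by (auto simp: nonoverlapping_def pairwise_def)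
  have incR: "increment h R = increment h C1 - increment h C2" for h
  proof -
    have "increment h (C2 \<union> G1) = increment h C2 + increment h G1"
      using fin2 fing dis by (intro sum.union_disjoint)
    then show ?thesis using R(3)[of h] G1(3)[of h] by linarith
  qed
  let ?L1 = "increment (\<lambda>x. x) C1" and ?L2 = "increment (\<lambda>x. x) C2"
  have "m \<le> ?L2 + 2 * \<eta>"
  proof -
    let ?F = "(fst ` C1 \<union> snd ` C1)" and ?W = "\<Union>I\<in>C2. {fst I..snd I}"
    have nF: "negligible ?F" using fin1 by (simp add: negligible_finite)
    have W: "?W \<in> lmeasurable" using fin2 by (intro fmeasurable.finite_UN) auto
    have "?S \<subseteq> ((?W \<union> T2) \<union> T1) \<union> ?F"
    proof
      fix x assume x: "x \<in> ?S"
      show "x \<in> ((?W \<union> T2) \<union> T1) \<union> ?F"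
      proof (cases "x \<in> V \<or> x \<in> T1")
        case True
        then show ?thesis using x C2(4) by blast
      next
        case False
        then have "x \<in> (\<Union>I\<in>C1. {fst I..snd I})" using C1(4) x by blast
        then obtain I where I: "I \<in> C1" "fst I \<le> x" "x \<le> snd I" by auto
        moreover have "\<not> (fst I < x \<and> x < snd I)" using False I(1) by (auto simp: V_def)
        ultimately have "x = fst I \<or> x = snd I" by linarith
        then show ?thesis using I by auto
      qed
    qed
    moreover have m1: "(?W \<union> T2) \<union> T1 \<in> lmeasurable" using W C1(3) C2(3) by (simp add: fmeasurable.Un)
    moreover have "measure lebesgue (((?W \<union> T2) \<union> T1) \<union> ?F) = measure lebesgue ((?W \<union> T2) \<union> T1)"
      by (rule measure_negligible_symdiff[OF m1]) (rule negligible_subset[OF nF], auto)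
    moreover have "measure lebesgue ((?W \<union> T2) \<union> T1) \<le> measure lebesgue ?W + measure lebesgue T2 + measure lebesgue T1"
      using measure_Un_le[of "?W \<union> T2" lebesgue T1] measure_Un_le[of ?W lebesgue T2] W C1(3) C2(3)
      by (simp add: fmeasurableD sets.Un)
    moreover have "((?W \<union> T2) \<union> T1) \<union> ?F \<in> lmeasurable"
      using m1 nF by (simp add: fmeasurable.Un negligible_imp_measurable)
    ultimately have "m \<le> measure lebesgue ?W + measure lebesgue T2 + measure lebesgue T1"
      using m(2)[of "((?W \<union> T2) \<union> T1) \<union> ?F"] by linarith
    then show ?thesis using measure_nonoverlapping_le[OF C2(1)] C1(5) C2(5) by linarith
  qed
  moreover have "?L1 < m + \<eta>" using C1(6) U(4) by linarith
  ultimately have \<rho>: "?L1 - ?L2 \<le> 3 * \<eta>" and L2: "?L2 \<ge> m - 2 * \<eta>" by linarith+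
  have "increment (\<lambda>x. x) R < d" using incR[of "\<lambda>x. x"] \<rho> \<eta> d(1) by linarith
  from d(2)[OF nR this] have *: "\<bar>increment f R\<bar> < c * m / 4"
    using sum_abs[of "\<lambda>I. f (snd I) - f (fst I)" R] by linarith
  have f1: "increment f C1 \<le> p * ?L1"
    unfolding sum_distrib_left using C1(2) by (intro sum_mono) (auto simp: less_imp_le)
  have f2: "increment f C2 \<ge> q * ?L2"
    unfolding sum_distrib_left using C2(2) by (intro sum_mono) (auto simp: Q_def less_imp_le)
  have \<rho>0: "?L1 - ?L2 \<ge> 0"
  proof -
    have "increment (\<lambda>x. x) R \<ge> 0" using nR by (intro sum_nonneg) (auto simp: nonoverlapping_def less_imp_le)
    then show ?thesis using incR[of "\<lambda>x. x"] by simp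
  qed
  have "p * (?L1 - ?L2) \<le> \<bar>p\<bar> * (?L1 - ?L2)" using \<rho>0 by (intro mult_right_mono) auto
  also have "\<dots> \<le> \<bar>p\<bar> * (3 * \<eta>)" using \<rho> by (intro mult_left_mono) auto
  also have "\<dots> \<le> (\<bar>p\<bar> + 1) * (3 * \<eta>)" using \<eta>(1) by (intro mult_right_mono) auto
  also have "\<dots> \<le> c * m / 4" using \<eta>(4) by (simp add: field_simps)
  finally have pp: "p * (?L1 - ?L2) \<le> c * m / 4" .
  have "c * ?L2 \<ge> c * (m - m / 4)" using L2 \<eta>(3) c by (intro mult_left_mono) auto
  then have cc: "c * ?L2 \<ge> 3 * (c * m / 4)" by (simp add: field_simps)
  \<comment> \<open>The steep intervals take away more than the short remainder can make up for: the
    increment over R is at most \<open>- (c * m / 2)\<close>, while absolute continuity bounds its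
    modulus by \<open>c * m / 4\<close>.\<close>
  have "increment f R \<le> p * (?L1 - ?L2) - c * ?L2"
    using incR[of f] f1 f2 by (simp add: c_def algebra_simps)
  then have "increment f R \<le> c * m / 4 - 3 * (c * m / 4)" using pp cc by linarith
  then show False using * c m(1) by (smt (verit) divide_pos_pos mult_pos_pos)
qed

text \<open>If the set were not null, neither would be its part in some ball of length
  \<open>2 * d / 3\<close>. There every finite family is short enough for absolute continuity to
  apply, yet slopes above \<open>2 / m\<close> on a total length of at least \<open>m / 2\<close>
  add up to 1.\<close>

lemma abs_cont_on_unbounded_quotient_negligible:
  assumes f: "abs_cont_on a b f"
  shows "negligible {x\<in>{a<..<b}. \<forall>K. \<forall>d>0.
     \<exists>l u. l < u \<and> l \<le> x \<and> x \<le> u \<and> u - l < d \<and> \<bar>f u - f l\<bar> > K * (u - l)}" (is "negligible ?S")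
proof (rule ccontr)
  assume "\<not> negligible ?S"
  obtain d where d: "d > 0" "\<And>C. nonoverlapping a b C \<Longrightarrow> increment (\<lambda>x. x) C < d
      \<Longrightarrow> (\<Sum>I\<in>C. \<bar>f (snd I) - f (fst I)\<bar>) < 1"
    using abs_cont_on_nonoverlapping[OF f, of 1] by auto
  obtain z where z: "\<not> negligible (?S \<inter> ball z (d / 3))"
  proof (rule ccontr)
    assume "\<not> thesis"
    then have "negligible (?S \<inter> ball z (d / 3))" for z using that by blast
    then have "negligible ?S"
      unfolding locally_negligible_alt[of ?S]
    proof (intro ballI exI conjI)
      fix x assume "x \<in> ?S"
      then show "x \<in> ?S \<inter> ball x (d / 3)" using d(1) by simp
      show "openin (top_of_set ?S) (?S \<inter> ball x (d / 3))" by (rule openin_open_Int[OF open_ball])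
      show "negligible (?S \<inter> ball x (d / 3))" by fact
    qed
    then show False using \<open>\<not> negligible ?S\<close> by simp
  qed
  let ?Z = "?S \<inter> ball z (d / 3)"
  obtain m where m: "m > 0" "\<And>T. T \<in> lmeasurable \<Longrightarrow> ?Z \<subseteq> T \<Longrightarrow> m \<le> measure lebesgue T"
    by (rule not_negligible_outer[OF z, of a b]) auto
  let ?U = "{a<..<b} \<inter> ball z (d / 3)"
  obtain C T where C: "nonoverlapping a b C"
      "\<And>I. I \<in> C \<Longrightarrow> {fst I..snd I} \<subseteq> ?U \<and> \<bar>f (snd I) - f (fst I)\<bar> > 2 / m * (snd I - fst I)"
      "T \<in> lmeasurable" "?Z \<subseteq> (\<Union>I\<in>C. {fst I..snd I}) \<union> T" "measure lebesgue T < m / 2"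
      "increment (\<lambda>x. x) C \<le> measure lebesgue ?U"
  proof (rule vitali_nonoverlapping[where U = ?U and S = ?Z and a = a and b = b and e = "m / 2"
        and P = "\<lambda>l u. \<bar>f u - f l\<bar> > 2 / m * (u - l)"])
    show "open ?U" "?U \<subseteq> {a<..<b}" "?Z \<subseteq> ?U" "m / 2 > 0" using m(1) by auto
    show "\<exists>l u. l < u \<and> l \<le> x \<and> x \<le> u \<and> u - l < e \<and> 2 / m * (u - l) < \<bar>f u - f l\<bar>"
      if "x \<in> ?Z" "0 < e" for x e using that by blast
  qed blast
  have W: "(\<Union>I\<in>C. {fst I..snd I}) \<in> lmeasurable"
    using C(1) by (intro fmeasurable.finite_UN) (auto simp: nonoverlapping_def)
  have "m \<le> measure lebesgue (\<Union>I\<in>C. {fst I..snd I}) + measure lebesgue T"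
    using m(2)[OF fmeasurable.Un[OF W C(3)] C(4)]
      measure_Un_le[of "\<Union>I\<in>C. {fst I..snd I}" lebesgue T] W C(3) by (simp add: fmeasurableD)
  then have L: "m / 2 \<le> increment (\<lambda>x. x) C"
    using C(5) measure_nonoverlapping_le[OF C(1)] by linarith
  have "measure lebesgue ?U \<le> measure lebesgue (ball z (d / 3))"
    by (intro measure_mono_fmeasurable) auto
  also have "\<dots> = 2 * d / 3" using d(1) by (simp add: ball_eq_greaterThanLessThan)
  finally have "increment (\<lambda>x. x) C < d" using C(6) d(1) by linarith
  from d(2)[OF C(1) this] have "(\<Sum>I\<in>C. \<bar>f (snd I) - f (fst I)\<bar>) < 1" .
  moreover have "2 / m * increment (\<lambda>x. x) C \<le> (\<Sum>I\<in>C. \<bar>f (snd I) - f (fst I)\<bar>)"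
    unfolding sum_distrib_left using C(2) by (intro sum_mono) (auto simp: less_imp_le)
  moreover have "1 \<le> 2 / m * increment (\<lambda>x. x) C" using L m(1) by (simp add: field_simps)
  ultimately show False by linarith
qed

text \<open>L is the supremum of the rational numbers that are eventually lower bounds. That
  rational p and q suffice keeps the number of exceptional sets countable.\<close>

lemma tendsto_of_no_rational_gap:
  fixes Q :: "'a \<Rightarrow> real"
  assumes F: "F \<noteq> bot" and bdd: "eventually (\<lambda>x. \<bar>Q x\<bar> \<le> K) F"
    and gap: "\<And>p q. p \<in> \<rat> \<Longrightarrow> q \<in> \<rat> \<Longrightarrow> p < q \<Longrightarrow>
      eventually (\<lambda>x. p \<le> Q x) F \<or> eventually (\<lambda>x. Q x \<le> q) F"
  shows "\<exists>L. (Q \<longlongrightarrow> L) F"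
proof -
  define A where "A = {p\<in>\<rat>. eventually (\<lambda>x. p \<le> Q x) F}"
  have up: "p \<le> K" if "p \<in> A" for p
  proof -
    have "eventually (\<lambda>x. p \<le> Q x \<and> \<bar>Q x\<bar> \<le> K) F"
      using that bdd by (auto simp: A_def eventually_conj_iff)
    then obtain x where "p \<le> Q x" "\<bar>Q x\<bar> \<le> K" using F eventually_happens by blast
    then show ?thesis by linarith
  qed
  obtain p0 where p0: "p0 \<in> \<rat>" "p0 < - K" using Rats_dense_in_real[of "- K - 1" "- K"] by auto
  have "eventually (\<lambda>x. p0 \<le> Q x) F" by (rule eventually_mono[OF bdd]) (use p0 in auto)
  then have ne: "A \<noteq> {}" using p0 by (auto simp: A_def)
  have bA: "bdd_above A" using up by (rule bdd_aboveI)
  define L where "L = Sup A"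
  have "(Q \<longlongrightarrow> L) F"
  proof (rule order_tendstoI)
    fix y assume "y < L"
    then obtain p where p: "p \<in> A" "y < p" using less_cSup_iff[OF ne bA] by (auto simp: L_def)
    then have "eventually (\<lambda>x. p \<le> Q x) F" by (simp add: A_def)
    then show "eventually (\<lambda>x. y < Q x) F" by (rule eventually_mono) (use p in auto)
  next
    fix y assume "L < y"
    then obtain q where q: "q \<in> \<rat>" "L < q" "q < y" using Rats_dense_in_real by blast
    then obtain p where p: "p \<in> \<rat>" "L < p" "p < q" using Rats_dense_in_real by blast
    have "p \<notin> A" using p(2) cSup_upper[OF _ bA, of p] by (auto simp: L_def)
    then have "\<not> eventually (\<lambda>x. p \<le> Q x) F" using p(1) by (simp add: A_def)
    then have "eventually (\<lambda>x. Q x \<le> q) F" using gap[OF p(1) q(1) p(3)] by blast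
    then show "eventually (\<lambda>x. Q x < y) F" by (rule eventually_mono) (use q in auto)
  qed
  then show ?thesis by blast
qed

text \<open>A difference quotient at x is the slope of an interval with end point x, on one side or
  the other. Off the null sets B and \<open>E (p, q)\<close> these slopes are bounded and do not
  oscillate across any rational gap, so they converge.\<close>

lemma abs_cont_on_differentiable_ae:
  assumes f: "abs_cont_on a b f"
  shows "negligible {x\<in>{a<..<b}. \<not> f differentiable (at x)}"
proof (cases "a \<le> b")
  case True
  define E where "E = (\<lambda>(p, q). {x\<in>{a<..<b}. \<forall>d>0.
     (\<exists>l u. l < u \<and> l \<le> x \<and> x \<le> u \<and> u - l < d \<and> f u - f l < p * (u - l)) \<and>
     (\<exists>l u. l < u \<and> l \<le> x \<and> x \<le> u \<and> u - l < d \<and> f u - f l > q * (u - l))})"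
  define B where "B = {x\<in>{a<..<b}. \<forall>K. \<forall>d>0.
     \<exists>l u. l < u \<and> l \<le> x \<and> x \<le> u \<and> u - l < d \<and> \<bar>f u - f l\<bar> > K * (u - l)}"
  let ?R = "{(p, q). p \<in> (\<rat>::real set) \<and> q \<in> (\<rat>::real set) \<and> p < q}"
  have "?R \<subseteq> \<rat> \<times> \<rat>" by auto
  then have "countable ?R" by (rule countable_subset) (simp add: countable_rat)
  then have "negligible (\<Union>(E ` ?R))"
    using abs_cont_on_oscillation_negligible[OF f True]
    by (intro negligible_countable_Union) (auto simp: E_def)
  moreover have "negligible B" unfolding B_def by (rule abs_cont_on_unbounded_quotient_negligible[OF f])
  ultimately have N: "negligible (B \<union> \<Union>(E ` ?R))" by (rule negligible_Un[rotated])
  have "f differentiable (at x)" if x: "x \<in> {a<..<b}" "x \<notin> B \<union> \<Union>(E ` ?R)" for x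
  proof -
    define Q where "Q = (\<lambda>h. (f (x + h) - f x) / h)"
    have near: "eventually P (at (0::real))" if "d > 0" "\<And>h. h \<noteq> 0 \<Longrightarrow> \<bar>h\<bar> < d \<Longrightarrow> P h" for P d
      unfolding eventually_at using that by (auto simp: dist_real_def)
    have up: "P (Q h)" if "h \<noteq> 0" "\<bar>h\<bar> < d"
      "\<And>l u. l < u \<Longrightarrow> l \<le> x \<Longrightarrow> x \<le> u \<Longrightarrow> u - l < d \<Longrightarrow> P ((f u - f l) / (u - l))" for P h d
    proof (cases "h > 0")
      case True
      then show ?thesis using that(3)[of x "x + h"] that(2) by (simp add: Q_def)
    next
      case False
      have "(f x - f (x + h)) / (x - (x + h)) = Q h"
        using that(1) by (simp add: Q_def divide_simps)
      then show ?thesis using that(3)[of "x + h" x] that(1,2) False by simp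
    qed
    have "\<exists>L. (Q \<longlongrightarrow> L) (at 0)"
    proof -
      obtain K d where d: "d > 0" and K: "\<And>l u. l < u \<Longrightarrow> l \<le> x \<Longrightarrow> x \<le> u \<Longrightarrow> u - l < d \<Longrightarrow> \<bar>f u - f l\<bar> \<le> K * (u - l)"
      proof -
        have "\<not> (\<forall>K. \<forall>d>0. \<exists>l u. l < u \<and> l \<le> x \<and> x \<le> u \<and> u - l < d \<and> \<bar>f u - f l\<bar> > K * (u - l))"
          using x unfolding B_def by blast
        then obtain K d where "d > 0"
          "\<nexists>l u. l < u \<and> l \<le> x \<and> x \<le> u \<and> u - l < d \<and> \<bar>f u - f l\<bar> > K * (u - l)" by blast
        moreover from this(2) have "\<bar>f u - f l\<bar> \<le> K * (u - l)"
          if "l < u" "l \<le> x" "x \<le> u" "u - l < d" for l u using that by (meson linorder_not_le)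
        ultimately show thesis using that by blast
      qed
      have "\<bar>Q h\<bar> \<le> K" if h: "h \<noteq> 0" "\<bar>h\<bar> < d" for h
        by (rule up[OF h, of "\<lambda>y. \<bar>y\<bar> \<le> K"]) (use K in \<open>auto simp: pos_divide_le_eq\<close>)
      then have 1: "eventually (\<lambda>h. \<bar>Q h\<bar> \<le> K) (at 0)" using near[OF d, of "\<lambda>h. \<bar>Q h\<bar> \<le> K"] by simp
      have 2: "eventually (\<lambda>h. p \<le> Q h) (at 0) \<or> eventually (\<lambda>h. Q h \<le> q) (at 0)"
        if pq: "p \<in> \<rat>" "q \<in> \<rat>" "p < q" for p q
      proof -
        have "x \<notin> E (p, q)" using x(2) pq by blast
        then obtain e where e: "e > 0" and
          or: "(\<forall>l u. l < u \<longrightarrow> l \<le> x \<longrightarrow> x \<le> u \<longrightarrow> u - l < e \<longrightarrow> f u - f l \<ge> p * (u - l)) \<or>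
               (\<forall>l u. l < u \<longrightarrow> l \<le> x \<longrightarrow> x \<le> u \<longrightarrow> u - l < e \<longrightarrow> f u - f l \<le> q * (u - l))"
        proof -
          have "\<not> (\<forall>d>0. (\<exists>l u. l < u \<and> l \<le> x \<and> x \<le> u \<and> u - l < d \<and> f u - f l < p * (u - l)) \<and>
            (\<exists>l u. l < u \<and> l \<le> x \<and> x \<le> u \<and> u - l < d \<and> f u - f l > q * (u - l)))"
            using x(1) \<open>x \<notin> E (p, q)\<close> unfolding E_def by blast
          then obtain e where "e > 0" "(\<nexists>l u. l < u \<and> l \<le> x \<and> x \<le> u \<and> u - l < e \<and> f u - f l < p * (u - l)) \<or>
            (\<nexists>l u. l < u \<and> l \<le> x \<and> x \<le> u \<and> u - l < e \<and> f u - f l > q * (u - l))" by blast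
          moreover from this(2) have
            "(\<forall>l u. l < u \<longrightarrow> l \<le> x \<longrightarrow> x \<le> u \<longrightarrow> u - l < e \<longrightarrow> f u - f l \<ge> p * (u - l)) \<or>
             (\<forall>l u. l < u \<longrightarrow> l \<le> x \<longrightarrow> x \<le> u \<longrightarrow> u - l < e \<longrightarrow> f u - f l \<le> q * (u - l))"
            by (meson linorder_not_le)
          ultimately show thesis using that by blast
        qed
        from or show ?thesis
        proof
          assume *: "\<forall>l u. l < u \<longrightarrow> l \<le> x \<longrightarrow> x \<le> u \<longrightarrow> u - l < e \<longrightarrow> f u - f l \<ge> p * (u - l)"
          have "p \<le> Q h" if h: "h \<noteq> 0" "\<bar>h\<bar> < e" for h
            by (rule up[OF h, of "\<lambda>y. p \<le> y"]) (use * in \<open>auto simp: pos_le_divide_eq\<close>)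
          then show ?thesis using near[OF e, of "\<lambda>h. p \<le> Q h"] by simp
        next
          assume *: "\<forall>l u. l < u \<longrightarrow> l \<le> x \<longrightarrow> x \<le> u \<longrightarrow> u - l < e \<longrightarrow> f u - f l \<le> q * (u - l)"
          have "Q h \<le> q" if h: "h \<noteq> 0" "\<bar>h\<bar> < e" for h
            by (rule up[OF h, of "\<lambda>y. y \<le> q"]) (use * in \<open>auto simp: pos_divide_le_eq\<close>)
          then show ?thesis using near[OF e, of "\<lambda>h. Q h \<le> q"] by simp
        qed
      qed
      show ?thesis by (rule tendsto_of_no_rational_gap[OF _ 1 2]) auto
    qed
    then show ?thesis by (auto simp: real_differentiable_def DERIV_def Q_def)
  qed
  then have "{x\<in>{a<..<b}. \<not> f differentiable (at x)} \<subseteq> B \<union> \<Union>(E ` ?R)" by blast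
  then show ?thesis by (rule negligible_subset[OF N])
qed auto

text \<open>Almost every point is the left end of arbitrarily short intervals of slope below some k
  slightly above K. Finitely many of them nearly fill the whole interval, and by absolute continuity
  the gaps contribute little.\<close>

lemma abs_cont_on_increment_le:
  assumes f: "abs_cont_on a b f" and ab: "a \<le> b" and N: "negligible N"
    and D: "\<And>x. x \<in> {a<..<b} - N \<Longrightarrow> \<exists>D\<le>K. (f has_real_derivative D) (at x)"
  shows "f b - f a \<le> K * (b - a)"
proof (rule field_le_epsilon)
  fix e :: real assume e: "e > 0"
  \<comment> \<open>The error e is split in three: for raising K to k, for the length missed by C,
    and for the increments over the gaps. The summand 1 keeps the denominator positive for
    \<open>a = b\<close>.\<close>
  define k where "k = K + e / (3 * (b - a + 1))"
  have kK: "K < k" using e ab by (simp add: k_def)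
  obtain d where d: "d > 0" "\<And>C. nonoverlapping a b C \<Longrightarrow> increment (\<lambda>x. x) C < d
      \<Longrightarrow> (\<Sum>I\<in>C. \<bar>f (snd I) - f (fst I)\<bar>) < e / 3"
    using abs_cont_on_nonoverlapping[OF f, of "e / 3"] e by auto
  define \<eta> where "\<eta> = min d (e / (3 * (\<bar>k\<bar> + 1)))"
  have "\<eta> > 0" using d e by (auto simp: \<eta>_def)
  let ?S = "{a<..<b} - N"
  obtain C T where C: "nonoverlapping a b C"
      "\<And>I. I \<in> C \<Longrightarrow> {fst I..snd I} \<subseteq> {a<..<b} \<and> f (snd I) - f (fst I) \<le> k * (snd I - fst I)"
      "T \<in> lmeasurable" "?S \<subseteq> (\<Union>I\<in>C. {fst I..snd I}) \<union> T" "measure lebesgue T < \<eta>"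
      "increment (\<lambda>x. x) C \<le> measure lebesgue {a<..<b}"
  proof (rule vitali_nonoverlapping[where U = "{a<..<b}" and S = ?S and a = a and b = b and e = \<eta>
        and P = "\<lambda>l u. f u - f l \<le> k * (u - l)"])
    fix x d' :: real assume x: "x \<in> ?S" "0 < d'"
    then obtain D where "D \<le> K" "(f has_real_derivative D) (at x)" using D by blast
    then have "((\<lambda>h. (f (x + h) - f x) / h) \<longlongrightarrow> D) (at 0)" "D < k" using kK by (auto simp: DERIV_def)
    then have "eventually (\<lambda>h. (f (x + h) - f x) / h < k) (at 0)" by (rule order_tendstoD)
    then obtain s where s: "s > 0" "\<And>h. h \<noteq> 0 \<Longrightarrow> \<bar>h\<bar> < s \<Longrightarrow> (f (x + h) - f x) / h < k"
      unfolding eventually_at by (auto simp: dist_real_def)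
    define h where "h = min s d' / 2"
    have h: "h > 0" "h < s" "h < d'" using s(1) x(2) by (auto simp: h_def)
    have "f (x + h) - f x \<le> k * (x + h - x)" using s(2)[of h] h by (simp add: pos_divide_less_eq)
    then show "\<exists>l u. l < u \<and> l \<le> x \<and> x \<le> u \<and> u - l < d' \<and> f u - f l \<le> k * (u - l)"
      using h by (intro exI[of _ x] exI[of _ "x + h"]) auto
  qed (use \<open>\<eta> > 0\<close> in auto)
  let ?L = "increment (\<lambda>x. x) C"
  obtain G where G: "nonoverlapping a b (C \<union> G)" "C \<inter> G = {}"
    "\<And>h. increment h C + increment h G = h b - h a"
    using nonoverlapping_complement[OF C(1) ab] by blast
  have nG: "nonoverlapping a b G" using G(1) by (auto simp: nonoverlapping_def pairwise_def)
  let ?W = "\<Union>I\<in>C. {fst I..snd I}"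
  have W: "?W \<in> lmeasurable"
    using C(1) by (intro fmeasurable.finite_UN) (auto simp: nonoverlapping_def)
  have "b - a \<le> measure lebesgue (?W \<union> T)"
  proof -
    have "measure lebesgue ((?W \<union> T) \<union> N) = measure lebesgue (?W \<union> T)"
      by (rule measure_negligible_symdiff) (use W C(3) N in \<open>auto intro: negligible_subset\<close>)
    moreover have "measure lebesgue {a<..<b} \<le> measure lebesgue ((?W \<union> T) \<union> N)"
      using C(3,4) W N by (intro measure_mono_fmeasurable) (auto simp: negligible_imp_measurable fmeasurable.Un)
    ultimately show ?thesis using ab by simp
  qed
  also have "\<dots> \<le> measure lebesgue ?W + measure lebesgue T"
    using W C(3) by (intro measure_Un_le) (auto simp: fmeasurableD)
  finally have L: "b - a < ?L + \<eta>" using measure_nonoverlapping_le[OF C(1)] C(5) by linarith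
  have L0: "?L \<le> b - a" using C(6) ab by simp
  have "increment (\<lambda>x. x) G < d" using G(3)[of "\<lambda>x. x"] L by (auto simp: \<eta>_def)
  from d(2)[OF nG this] have fG: "increment f G < e / 3"
    using sum_abs[of "\<lambda>I. f (snd I) - f (fst I)" G] by linarith
  have fC: "increment f C \<le> k * ?L"
    unfolding sum_distrib_left using C(2) by (intro sum_mono) auto
  have "- k * (b - a - ?L) \<le> \<bar>k\<bar> * (b - a - ?L)" using L0 by (intro mult_right_mono) auto
  also have "\<dots> \<le> (\<bar>k\<bar> + 1) * (e / (3 * (\<bar>k\<bar> + 1)))"
    using L0 L by (intro mult_mono) (auto simp: \<eta>_def)
  also have "\<dots> = e / 3" by (simp add: field_simps)
  finally have "k * ?L \<le> k * (b - a) + e / 3" by (simp add: algebra_simps)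
  moreover have "k * (b - a) \<le> K * (b - a) + e / 3"
  proof -
    have "e / (3 * (b - a + 1)) * (b - a) \<le> e / (3 * (b - a + 1)) * (b - a + 1)"
      using ab e by (intro mult_left_mono) auto
    also have "\<dots> = e / 3" using ab by (simp add: field_simps)
    finally show ?thesis by (simp add: k_def algebra_simps)
  qed
  ultimately show "f b - f a \<le> K * (b - a) + e" using G(3)[of f] fG fC by linarith
qed

section \<open>Local absolute continuity and bounds on increments\<close>

lemma loc_abs_cont_uminus: "loc_abs_cont f \<Longrightarrow> loc_abs_cont (\<lambda>x. - f x)"
proof -
  have "\<bar>- f x - - f y\<bar> = \<bar>f x - f y\<bar>" for x y by simp
  then show "loc_abs_cont f \<Longrightarrow> loc_abs_cont (\<lambda>x. - f x)"
    unfolding loc_abs_cont_def abs_cont_on_def by simp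
qed

lemma loc_abs_cont_differentiable_ae:
  assumes "loc_abs_cont f"
  shows "negligible {x. \<not> f differentiable (at x)}"
proof -
  have "negligible (\<Union>n::nat. {x\<in>{-real n - 1<..<real n + 1}. \<not> f differentiable (at x)})"
  proof (rule negligible_countable_Union)
    fix S assume "S \<in> range (\<lambda>n. {x\<in>{-real n - 1<..<real n + 1}. \<not> f differentiable (at x)})"
    then obtain n where "S = {x\<in>{-real n - 1<..<real n + 1}. \<not> f differentiable (at x)}" by blast
    then show "negligible S"
      using assms abs_cont_on_differentiable_ae[of "- real n - 1" "real n + 1" f]
      unfolding loc_abs_cont_def by simp
  qed auto
  moreover have "{x. \<not> f differentiable (at x)} \<subseteq> (\<Union>n::nat. {x\<in>{-real n - 1<..<real n + 1}. \<not> f differentiable (at x)})"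
  proof
    fix x assume x: "x \<in> {x. \<not> f differentiable (at x)}"
    obtain n :: nat where "\<bar>x\<bar> < n" using reals_Archimedean2 by blast
    then show "x \<in> (\<Union>n::nat. {x\<in>{-real n - 1<..<real n + 1}. \<not> f differentiable (at x)})"
      using x by (auto intro!: exI[of _ n])
  qed
  ultimately show ?thesis by (rule negligible_subset)
qed

text \<open>The bound is asked for only where a derivative exists, since elsewhere
  \<open>deriv\<close> carries no information; the other points form a null set that is added to
  N.\<close>

lemma loc_abs_cont_increment_le:
  assumes f: "loc_abs_cont f" and "a \<le> b" "negligible N"
    and "\<And>x. x \<in> {a<..<b} - N \<Longrightarrow> f differentiable (at x) \<Longrightarrow> deriv f x \<le> K"
  shows "f b - f a \<le> K * (b - a)"
proof (cases "a < b")
  case True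
  then have "abs_cont_on a b f" using f by (auto simp: loc_abs_cont_def)
  then show ?thesis
  proof (rule abs_cont_on_increment_le)
    show "negligible (N \<union> {x. \<not> f differentiable (at x)})"
      by (intro negligible_Un assms loc_abs_cont_differentiable_ae)
    fix x assume "x \<in> {a<..<b} - (N \<union> {x. \<not> f differentiable (at x)})"
    then have x: "x \<in> {a<..<b} - N" "f differentiable (at x)" by auto
    then have "(f has_real_derivative deriv f x) (at x)"
      using DERIV_deriv_iff_real_differentiable by blast
    then show "\<exists>D\<le>K. (f has_real_derivative D) (at x)" using assms(4)[OF x] by blast
  qed (use assms in auto)
qed (use assms in auto)

lemma loc_abs_cont_lipschitzI:
  assumes f: "loc_abs_cont f" and N: "negligible N"
    and D: "\<And>x. x \<notin> N \<Longrightarrow> f differentiable (at x) \<Longrightarrow> \<bar>deriv f x\<bar> \<le> L"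
  shows "\<bar>f y - f x\<bar> \<le> L * \<bar>y - x\<bar>"
proof -
  have *: "\<bar>f y - f x\<bar> \<le> L * (y - x)" if "x \<le> y" for x y
  proof -
    have "f y - f x \<le> L * (y - x)"
      by (rule loc_abs_cont_increment_le[OF f that N]) (use D in \<open>force simp: abs_le_iff\<close>)
    moreover have "(- f y) - (- f x) \<le> L * (y - x)"
    proof (rule loc_abs_cont_increment_le[OF loc_abs_cont_uminus[OF f] that N])
      fix z assume z: "z \<in> {x<..<y} - N" "(\<lambda>x. - f x) differentiable (at z)"
      then have d: "f differentiable (at z)"
        using differentiable_minus[of "\<lambda>x. - f x"] by simp
      then have "deriv (\<lambda>x. - f x) z = - deriv f z"
        by (intro DERIV_imp_deriv DERIV_minus) (simp add: DERIV_deriv_iff_real_differentiable)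
      then show "deriv (\<lambda>x. - f x) z \<le> L" using D[OF _ d] z(1) by (auto simp: abs_le_iff)
    qed
    ultimately show ?thesis by simp
  qed
  show ?thesis using *[of x y] *[of y x] by (cases "x \<le> y") (auto simp: abs_minus_commute)
qed

text \<open>At points without a derivative the hypothesis may hold by accident of the default value,
  but such points form a null set and do not affect increments.\<close>

lemma loc_abs_cont_affine:
  assumes f: "loc_abs_cont f" and c: "const_on (deriv f) c a b" and xy: "x \<in> {a..b}" "y \<in> {a..b}"
  shows "f y - f x = c * (y - x)"
proof -
  have *: "f y - f x = c * (y - x)" if "a \<le> x" "x \<le> y" "y \<le> b" for x y
  proof (rule antisym)
    show "f y - f x \<le> c * (y - x)"
      by (rule loc_abs_cont_increment_le[OF f that(2) negligible_empty])
        (use c that in \<open>auto simp: const_on_def\<close>)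
    have "(- f y) - (- f x) \<le> (- c) * (y - x)"
    proof (rule loc_abs_cont_increment_le[OF loc_abs_cont_uminus[OF f] that(2) negligible_empty])
      fix z assume z: "z \<in> {x<..<y} - {}" "(\<lambda>x. - f x) differentiable (at z)"
      then have d: "f differentiable (at z)"
        using differentiable_minus[of "\<lambda>x. - f x"] by simp
      then have "deriv (\<lambda>x. - f x) z = - deriv f z"
        by (intro DERIV_imp_deriv DERIV_minus) (simp add: DERIV_deriv_iff_real_differentiable)
      then show "deriv (\<lambda>x. - f x) z \<le> - c" using c z that by (auto simp: const_on_def)
    qed
    then show "c * (y - x) \<le> f y - f x" by simp
  qed
  show ?thesis using *[of x y] *[of y x] xy by (cases "x \<le> y") (auto simp: algebra_simps)
qed

lemma lipschitz_imp_loc_abs_cont: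
  assumes L: "\<And>x y. \<bar>f y - f x\<bar> \<le> L * \<bar>y - x\<bar>"
  shows "loc_abs_cont f"
  unfolding loc_abs_cont_def abs_cont_on_def
proof (intro allI impI)
  fix a b e :: real assume e: "e > 0"
  show "\<exists>d>0. \<forall>(m::nat) p q. (\<forall>i<m. a \<le> p i \<and> p i \<le> q i \<and> q i \<le> b) \<longrightarrow>
           (\<forall>i<m. \<forall>j<m. i \<noteq> j \<longrightarrow> {p i<..<q i} \<inter> {p j<..<q j} = {}) \<longrightarrow>
           (\<Sum>i<m. q i - p i) < d \<longrightarrow> (\<Sum>i<m. \<bar>f (q i) - f (p i)\<bar>) < e"
  proof (intro exI[of _ "e / (\<bar>L\<bar> + 1)"] conjI allI impI)
    show "e / (\<bar>L\<bar> + 1) > 0" using e by simp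
    fix m :: nat and p q :: "nat \<Rightarrow> real"
    assume pq: "\<forall>i<m. a \<le> p i \<and> p i \<le> q i \<and> q i \<le> b" and s: "(\<Sum>i<m. q i - p i) < e / (\<bar>L\<bar> + 1)"
    have "(\<Sum>i<m. \<bar>f (q i) - f (p i)\<bar>) \<le> (\<Sum>i<m. (\<bar>L\<bar> + 1) * (q i - p i))"
    proof (rule sum_mono)
      fix i assume "i \<in> {..<m}"
      then have "\<bar>f (q i) - f (p i)\<bar> \<le> L * (q i - p i)" "q i - p i \<ge> 0" using pq L[of "q i" "p i"] by auto
      moreover have "L * (q i - p i) \<le> (\<bar>L\<bar> + 1) * (q i - p i)" using calculation(2) by (intro mult_right_mono) auto
      ultimately show "\<bar>f (q i) - f (p i)\<bar> \<le> (\<bar>L\<bar> + 1) * (q i - p i)" by linarith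
    qed
    also have "\<dots> = (\<bar>L\<bar> + 1) * (\<Sum>i<m. q i - p i)" by (rule sum_distrib_left[symmetric])
    also have "\<dots> < e" using s by (simp add: pos_less_divide_eq mult.commute)
    finally show "(\<Sum>i<m. \<bar>f (q i) - f (p i)\<bar>) < e" .
  qed
qed

section \<open>The classes in terms of Lipschitz conditions\<close>

text \<open>\<open>deriv\<close> selects from the predicate of being a derivative at t. Translation
  by a period leaves this predicate unchanged, hence also the selected value, even where no
  derivative exists.\<close>

lemma periodic_deriv:
  assumes "periodic f"
  shows "periodic (deriv f)"
proof -
  have "(\<lambda>x. f (x + 2 * pi)) = f" using assms by (auto simp: periodic_def)
  then have "(f has_real_derivative D) (at (t + 2 * pi)) \<longleftrightarrow> (f has_real_derivative D) (at t)" for t D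
    by (simp add: DERIV_shift)
  then show ?thesis by (simp add: periodic_def deriv_def)
qed

lemma periodic_nderiv: "periodic f \<Longrightarrow> periodic (nderiv k f)"
  by (induction k) (auto intro: periodic_deriv)

lemma periodic_add_nat: "periodic f \<Longrightarrow> f (t + 2 * pi * real l) = f t"
proof (induction l)
  case (Suc l)
  have "t + 2 * pi * real (Suc l) = (t + 2 * pi * real l) + 2 * pi" by (simp add: algebra_simps)
  then show ?case using Suc by (metis periodic_def)
qed simp

lemma periodic_add_int:
  assumes "periodic f"
  shows "f (t + 2 * pi * of_int j) = f t"
proof (cases "j \<ge> 0")
  case True
  then show ?thesis using periodic_add_nat[OF assms, of t "nat j"] by simp
next
  case False
  then show ?thesis using periodic_add_nat[OF assms, of "t + 2 * pi * of_int j" "nat (- j)"] by simp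
qed

lemma periodic_reduce:
  obtains j :: int where "t - 2 * pi * of_int j \<in> {0..<2*pi}"
proof
  show "t - 2 * pi * of_int \<lfloor>t / (2 * pi)\<rfloor> \<in> {0..<2*pi}"
    using floor_divide_lower[of "2*pi" t] floor_divide_upper[of "2*pi" t] by (auto simp: algebra_simps)
qed

section \<open>Essential bounds and Lipschitz conditions\<close>

lemma Lp_norm_inf_leD:
  assumes "Lp_norm \<infinity> f \<le> ennreal L" "0 \<le> L"
  obtains N where "negligible N" "\<And>t. t \<in> {0..2*pi} - N \<Longrightarrow> \<bar>f t\<bar> \<le> L"
proof -
  have "AE t in lebesgue_on {0..2*pi}. ennreal \<bar>f t\<bar> \<le> ennreal L"
  proof (rule eventually_mono[OF esssup_AE])
    fix t assume "ennreal \<bar>f t\<bar> \<le> esssup (lebesgue_on {0..2*pi}) (\<lambda>t. ennreal \<bar>f t\<bar>)"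
    also have "\<dots> \<le> ennreal L" using assms(1) by (simp add: Lp_norm_def)
    finally show "ennreal \<bar>f t\<bar> \<le> ennreal L" .
  qed
  then have "AE t in lebesgue. t \<in> {0..2*pi} \<longrightarrow> \<bar>f t\<bar> \<le> L"
    using assms(2) by (simp add: AE_restrict_space_iff ennreal_le_iff)
  then show thesis using that unfolding eventually_ae_filter_negligible by blast
qed

text \<open>The essential supremum of a non-measurable function is top; therefore measurability has
  to be supplied here, unlike in the converse direction.\<close>

lemma Lp_norm_inf_leI:
  assumes "f \<in> borel_measurable (lebesgue_on {0..2*pi})"
    and "negligible N" "\<And>t. t \<in> {0..2*pi} - N \<Longrightarrow> \<bar>f t\<bar> \<le> L"
  shows "Lp_norm \<infinity> f \<le> ennreal L"
proof -
  have "AE t in lebesgue. t \<in> {0..2*pi} \<longrightarrow> ennreal \<bar>f t\<bar> \<le> ennreal L"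
    unfolding eventually_ae_filter_negligible using assms(2,3)
    by (intro exI[of _ N]) (auto intro: ennreal_leI)
  then have "AE t in lebesgue_on {0..2*pi}. ennreal \<bar>f t\<bar> \<le> ennreal L"
    by (simp add: AE_restrict_space_iff)
  then show ?thesis
    unfolding Lp_norm_def using assms(1) by (auto intro!: esssup_I)
qed

lemma lipschitz_imp_deriv_le:
  assumes f: "L-lipschitz_on UNIV (f :: real \<Rightarrow> real)" and D: "(f has_real_derivative D) (at x)"
  shows "\<bar>D\<bar> \<le> L"
proof -
  have "((\<lambda>h. \<bar>(f (x + h) - f x) / h\<bar>) \<longlongrightarrow> \<bar>D\<bar>) (at 0)"
    using D unfolding DERIV_def by (intro tendsto_rabs)
  moreover have "\<forall>\<^sub>F h in at 0. \<bar>(f (x + h) - f x) / h\<bar> \<le> L"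
    using lipschitz_onD[OF f, of "x + _" x]
    by (auto simp: eventually_at_filter dist_real_def abs_divide pos_divide_le_eq)
  ultimately show ?thesis by (intro tendsto_upperbound[where F = "at 0"]) auto
qed

lemma lipschitz_real_iff: "L-lipschitz_on UNIV f \<longleftrightarrow> 0 \<le> L \<and> (\<forall>x y. \<bar>f y - f x\<bar> \<le> L * \<bar>y - (x::real)\<bar>)"
  for f :: "real \<Rightarrow> real"
  by (auto simp: lipschitz_on_def dist_real_def abs_minus_commute)

text \<open>Almost everywhere the derivative is the limit of continuous difference quotients. Since
  Lebesgue measure is complete, the default values on the remaining null set do no harm.\<close>

lemma lipschitz_measurable_deriv:
  fixes f :: "real \<Rightarrow> real"
  assumes f: "L-lipschitz_on UNIV f"
  shows "deriv f \<in> borel_measurable lebesgue"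
proof -
  define g where "g = (\<lambda>(n::nat) x. (f (x + 1 / (real n + 1)) - f x) / (1 / (real n + 1)))"
  have cf: "continuous_on A f" for A
    using lipschitz_on_continuous_on[OF f] continuous_on_subset by blast
  have "g n \<in> borel_measurable lebesgue" for n
  proof -
    have "continuous_on UNIV (g n)"
      unfolding g_def by (intro continuous_intros continuous_on_compose2[OF cf[of UNIV]]) auto
    then show ?thesis by (simp add: borel_measurable_continuous_onI measurable_completion)
  qed
  then have m: "(\<lambda>x. lim (\<lambda>n. g n x)) \<in> borel_measurable lebesgue" by measurable
  have lac: "loc_abs_cont f" using f by (intro lipschitz_imp_loc_abs_cont) (auto simp: lipschitz_real_iff)
  show ?thesis
  proof (rule borel_measurable_AE[OF m])
    show "AE x in lebesgue. lim (\<lambda>n. g n x) = deriv f x"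
      unfolding eventually_ae_filter_negligible
    proof (intro exI conjI)
      show "negligible {x. \<not> f differentiable (at x)}" by (rule loc_abs_cont_differentiable_ae[OF lac])
      have "lim (\<lambda>n. g n x) = deriv f x" if x: "f differentiable (at x)" for x
      proof (rule limI)
        have "((\<lambda>h. (f (x + h) - f x) / h) \<longlongrightarrow> deriv f x) (at 0)"
          using x by (simp add: DERIV_deriv_iff_real_differentiable flip: DERIV_def)
        moreover have "filterlim (\<lambda>n. 1 / (real n + 1)) (at 0) sequentially"
          unfolding filterlim_at using LIMSEQ_inverse_real_of_nat
          by (auto simp: inverse_eq_divide add.commute intro!: always_eventually)
        ultimately show "(\<lambda>n. g n x) \<longlonglongrightarrow> deriv f x"
          unfolding g_def by (rule filterlim_compose)
      qed
      then show "{x. lim (\<lambda>n. g n x) \<noteq> deriv f x} \<subseteq> {x. \<not> f differentiable (at x)}" by blast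
    qed
  qed
qed

text \<open>This trades the highest derivative, with its default values, for a condition on a
  function without exceptional points.\<close>

lemma Lp_norm_inf_deriv_le_iff:
  assumes per: "periodic f" and f: "loc_abs_cont f" and L: "0 \<le> L"
  shows "Lp_norm \<infinity> (deriv f) \<le> ennreal L \<longleftrightarrow> L-lipschitz_on UNIV f"
proof
  assume "Lp_norm \<infinity> (deriv f) \<le> ennreal L"
  then obtain N where N: "negligible N" "\<And>t. t \<in> {0..2*pi} - N \<Longrightarrow> \<bar>deriv f t\<bar> \<le> L"
    using L by (rule Lp_norm_inf_leD) blast
  \<comment> \<open>The norm sees one period only, so its null set is copied to all periods.\<close>
  define N' where "N' = (\<Union>j::int. (+) (2 * pi * of_int j) ` N)"
  have "negligible N'"
    unfolding N'_def by (rule negligible_countable_Union) (auto intro: negligible_translation N(1))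
  moreover have "\<bar>deriv f x\<bar> \<le> L" if "x \<notin> N'" for x
  proof -
    obtain j :: int where j: "x - 2 * pi * of_int j \<in> {0..<2*pi}" by (rule periodic_reduce)
    have "x - 2 * pi * of_int j \<notin> N"
      using that unfolding N'_def by (metis UN_I UNIV_I add.commute diff_add_cancel imageI)
    then have "\<bar>deriv f (x - 2 * pi * of_int j)\<bar> \<le> L" using j N(2) by auto
    then show ?thesis
      using periodic_add_int[OF periodic_deriv[OF per], of "x - 2 * pi * of_int j" j] by simp
  qed
  ultimately show "L-lipschitz_on UNIV f"
    using L loc_abs_cont_lipschitzI[OF f, of N' L] by (auto simp: lipschitz_real_iff)
next
  assume lip: "L-lipschitz_on UNIV f"
  show "Lp_norm \<infinity> (deriv f) \<le> ennreal L"
  proof (rule Lp_norm_inf_leI)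
    show "deriv f \<in> borel_measurable (lebesgue_on {0..2*pi})"
      by (rule measurable_restrict_space1[OF lipschitz_measurable_deriv[OF lip]])
    show "negligible {x. \<not> f differentiable (at x)}" by (rule loc_abs_cont_differentiable_ae[OF f])
    show "\<bar>deriv f t\<bar> \<le> L" if "t \<in> {0..2*pi} - {x. \<not> f differentiable (at x)}" for t
      using that by (intro lipschitz_imp_deriv_le[OF lip, of _ t]) (simp add: DERIV_deriv_iff_real_differentiable)
  qed
qed

text \<open>The set where a continuous function exceeds M in modulus is open, and an open null set
  is empty. The end points of the period follow by closure.\<close>

lemma Lp_norm_inf_le_iff:
  assumes per: "periodic f" and f: "continuous_on UNIV f" and M: "0 \<le> M"
  shows "Lp_norm \<infinity> f \<le> ennreal M \<longleftrightarrow> (\<forall>t. \<bar>f t\<bar> \<le> M)"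
proof
  assume "Lp_norm \<infinity> f \<le> ennreal M"
  then obtain N where N: "negligible N" "\<And>t. t \<in> {0..2*pi} - N \<Longrightarrow> \<bar>f t\<bar> \<le> M"
    using M by (rule Lp_norm_inf_leD) blast
  have cf: "continuous_on A (\<lambda>t. \<bar>f t\<bar>)" for A
    using continuous_on_subset[OF continuous_on_rabs[OF f]] by blast
  let ?U = "{0<..<2*pi} \<inter> {t. M < \<bar>f t\<bar>}"
  have "open ?U" by (intro open_Int open_Collect_less) (auto intro: cf)
  moreover have "?U \<subseteq> N"
  proof
    fix t assume "t \<in> ?U"
    then show "t \<in> N" using N(2)[of t] by (cases "t \<in> N") auto
  qed
  ultimately have "?U = {}" using N(1) negligible_subset open_not_negligible by blast
  then have *: "\<bar>f t\<bar> \<le> M" if "t \<in> {0<..<2*pi}" for t using that by force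
  have "\<bar>f t\<bar> \<le> M" if "t \<in> {0..2*pi}" for t
    by (rule continuous_le_on_closure[of "{0<..<2*pi}"]) (use that * cf in auto)
  then show "\<forall>t. \<bar>f t\<bar> \<le> M"
    using periodic_reduce periodic_add_int[OF per] by (metis atLeastLessThan_iff atLeastAtMost_iff diff_add_cancel less_imp_le)
next
  assume "\<forall>t. \<bar>f t\<bar> \<le> M"
  moreover have "f \<in> borel_measurable (lebesgue_on {0..2*pi})"
    by (rule measurable_restrict_space1) (simp add: f borel_measurable_continuous_onI measurable_completion)
  ultimately show "Lp_norm \<infinity> f \<le> ennreal M" by (intro Lp_norm_inf_leI[of f "{}"]) auto
qed

section \<open>Membership in the classes without exceptional sets\<close>

definition smooth :: "nat \<Rightarrow> (real \<Rightarrow> real) \<Rightarrow> bool" where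
  "smooth m f \<longleftrightarrow> (\<forall>k<m. \<forall>t. (nderiv k f has_real_derivative nderiv (Suc k) f t) (at t))"

lemma smooth_iff: "smooth m f \<longleftrightarrow> (\<forall>k<m. \<forall>t. nderiv k f differentiable (at t))"
  by (simp add: smooth_def DERIV_deriv_iff_real_differentiable)

lemma L_inf_Suc_iff:
  "f \<in> L_inf (Suc m) \<longleftrightarrow> periodic f \<and> smooth m f \<and> (\<exists>L. L-lipschitz_on UNIV (nderiv m f))"
proof
  assume f: "f \<in> L_inf (Suc m)"
  then have *: "periodic f" "smooth m f" "loc_abs_cont (nderiv m f)" "Lp_norm \<infinity> (deriv (nderiv m f)) < \<infinity>"
    by (auto simp: L_inf_def smooth_iff)
  then obtain L where L: "Lp_norm \<infinity> (deriv (nderiv m f)) = ennreal L" "L \<ge> 0"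
    by (cases "Lp_norm \<infinity> (deriv (nderiv m f))") auto
  then have "L-lipschitz_on UNIV (nderiv m f)"
    using Lp_norm_inf_deriv_le_iff[OF periodic_nderiv[OF *(1)] *(3) L(2)] by simp
  then show "periodic f \<and> smooth m f \<and> (\<exists>L. L-lipschitz_on UNIV (nderiv m f))" using * by blast
next
  assume f: "periodic f \<and> smooth m f \<and> (\<exists>L. L-lipschitz_on UNIV (nderiv m f))"
  then obtain L where L: "L-lipschitz_on UNIV (nderiv m f)" by blast
  then have lac: "loc_abs_cont (nderiv m f)" "L \<ge> 0"
    by (auto intro!: lipschitz_imp_loc_abs_cont simp: lipschitz_real_iff)
  then have "Lp_norm \<infinity> (deriv (nderiv m f)) \<le> ennreal L"
    using Lp_norm_inf_deriv_le_iff[OF periodic_nderiv lac] f L by simp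
  then have "Lp_norm \<infinity> (deriv (nderiv m f)) < \<infinity>" using ennreal_less_top le_less_trans by (simp add: order_le_less_trans)
  then show "f \<in> L_inf (Suc m)" using f lac by (auto simp: L_inf_def smooth_iff)
qed

lemma L_inf_norm_le_one_iff:
  assumes "f \<in> L_inf (Suc m)"
  shows "Lp_norm \<infinity> (nderiv (Suc m) f) \<le> 1 \<longleftrightarrow> 1-lipschitz_on UNIV (nderiv m f)"
proof -
  have "periodic f" "loc_abs_cont (nderiv m f)" using assms by (auto simp: L_inf_def)
  then show ?thesis
    using Lp_norm_inf_deriv_le_iff[OF periodic_nderiv[of f m], of 1] by simp
qed

lemma L_inf_continuous:
  assumes "f \<in> L_inf (Suc m)" "k \<le> m"
  shows "continuous_on UNIV (nderiv k f)"
proof (cases "k = m")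
  case True
  then show ?thesis using assms by (auto simp: L_inf_Suc_iff intro: lipschitz_on_continuous_on)
next
  case False
  then have "k < m" using assms by simp
  then have "isCont (nderiv k f) t" for t
    using assms(1) unfolding L_inf_Suc_iff smooth_def by (blast intro: DERIV_isCont)
  then show ?thesis by (simp add: continuous_at_imp_continuous_on)
qed

lemma L_inf_norm_le_iff:
  assumes "f \<in> L_inf (Suc m)" "k \<le> m" "0 \<le> M"
  shows "Lp_norm \<infinity> (nderiv k f) \<le> ennreal M \<longleftrightarrow> (\<forall>t. \<bar>nderiv k f t\<bar> \<le> M)"
  using Lp_norm_inf_le_iff[OF periodic_nderiv L_inf_continuous[OF assms(1,2)] assms(3)] assms(1)
  by (auto simp: L_inf_Suc_iff)

definition bounded_by :: "(real \<Rightarrow> real) \<Rightarrow> real \<Rightarrow> bool" where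
  "bounded_by f M \<longleftrightarrow> (\<forall>t. \<bar>f t\<bar> \<le> M)"

text \<open>The index is r - 1: the bound 1 on the derivative of order r is kept as a Lipschitz
  condition one order below.\<close>

definition unit_class :: "nat \<Rightarrow> (real \<Rightarrow> real) set" where
  "unit_class m = {x. periodic x \<and> smooth m x \<and> 1-lipschitz_on UNIV (nderiv m x)}"

lemma unit_class_eq: "unit_class m = {x\<in>L_inf (Suc m). Lp_norm \<infinity> (nderiv (Suc m) x) \<le> 1}"
  using L_inf_norm_le_one_iff[of _ m] unfolding unit_class_def L_inf_Suc_iff by blast

text \<open>Writing r as \<open>q + 2\<close> removes truncated subtraction; q is the order at which
  zeros will be counted.\<close>

lemma class_set_iff:
  assumes "M > 0" "N > 0"
  shows "x \<in> class_set (W1 (q + 2) M) \<longleftrightarrow> x \<in> unit_class (Suc q) \<and> bounded_by (nderiv (Suc q) x) M"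
    and "x \<in> class_set (W2 (q + 2) M) \<longleftrightarrow> x \<in> unit_class (Suc q) \<and> bounded_by (nderiv q x) M"
    and "x \<in> class_set (W12 (q + 2) M N) \<longleftrightarrow> x \<in> unit_class (Suc q) \<and>
      bounded_by (nderiv (Suc q) x) N \<and> bounded_by (nderiv q x) M"
  using assms L_inf_norm_le_iff[of x "Suc q" "Suc q" M] L_inf_norm_le_iff[of x "Suc q" "Suc q" N]
    L_inf_norm_le_iff[of x "Suc q" q M]
  unfolding unit_class_eq bounded_by_def by auto

section \<open>Counting zeros\<close>

text \<open>At least m zeros per length \<open>2 * pi\<close>, in the sense of asymptotic frequency on \<open>{a..}\<close>: this form
  passes to the derivative by Rolle's theorem without any bookkeeping about periodicity.\<close>

definition zero_rate :: "real \<Rightarrow> nat \<Rightarrow> (real \<Rightarrow> real) \<Rightarrow> bool" where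
  "zero_rate a m f \<longleftrightarrow> (\<exists>z C. strict_mono (z :: nat \<Rightarrow> real) \<and> a \<le> z 0 \<and> (\<forall>i. f (z i) = 0) \<and>
     (\<forall>L::nat. z (m * L) \<le> C + 2 * pi * L))"

text \<open>The zeros w given by Rolle's theorem interlace the zeros z, and \<open>w (m * L)\<close>
  comes before \<open>z (m * (L + 1))\<close>. The delay of one period goes into the constant
  C.\<close>

lemma zero_rate_deriv:
  assumes m: "m \<ge> 1" and d: "\<And>t. (f has_real_derivative f' t) (at t)" and f: "zero_rate a m f"
  shows "zero_rate a m f'"
proof -
  obtain z C where z: "strict_mono z" "a \<le> z 0" "\<And>i. f (z i) = 0" "\<And>L::nat. z (m * L) \<le> C + 2 * pi * L"
    using f unfolding zero_rate_def by blast
  have "\<exists>w. z i < w \<and> w < z (Suc i) \<and> f' w = 0" for i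
  proof -
    have "z i < z (Suc i)" using z(1) by (simp add: strict_mono_Suc_iff)
    moreover have "continuous_on {z i..z (Suc i)} f"
      by (meson DERIV_isCont continuous_at_imp_continuous_on d)
    ultimately obtain w where w: "z i < w" "w < z (Suc i)" "(f has_real_derivative 0) (at w)"
      using Rolle[of "z i" "z (Suc i)" f] z(3) d real_differentiable_def by metis
    then have "f' w = 0" using DERIV_unique[OF d] by blast
    then show ?thesis using w by blast
  qed
  then obtain w where w: "\<And>i. z i < w i" "\<And>i. w i < z (Suc i)" "\<And>i. f' (w i) = 0" by metis
  have "strict_mono w" unfolding strict_mono_Suc_iff using w(1,2) less_trans by blast
  moreover have "a \<le> w 0" using z(2) w(1)[of 0] by simp
  moreover have "w (m * L) \<le> (C + 2 * pi) + 2 * pi * L" for L :: nat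
  proof -
    have "w (m * L) \<le> z (m * L + 1)" using w(2)[of "m * L"] by simp
    also have "\<dots> \<le> z (m * (L + 1))" using z(1) m by (simp add: strict_mono_less_eq)
    also have "\<dots> \<le> C + 2 * pi * (L + 1)" using z(4)[of "L + 1"] by simp
    finally show ?thesis by (simp add: algebra_simps)
  qed
  ultimately show ?thesis unfolding zero_rate_def using w(3) by blast
qed

lemma zero_rate_nderiv:
  assumes "m \<ge> 1" "smooth q f" "zero_rate a m f" "k \<le> q"
  shows "zero_rate a m (nderiv k f)"
  using assms(4)
proof (induction k)
  case (Suc k)
  then have "k < q" "zero_rate a m (nderiv k f)" by simp_all
  then show ?case
    using zero_rate_deriv[OF assms(1)] assms(2) unfolding smooth_def by blast
qed (use assms in simp)

text \<open>Pigeonhole: each cell \<open>J l i\<close> holds at most one zero, and there are q cells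
  for each l, so m zeros per period in the long run force m to be at most q. It is enough to bound
  the period index l by the position of x.\<close>

lemma zero_rate_le:
  assumes f: "zero_rate a m f"
    and cover: "\<And>x. f x = 0 \<Longrightarrow> a \<le> x \<Longrightarrow> \<exists>l i. i < q \<and> 2 * pi * real l \<le> x - t \<and> x \<in> J l i"
    and single: "\<And>l i x y. x \<in> J l i \<Longrightarrow> y \<in> J l i \<Longrightarrow> f x = 0 \<Longrightarrow> f y = 0 \<Longrightarrow> x = y"
  shows "m \<le> q"
proof (rule ccontr)
  assume "\<not> m \<le> q"
  obtain z C where z: "strict_mono z" "a \<le> z 0" "\<And>i. f (z i) = 0" "\<And>L::nat. z (m * L) \<le> C + 2 * pi * L"
    using f unfolding zero_rate_def by blast
  have za: "a \<le> z i" for i using z(2) strict_mono_less_eq[OF z(1), of 0 i] by simp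
  have "\<forall>i. \<exists>p. snd p < q \<and> 2 * pi * real (fst p) \<le> z i - t \<and> z i \<in> J (fst p) (snd p)"
    using cover[OF z(3) za] by (metis fst_conv snd_conv)
  then obtain p where p: "\<And>i. snd (p i) < q" "\<And>i. 2 * pi * real (fst (p i)) \<le> z i - t"
    "\<And>i. z i \<in> J (fst (p i)) (snd (p i))" by metis
  have inj: "inj_on p A" for A
  proof (rule inj_onI)
    fix i j assume "p i = p j"
    then have "z i = z j" using single p(3) z(3) by metis
    then show "i = j" using z(1) by (simp add: strict_mono_eq)
  qed
  obtain c :: nat where c: "(C - t) / (2 * pi) \<le> c" using real_arch_simple by blast
  \<comment> \<open>There are \<open>m * L + 1\<close> zeros in at most
    \<open>(L + c + 1) * q\<close> cells. If m is at least \<open>q + 1\<close>, this L is just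
    large enough for a contradiction.\<close>
  define L where "L = (c + 1) * q"
  have "p ` {..m * L} \<subseteq> {..<L + c + 1} \<times> {..<q}"
  proof
    fix y assume "y \<in> p ` {..m * L}"
    then obtain i where i: "i \<le> m * L" "y = p i" by auto
    have "2 * pi * real (fst (p i)) \<le> z (m * L) - t"
      using p(2)[of i] i z(1) by (meson diff_right_mono order_trans strict_mono_less_eq)
    also have "\<dots> \<le> (C - t) + 2 * pi * L" using z(4)[of L] by simp
    also have "C - t \<le> 2 * pi * c" using c by (simp add: field_simps)
    finally have "2 * pi * real (fst (p i)) \<le> 2 * pi * (real c + real L)" by (simp add: algebra_simps)
    then have "real (fst (p i)) \<le> real c + real L" by simp
    then have "fst (p i) < L + c + 1" by linarith
    then show "y \<in> {..<L + c + 1} \<times> {..<q}" using p(1)[of i] i by (simp add: mem_Times_iff)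
  qed
  then have "card (p ` {..m * L}) \<le> card ({..<L + c + 1} \<times> {..<q})" by (intro card_mono) auto
  then have "m * L + 1 \<le> (L + c + 1) * q" by (simp add: card_image[OF inj] card_cartesian_product)
  moreover have "(q + 1) * L \<le> m * L" using \<open>\<not> m \<le> q\<close> by (intro mult_right_mono) auto
  ultimately show False by (simp add: L_def algebra_simps)
qed

text \<open>The sorted list of U is repeated with period \<open>2 * pi\<close>, from J periods later
  on so as to start beyond a. The half-open interval makes the step from its last element to the
  next copy of the first one strict.\<close>

lemma zero_rateI:
  assumes per: "periodic f" and U: "finite U" "U \<noteq> {}" "U \<subseteq> {b..<b + 2 * pi}" and f: "\<And>x. x \<in> U \<Longrightarrow> f x = 0"
  shows "zero_rate a (card U) f"
proof -
  define m where "m = card U"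
  have m: "m > 0" using U by (simp add: m_def card_gt_0_iff)
  define xs where "xs = sorted_list_of_set U"
  have xs: "length xs = m" "sorted_wrt (<) xs" "set xs = U"
    using U by (auto simp: xs_def m_def strict_sorted_list_of_set)
  have nth: "xs ! i \<in> U" if "i < m" for i using that xs by (metis nth_mem)
  obtain J :: nat where J: "(a - b) / (2 * pi) \<le> J" using real_arch_simple by blast
  define z where "z = (\<lambda>i. xs ! (i mod m) + 2 * pi * real (i div m + J))"
  have "strict_mono z"
    unfolding strict_mono_Suc_iff
  proof
    fix i
    show "z i < z (Suc i)"
    proof (cases "Suc (i mod m) < m")
      case True
      then have "Suc i mod m = Suc (i mod m)" "Suc i div m = i div m"
        by (simp_all add: mod_Suc div_Suc)
      then show ?thesis using xs True by (simp add: z_def sorted_wrt_nth_less)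
    next
      case False
      then have "Suc (i mod m) = m" using m by (meson Suc_lessI mod_less_divisor)
      then have "Suc i mod m = 0" "Suc i div m = Suc (i div m)"
        by (simp_all add: mod_Suc div_Suc)
      moreover have "xs ! (i mod m) < xs ! 0 + 2 * pi"
        using subsetD[OF U(3) nth[of "i mod m"]] subsetD[OF U(3) nth[of 0]] m by simp
      ultimately show ?thesis by (simp add: z_def algebra_simps)
    qed
  qed
  moreover have "a \<le> z 0"
  proof -
    have "a - b \<le> 2 * pi * J" using J by (simp add: field_simps)
    moreover have "b \<le> xs ! 0" using subsetD[OF U(3) nth[of 0]] m by simp
    ultimately show ?thesis by (simp add: z_def)
  qed
  moreover have "f (z i) = 0" for i
    using periodic_add_nat[OF per, of "xs ! (i mod m)" "i div m + J"] f nth[of "i mod m"] m by (simp add: z_def)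
  moreover have "z (m * L) \<le> (xs ! 0 + 2 * pi * J) + 2 * pi * L" for L :: nat
    using m by (simp add: z_def algebra_simps)
  ultimately show ?thesis unfolding zero_rate_def m_def by blast
qed

section \<open>The comparison argument\<close>

text \<open>With increments on the closed interval, adjacent pieces can be joined without
  differentiating at the common end point, and a one-point interval admits every slope c.\<close>

definition affine_on :: "(real \<Rightarrow> real) \<Rightarrow> real \<Rightarrow> real \<Rightarrow> real \<Rightarrow> bool" where
  "affine_on S c l r \<longleftrightarrow> (\<forall>x\<in>{l..r}. \<forall>y\<in>{l..r}. S y - S x = c * (y - x))"

lemma affine_onD: "affine_on S c l r \<Longrightarrow> l \<le> x \<Longrightarrow> x \<le> r \<Longrightarrow> l \<le> y \<Longrightarrow> y \<le> r \<Longrightarrow> S y - S x = c * (y - x)"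
  by (auto simp: affine_on_def)

lemma affine_on_join:
  assumes "affine_on S c l m" "affine_on S c m r" "l \<le> m" "m \<le> r"
  shows "affine_on S c l r"
proof -
  have *: "S y = S m + c * (y - m)" if "l \<le> y" "y \<le> r" for y
    using affine_onD[OF assms(1), of m y] affine_onD[OF assms(2), of m y] that assms(3,4)
    by (cases "y \<le> m") auto
  show ?thesis unfolding affine_on_def
  proof (intro ballI)
    fix x y assume "x \<in> {l..r}" "y \<in> {l..r}"
    then show "S y - S x = c * (y - x)" using *[of x] *[of y] by (simp add: algebra_simps)
  qed
qed

lemma affine_on_DERIV:
  assumes "affine_on S c l r" "l < t" "t < r"
  shows "(S has_real_derivative c) (at t)"
proof (rule has_field_derivative_transform_within_open[where S = "{l<..<r}"])
  show "((\<lambda>x. S t + c * (x - t)) has_real_derivative c) (at t)"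
    by (auto intro!: derivative_eq_intros)
  show "S t + c * (x - t) = S x" if "x \<in> {l<..<r}" for x
    using affine_onD[OF assms(1), of t x] that assms(2,3) by auto
qed (use assms in auto)

lemma strict_mono_on_join:
  fixes g :: "real \<Rightarrow> real"
  assumes "strict_mono_on {l..m} g" "strict_mono_on {m..r} g" "l \<le> m" "m \<le> r"
  shows "strict_mono_on {l..r} g"
proof (rule strict_mono_onI)
  fix x y assume xy: "x \<in> {l..r}" "y \<in> {l..r}" "x < y"
  consider "y \<le> m" | "m \<le> x" | "x < m" "m < y" by linarith
  then show "g x < g y"
  proof cases
    case 3
    then have "g x < g m" "g m < g y"
      using xy assms by (auto intro: strict_mono_onD[of "{l..m}"] strict_mono_onD[of "{m..r}"])
    then show ?thesis by simp
  qed (use xy assms in \<open>auto intro: strict_mono_onD[of "{l..m}"] strict_mono_onD[of "{m..r}"]\<close>)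
qed

lemma strict_mono_on_DERIV_pos:
  fixes g :: "real \<Rightarrow> real"
  assumes "continuous_on {l..r} g" "\<And>x. l < x \<Longrightarrow> x < r \<Longrightarrow> \<exists>D. (g has_real_derivative D) (at x) \<and> D > 0"
  shows "strict_mono_on {l..r} g"
proof (rule strict_mono_onI)
  fix x y assume xy: "x \<in> {l..r}" "y \<in> {l..r}" "x < y"
  show "g x < g y"
    by (rule DERIV_pos_imp_increasing_open[OF xy(3)])
      (use xy assms in \<open>auto intro: continuous_on_subset\<close>)
qed

text \<open>G increases strictly but may be discontinuous, so its change of sign is located as a
  supremum. Including l in A puts w at l when G is nowhere negative.\<close>

lemma turning_point:
  fixes F G :: "real \<Rightarrow> real"
  assumes lr: "l \<le> r" and cont: "continuous_on {l..r} F"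
    and D: "\<And>x. l < x \<Longrightarrow> x < r \<Longrightarrow> (F has_real_derivative G x) (at x)"
    and G: "\<And>x y. l \<le> x \<Longrightarrow> x < y \<Longrightarrow> y \<le> r \<Longrightarrow> G x < G y"
  obtains w where "l \<le> w" "w \<le> r" "strict_mono_on {l..w} (\<lambda>x. - F x)" "strict_mono_on {w..r} F"
proof -
  define A where "A = insert l {x\<in>{l..r}. G x < 0}"
  define w where "w = Sup A"
  have bdd: "bdd_above A" by (rule bdd_aboveI[of _ r]) (use lr in \<open>auto simp: A_def\<close>)
  have w: "l \<le> w" "w \<le> r"
    unfolding w_def using bdd lr by (auto intro!: cSup_upper cSup_least simp: A_def)
  have neg: "G x < 0" if x: "l \<le> x" "x < w" for x
  proof -
    obtain x' where x': "x' \<in> A" "x < x'"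
      using x(2) less_cSup_iff[of A x] bdd unfolding w_def A_def by blast
    then have "x' \<le> r" "G x' < 0" using x(1) by (auto simp: A_def)
    then show ?thesis using G[of x x'] x(1) x'(2) by simp
  qed
  have pos: "G x > 0" if x: "w < x" "x \<le> r" for x
  proof -
    obtain y where y: "w < y" "y < x" using dense x(1) by blast
    have "y \<notin> A" using y(1) cSup_upper[OF _ bdd, of y] by (auto simp: w_def)
    then have "G y \<ge> 0" using y x w by (auto simp: A_def)
    then show ?thesis using G[of y x] y x w by simp
  qed
  show thesis
  proof (rule that[OF w])
    show "strict_mono_on {l..w} (\<lambda>x. - F x)"
    proof (rule strict_mono_on_DERIV_pos)
      show "continuous_on {l..w} (\<lambda>x. - F x)"
        using w by (intro continuous_intros continuous_on_subset[OF cont]) auto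
      show "\<exists>D. ((\<lambda>x. - F x) has_real_derivative D) (at x) \<and> D > 0" if "l < x" "x < w" for x
        using D[of x] neg[of x] that w by (intro exI[of _ "- G x"] conjI DERIV_minus) auto
    qed
    show "strict_mono_on {w..r} F"
    proof (rule strict_mono_on_DERIV_pos)
      show "continuous_on {w..r} F" using w by (intro continuous_on_subset[OF cont]) auto
      show "\<exists>D. (F has_real_derivative D) (at x) \<and> D > 0" if "w < x" "x < r" for x
        using D[of x] pos[of x] that w by (intro exI[of _ "G x"] conjI) auto
    qed
  qed
qed

lemma constant_closed_interval:
  fixes g :: "real \<Rightarrow> real"
  assumes "continuous_on UNIV g" "\<And>t. l < t \<Longrightarrow> t < r \<Longrightarrow> g t = c" "l < r" "t \<in> {l..r}"
  shows "g t = c"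
proof (rule continuous_constant_on_closure[where S = "{l<..<r}" and f = g and x = t and a = c])
  show "continuous_on (closure {l<..<r}) g" using assms(1) continuous_on_subset by blast
qed (use assms in auto)

text \<open>The common shape of the three kinds of ideal splines: with \<open>q = r - 2\<close>, on the knot interval
  from \<open>T k\<close> to \<open>T (Suc k)\<close> the derivative of order r of \<open>\<phi>\<close> is \<open>\<epsilon> k\<close>, 0, \<open>-\<epsilon> k\<close>, 0 on the
  four parts with end points \<open>T k \<le> a k \<le> b k \<le> d k \<le> T (Suc k)\<close>. For \<open>W1\<close> the last two parts are
  empty, and for \<open>W2\<close> the second one is. The indices continue periodically.\<close>

locale spline_frame =
  fixes n q :: nat and T a b d \<epsilon> :: "nat \<Rightarrow> real" and M N :: real and \<phi> :: "real \<Rightarrow> real"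
  assumes n: "n \<ge> 1" and M: "M > 0" and N: "N > 0"
    and T_less: "T k < T (Suc k)"
    and per: "T (k + 2 * n) = T k + 2 * pi" "a (k + 2 * n) = a k + 2 * pi"
      "b (k + 2 * n) = b k + 2 * pi" "d (k + 2 * n) = d k + 2 * pi"
    and order: "T k \<le> a k" "a k \<le> b k" "b k \<le> d k" "d k \<le> T (Suc k)"
    and sign: "\<epsilon> k = 1 \<or> \<epsilon> k = -1" "\<epsilon> (Suc k) = - \<epsilon> k"
    and phi: "periodic \<phi>" "smooth (Suc q) \<phi>" "continuous_on UNIV (nderiv (Suc q) \<phi>)"
    and up: "affine_on (nderiv (Suc q) \<phi>) (\<epsilon> k) (T k) (a k)"
    and flat_N: "a k < t \<Longrightarrow> t < b k \<Longrightarrow> nderiv (Suc q) \<phi> t = \<epsilon> k * N"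
    and down: "affine_on (nderiv (Suc q) \<phi>) (- \<epsilon> k) (b k) (d k)"
    and flat_M: "d k < t \<Longrightarrow> t < T (Suc k) \<Longrightarrow> nderiv q \<phi> t = \<epsilon> k * M"
    and bound: "\<bar>nderiv q \<phi> (T (Suc k))\<bar> \<le> M"
    and peak: "\<bar>nderiv q \<phi> (T (Suc k))\<bar> = M \<Longrightarrow> nderiv q \<phi> (T (Suc k)) = \<epsilon> k * M"
    and peak_nondegenerate: "\<bar>nderiv q \<phi> (T (Suc k))\<bar> = M \<Longrightarrow> b k < d k \<and> T (Suc k) < a (Suc k)"
    and nondegenerate: "b k < d k \<or> T (Suc k) < a (Suc k)"
begin

abbreviation "f \<equiv> nderiv q \<phi>"
abbreviation "f' \<equiv> nderiv (Suc q) \<phi>"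

text \<open>Since f is bounded by M at the knots, the two implications in the definition of S become
  one alternative. Each knot thus costs exactly one linear equation.\<close>

definition spline_pieces :: "(real \<Rightarrow> real) \<Rightarrow> (nat \<Rightarrow> real) \<Rightarrow> (nat \<Rightarrow> real) \<Rightarrow> bool" where
  "spline_pieces S c1 c2 \<longleftrightarrow> (\<forall>k. affine_on S (c1 k) (T k) (a k) \<and> affine_on S 0 (a k) (b k) \<and>
     affine_on S (c2 k) (b k) (d k) \<and> affine_on S 0 (d k) (T (Suc k)) \<and>
     (if \<bar>f (T (Suc k))\<bar> = M then S (T (Suc k)) = 0 else c2 k = c1 (Suc k)))"

definition spline :: "(real \<Rightarrow> real) \<Rightarrow> bool" where
  "spline s \<longleftrightarrow> periodic s \<and> smooth q s \<and> (\<exists>L. L-lipschitz_on UNIV (nderiv q s)) \<and>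
     (\<exists>c1 c2. spline_pieces (nderiv q s) c1 c2 \<and> c1 (2 * n) = c1 0)"

lemma f_DERIV: "(f has_real_derivative f' t) (at t)"
  using phi(2) unfolding smooth_def by blast

lemma T_mono: "strict_mono T"
  using T_less by (simp add: strict_mono_Suc_iff)

lemma T_shift: "T (i + 2 * n * l) = T i + 2 * pi * real l"
proof (induction l)
  case (Suc l)
  have "T (i + 2 * n * Suc l) = T ((i + 2 * n * l) + 2 * n)" by (simp add: algebra_simps)
  then show ?case using Suc per(1)[of "i + 2 * n * l"] by (simp add: algebra_simps)
qed simp

lemma T_ge: "T 0 + 2 * pi * real (k div (2 * n)) \<le> T k"
  using T_shift[of "k mod (2 * n)" "k div (2 * n)"] strict_mono_less_eq[OF T_mono, of 0 "k mod (2 * n)"]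
  by simp

lemma f_continuous: "continuous_on UNIV f"
  using DERIV_isCont[OF f_DERIV] by (simp add: continuous_at_imp_continuous_on)

lemma flat_M_closed: "d k < T (Suc k) \<Longrightarrow> t \<in> {d k..T (Suc k)} \<Longrightarrow> f t = \<epsilon> k * M"
  by (rule constant_closed_interval[where l = "d k" and r = "T (Suc k)" and g = f, OF f_continuous flat_M])

text \<open>By continuity, a plateau would carry the modulus M up to the knot.\<close>

lemma no_plateau: "\<bar>f (T (Suc k))\<bar> \<noteq> M \<Longrightarrow> d k = T (Suc k)"
  using flat_M_closed[of k "T (Suc k)"] order(4)[of k] sign(1)[of k] M
  by (cases "d k < T (Suc k)") auto

text \<open>On the two parts adjacent to a knot the combination F is, up to sign, strictly convex, so it has
  turning points there: a single one if no constant part ends at the knot, and otherwise two, with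
  F nonzero in between. From each knot to the next F is strictly monotone between turning points.\<close>

lemma comparison_zero_rate:
  assumes X: "\<And>t. (X has_real_derivative y t) (at t)" and y: "1-lipschitz_on UNIV y"
    and yN: "\<And>k t. a k < b k \<Longrightarrow> \<bar>y t\<bar> \<le> N" and XM: "\<And>k t. \<bar>f (T (Suc k))\<bar> = M \<Longrightarrow> \<bar>X t\<bar> \<le> M"
    and S: "continuous_on UNIV S" "spline_pieces S c1 c2" and \<gamma>: "\<bar>\<gamma>\<bar> < 1"
    and zeros: "zero_rate (T 2) m (\<lambda>t. f t - \<gamma> * (X t - S t))"
  shows "m \<le> 2 * n"
proof -
  define F where "F = (\<lambda>t. f t - \<gamma> * (X t - S t))"
  define p where "p = (\<lambda>t. f' t - \<gamma> * y t)"
  have cf: "continuous_on A f" "continuous_on A X" "continuous_on A S" for A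
    using f_DERIV X S(1) by (meson DERIV_isCont continuous_at_imp_continuous_on continuous_on_subset top_greatest)+
  have cF: "continuous_on A (\<lambda>t. c * F t)" for A c
    unfolding F_def by (intro continuous_intros cf)
  \<comment> \<open>On a part where S is affine it only adds a constant to the derivative of F, so
    the monotonicity of p decides.\<close>
  have DF: "((\<lambda>t. \<sigma> * F t) has_real_derivative \<sigma> * (p t + \<gamma> * c)) (at t)"
    if "affine_on S c l r" "l < t" "t < r" for c l r t \<sigma>
    unfolding F_def p_def
    by (auto intro!: derivative_eq_intros f_DERIV X affine_on_DERIV[OF that] simp: algebra_simps)
  \<comment> \<open>Here \<open>\<bar>\<gamma>\<bar> < 1\<close> enters: f' has slope \<sigma>,
    while \<gamma> y has a Lipschitz constant below 1.\<close>
  have pinc: "\<sigma> * p s < \<sigma> * p t" if aff: "affine_on f' \<sigma> l r" and \<sigma>: "\<sigma> = 1 \<or> \<sigma> = -1"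
    and st: "l \<le> s" "s < t" "t \<le> r" for \<sigma> l r s t
  proof -
    have 1: "f' t - f' s = \<sigma> * (t - s)" by (rule affine_onD[OF aff]) (use st in auto)
    have "\<bar>y t - y s\<bar> \<le> 1 * \<bar>t - s\<bar>" using y by (auto simp: lipschitz_real_iff)
    then have "\<bar>\<sigma> * \<gamma> * (y t - y s)\<bar> \<le> \<bar>\<gamma>\<bar> * (t - s)"
      using \<sigma> st by (auto simp: abs_mult intro!: mult_left_mono)
    also have "\<dots> < t - s" using \<gamma> st by simp
    finally have "\<sigma> * \<gamma> * (y t - y s) < t - s" by linarith
    moreover have "\<sigma> * p t - \<sigma> * p s = \<sigma> * (f' t - f' s) - \<sigma> * \<gamma> * (y t - y s)"
      by (simp add: p_def algebra_simps)
    moreover have "\<sigma> * (f' t - f' s) = t - s" using \<sigma> unfolding 1 by auto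
    ultimately show ?thesis by linarith
  qed
  have turn: "\<exists>w\<ge>l. w \<le> r \<and> strict_mono_on {l..w} (\<lambda>t. - (\<sigma> * F t)) \<and> strict_mono_on {w..r} (\<lambda>t. \<sigma> * F t)"
    if aff: "affine_on f' \<sigma> l r" and \<sigma>: "\<sigma> = 1 \<or> \<sigma> = -1" and Sc: "affine_on S c l r" and lr: "l \<le> r" for \<sigma> l r c
  proof -
    obtain w where "l \<le> w" "w \<le> r" "strict_mono_on {l..w} (\<lambda>t. - (\<sigma> * F t))" "strict_mono_on {w..r} (\<lambda>t. \<sigma> * F t)"
    proof (rule turning_point[OF lr cF, where G = "\<lambda>t. \<sigma> * (p t + \<gamma> * c)"])
      show "((\<lambda>t. \<sigma> * F t) has_real_derivative \<sigma> * (p x + \<gamma> * c)) (at x)" if "l < x" "x < r" for x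
        by (rule DF[OF Sc that])
      show "\<sigma> * (p x + \<gamma> * c) < \<sigma> * (p t + \<gamma> * c)" if "l \<le> x" "x < t" "t \<le> r" for x t
        using pinc[OF aff \<sigma> that] by (simp add: algebra_simps)
    qed
    then show ?thesis by blast
  qed
  have Sp: "affine_on S (c1 k) (T k) (a k)" "affine_on S 0 (a k) (b k)" "affine_on S (c2 k) (b k) (d k)"
    "affine_on S 0 (d k) (T (Suc k))" "\<bar>f (T (Suc k))\<bar> = M \<Longrightarrow> S (T (Suc k)) = 0"
    "\<bar>f (T (Suc k))\<bar> \<noteq> M \<Longrightarrow> c2 k = c1 (Suc k)" for k
    using S(2) unfolding spline_pieces_def by (auto split: if_splits)
  have turns: "\<exists>w w'. b k \<le> w \<and> w \<le> w' \<and> w' \<le> a (Suc k) \<and>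
     strict_mono_on {b k..w} (\<lambda>t. \<epsilon> k * F t) \<and> strict_mono_on {w'..a (Suc k)} (\<lambda>t. \<epsilon> (Suc k) * F t) \<and>
     (\<forall>t. w < t \<longrightarrow> t < w' \<longrightarrow> F t \<noteq> 0)" for k
  proof -
    let ?\<sigma> = "\<epsilon> (Suc k)"
    have \<sigma>: "?\<sigma> = 1 \<or> ?\<sigma> = -1" "- \<epsilon> k = ?\<sigma>" "\<epsilon> k = - ?\<sigma>" using sign[of "Suc k"] sign(2)[of k] by auto
    have aff1: "affine_on f' ?\<sigma> (b k) (d k)" using down[of k] \<sigma>(2) by simp
    have aff2: "affine_on f' ?\<sigma> (T (Suc k)) (a (Suc k))" by (rule up)
    show ?thesis
    proof (cases "\<bar>f (T (Suc k))\<bar> = M")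
      case True
      obtain w where w: "b k \<le> w" "w \<le> d k" "strict_mono_on {b k..w} (\<lambda>t. - (?\<sigma> * F t))"
        "strict_mono_on {w..d k} (\<lambda>t. ?\<sigma> * F t)"
        using turn[OF aff1 \<sigma>(1) Sp(3) order(3)] by blast
      obtain w' where w': "T (Suc k) \<le> w'" "w' \<le> a (Suc k)"
        "strict_mono_on {T (Suc k)..w'} (\<lambda>t. - (?\<sigma> * F t))"
        "strict_mono_on {w'..a (Suc k)} (\<lambda>t. ?\<sigma> * F t)"
        using turn[OF aff2 \<sigma>(1) Sp(1) order(1)] by blast
      \<comment> \<open>On the plateau, or at the knot alone if there is none, S vanishes and f is
        \<epsilon> k M, which outweighs \<gamma> X.\<close>
      have D: "?\<sigma> * F t < 0" if t: "d k \<le> t" "t \<le> T (Suc k)" for t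
      proof -
        have "f t = \<epsilon> k * M"
        proof (cases "d k < T (Suc k)")
          case False
          then have "t = T (Suc k)" using t by linarith
          then show ?thesis using peak[OF True] by simp
        qed (use flat_M_closed[of k t] t in simp)
        moreover have "S t = 0" using affine_onD[OF Sp(4), of k t "T (Suc k)"] Sp(5)[OF True] t order(4)[of k] by simp
        ultimately have "?\<sigma> * F t = - M - ?\<sigma> * \<gamma> * X t"
          using \<sigma> by (auto simp: F_def algebra_simps)
        moreover have "\<bar>?\<sigma> * \<gamma> * X t\<bar> < M"
        proof -
          have "\<bar>?\<sigma> * \<gamma> * X t\<bar> \<le> \<bar>\<gamma>\<bar> * M"
            using XM[OF True, of t] \<sigma>(1) by (auto simp: abs_mult intro!: mult_left_mono)
          also have "\<dots> < M" using \<gamma> M by simp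
          finally show ?thesis .
        qed
        ultimately show ?thesis by linarith
      qed
      have "F t \<noteq> 0" if t: "w < t" "t < w'" for t
      proof -
        consider "t < d k" | "d k \<le> t" "t \<le> T (Suc k)" | "T (Suc k) < t" by linarith
        then have "?\<sigma> * F t < 0"
        proof cases
          case 1
          then have "?\<sigma> * F t < ?\<sigma> * F (d k)" using strict_mono_onD[OF w(4), of t "d k"] t w(2) by simp
          then show ?thesis using D[of "d k"] order(4)[of k] by simp
        next
          case 3
          then have "?\<sigma> * F t < ?\<sigma> * F (T (Suc k))"
            using strict_mono_onD[OF w'(3), of "T (Suc k)" t] t by simp
          then show ?thesis using D[of "T (Suc k)"] order(4)[of k] by simp
        qed (rule D)
        then show ?thesis by auto
      qed
      moreover have "w \<le> w'" using w(2) w'(1) order(4)[of k] by linarith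
      ultimately show ?thesis using w(1,3) w'(2,4) \<sigma>(3) by (intro exI[of _ w] exI[of _ w']) auto
    next
      case False
      \<comment> \<open>Without a peak there is no plateau and the two slopes of S agree, so the
        convexity argument runs across the knot in one piece, and both turning points are the same
        w.\<close>
      have dT: "d k = T (Suc k)" by (rule no_plateau[OF False])
      have "affine_on f' ?\<sigma> (b k) (a (Suc k))" "affine_on S (c2 k) (b k) (a (Suc k))"
        using affine_on_join[of f' ?\<sigma> "b k" "T (Suc k)" "a (Suc k)"] aff1 aff2 Sp(3)[of k] Sp(1)[of "Suc k"]
          affine_on_join[of S "c2 k" "b k" "T (Suc k)" "a (Suc k)"] Sp(6)[OF False] dT order(3)[of k] order(1)[of "Suc k"]
        by auto
      then obtain w where "b k \<le> w" "w \<le> a (Suc k)" "strict_mono_on {b k..w} (\<lambda>t. - (?\<sigma> * F t))"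
        "strict_mono_on {w..a (Suc k)} (\<lambda>t. ?\<sigma> * F t)"
        using turn[OF _ \<sigma>(1), of "b k" "a (Suc k)" "c2 k"] order(3)[of k] order(1)[of "Suc k"] dT by fastforce
      then show ?thesis using \<sigma>(3) by (intro exI[of _ w]) auto
    qed
  qed
  then obtain w w' where w: "\<And>k. b k \<le> w k" "\<And>k. w k \<le> w' k" "\<And>k. w' k \<le> a (Suc k)"
     "\<And>k. strict_mono_on {b k..w k} (\<lambda>t. \<epsilon> k * F t)"
     "\<And>k. strict_mono_on {w' k..a (Suc k)} (\<lambda>t. \<epsilon> (Suc k) * F t)"
     "\<And>k t. w k < t \<Longrightarrow> t < w' k \<Longrightarrow> F t \<noteq> 0"
    by metis
  \<comment> \<open>Between a and b the function S is constant and f' equals \<epsilon> k N, which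
    outweighs \<gamma> y.\<close>
  have flat: "strict_mono_on {a k..b k} (\<lambda>t. \<epsilon> k * F t)" for k
  proof (rule strict_mono_on_DERIV_pos[OF cF])
    fix t assume t: "a k < t" "t < b k"
    have "\<bar>\<epsilon> k * \<gamma> * y t\<bar> \<le> \<bar>\<gamma>\<bar> * N"
      using yN[of k t] t sign(1)[of k] by (auto simp: abs_mult intro!: mult_left_mono)
    also have "\<dots> < N" using \<gamma> N by simp
    finally have "0 < N - \<epsilon> k * \<gamma> * y t" by linarith
    also have "\<dots> = \<epsilon> k * (p t + \<gamma> * 0)"
      using flat_N[OF t] sign(1)[of k] by (auto simp: p_def algebra_simps)
    finally show "\<exists>D. ((\<lambda>t. \<epsilon> k * F t) has_real_derivative D) (at t) \<and> 0 < D"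
      using DF[OF Sp(2) t, of "\<epsilon> k"] by blast
  qed
  have arc: "strict_mono_on {w' k..w (Suc k)} (\<lambda>t. \<epsilon> (Suc k) * F t)" for k
    by (rule strict_mono_on_join[OF strict_mono_on_join[OF w(5) flat] w(4)])
      (use w(1,2,3)[of k] w(1,2)[of "Suc k"] order(2)[of "Suc k"] in auto)
  let ?J = "\<lambda>l i. {w' (i + 2 * n * l)..w (Suc (i + 2 * n * l))}"
  show ?thesis
  proof (rule zero_rate_le[of "T 2" m F "2 * n" "T 0" ?J])
    show "zero_rate (T 2) m F" using zeros by (simp add: F_def)
    fix x assume x: "F x = 0" "T 2 \<le> x"
    have Tw: "T k \<le> w' k" for k using order(1,2)[of k] w(1,2)[of k] by linarith
    obtain l :: nat where l: "(x - T 0) / (2 * pi) < l" using reals_Archimedean2 by blast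
    have "T (2 * n * l) = T 0 + 2 * pi * l" using T_shift[of 0 l] by simp
    then have "x < T (2 * n * l)" using l by (simp add: field_simps)
    then have ex: "x < w' (2 * n * l)" using Tw[of "2 * n * l"] by linarith
    define K where "K = (LEAST k. x < w' k)"
    have K: "x < w' K" using LeastI[of "\<lambda>k. x < w' k", OF ex] by (simp add: K_def)
    \<comment> \<open>The arcs begin at \<open>w' 0\<close>, which lies between \<open>T 0\<close>
      and \<open>T 2\<close>; this is why zeros are counted from \<open>T 2\<close> on.\<close>
    have "w' 0 \<le> x"
    proof -
      have "w' 0 \<le> a (Suc 0)" by (rule w(3))
      also have "\<dots> \<le> T 2" using order(2,3,4)[of "Suc 0"] by (simp add: numeral_2_eq_2)
      finally show ?thesis using x(2) by simp
    qed
    then have "K \<noteq> 0" using K by (metis not_less)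
    then obtain k where k: "K = Suc k" by (cases K) auto
    have "\<not> x < w' k" unfolding K_def using not_less_Least[of k "\<lambda>k. x < w' k"] k by (simp add: K_def)
    then have xk: "w' k \<le> x" "x \<le> w (Suc k)" using w(6)[of "Suc k" x] K k x(1) by force+
    show "\<exists>l i. i < 2 * n \<and> 2 * pi * real l \<le> x - T 0 \<and> x \<in> ?J l i"
    proof (intro exI conjI)
      show "k mod (2 * n) < 2 * n" using n by simp
      show "2 * pi * real (k div (2 * n)) \<le> x - T 0" using T_ge[of k] Tw[of k] xk by linarith
      show "x \<in> ?J (k div (2 * n)) (k mod (2 * n))" using xk by simp
    qed
  next
    fix l i x t assume xt: "x \<in> ?J l i" "t \<in> ?J l i" "F x = 0" "F t = 0"
    have "inj_on (\<lambda>t. \<epsilon> (Suc (i + 2 * n * l)) * F t) (?J l i)"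
      using strict_mono_on_imp_inj_on[OF arc] by blast
    then show "x = t" using xt by (auto simp: inj_on_def)
  qed
qed

end

section \<open>Periodic primitives and linear systems\<close>

lemma nderiv_eqI:
  assumes "D 0 = f" "\<And>j t. j < m \<Longrightarrow> (D j has_real_derivative D (Suc j) t) (at t)" "k \<le> m"
  shows "nderiv k f = D k"
  using assms(3)
proof (induction k)
  case (Suc k)
  then have "nderiv k f = D k" "k < m" by simp_all
  moreover have "deriv (D k) = D (Suc k)" using assms(2)[OF \<open>k < m\<close>] by (auto intro: DERIV_imp_deriv)
  ultimately show ?case by simp
qed (use assms in simp)

lemma smoothI:
  assumes "D 0 = f" "\<And>j t. j < m \<Longrightarrow> (D j has_real_derivative D (Suc j) t) (at t)"
  shows "smooth m f"
  unfolding smooth_def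
proof (intro allI impI)
  fix k t assume "k < m"
  then show "(nderiv k f has_real_derivative nderiv (Suc k) f t) (at t)"
    using nderiv_eqI[of D f m k, OF assms] nderiv_eqI[of D f m "Suc k", OF assms] assms(2)[of k t] by simp
qed

lemma smooth_lincomb:
  assumes f: "smooth m f" and g: "smooth m g"
  shows "smooth m (\<lambda>t. \<alpha> * f t + \<beta> * g t)"
    and "k \<le> m \<Longrightarrow> nderiv k (\<lambda>t. \<alpha> * f t + \<beta> * g t) = (\<lambda>t. \<alpha> * nderiv k f t + \<beta> * nderiv k g t)"
proof -
  let ?D = "\<lambda>k t. \<alpha> * nderiv k f t + \<beta> * nderiv k g t"
  have D: "(?D j has_real_derivative ?D (Suc j) t) (at t)" if "j < m" for j t
  proof -
    have "(nderiv j f has_real_derivative nderiv (Suc j) f t) (at t)"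
      "(nderiv j g has_real_derivative nderiv (Suc j) g t) (at t)"
      using f g that unfolding smooth_def by blast+
    then show ?thesis by (intro DERIV_add DERIV_cmult)
  qed
  show "smooth m (\<lambda>t. \<alpha> * f t + \<beta> * g t)" by (rule smoothI[of ?D, OF _ D]) simp
  show "nderiv k (\<lambda>t. \<alpha> * f t + \<beta> * g t) = ?D k" if "k \<le> m"
    by (rule nderiv_eqI[of ?D, OF _ D that]) simp
qed

lemma smooth_mono: "smooth m f \<Longrightarrow> k \<le> m \<Longrightarrow> smooth k f"
  by (simp add: smooth_def)

lemma nderiv_zero: "nderiv k (\<lambda>_. 0) = (\<lambda>_. 0)" and smooth_zero: "smooth m (\<lambda>_. 0)"
  using nderiv_eqI[of "\<lambda>_ _. 0" "\<lambda>_. 0" k k] smoothI[of "\<lambda>_ _. 0" "\<lambda>_. 0" m] by simp_all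

text \<open>Induction on the equations: x solves the old ones, and y solves them with a coordinate
  \<open>j0\<close> from the support of x switched off. Either y meets the new equation, or x plus a
  multiple of y does; the latter keeps the nonzero value of x at \<open>j0\<close>.\<close>

lemma linear_system_solution:
  fixes L :: "'i \<Rightarrow> ('j \<Rightarrow> real) \<Rightarrow> real"
  assumes "finite I" "finite J" "card I < card J"
    and "\<And>i x y p q. i \<in> I \<Longrightarrow> L i (\<lambda>j. p * x j + q * y j) = p * L i x + q * L i y"
  shows "\<exists>x. (\<forall>j. j \<notin> J \<longrightarrow> x j = 0) \<and> (\<exists>j. x j \<noteq> 0) \<and> (\<forall>i\<in>I. L i x = 0)"
  using assms
proof (induction I arbitrary: J rule: finite_induct)
  case empty
  then obtain j where "j \<in> J" by fastforce
  then show ?case by (intro exI[of _ "\<lambda>i. if i = j then 1 else 0"]) auto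
next
  case (insert i I)
  obtain x where x: "\<And>j. j \<notin> J \<Longrightarrow> x j = 0" "\<exists>j. x j \<noteq> 0" "\<And>i. i \<in> I \<Longrightarrow> L i x = 0"
  proof -
    have "\<exists>x. (\<forall>j. j \<notin> J \<longrightarrow> x j = 0) \<and> (\<exists>j. x j \<noteq> 0) \<and> (\<forall>i\<in>I. L i x = 0)"
      by (rule insert.IH) (use insert.prems insert.hyps in simp_all)
    then show thesis using that by blast
  qed
  obtain j0 where j0: "x j0 \<noteq> 0" using x(2) by blast
  then have "j0 \<in> J" using x(1) by blast
  then have "card I < card (J - {j0})" using insert.prems insert.hyps by simp
  then obtain y where y: "\<And>j. j \<notin> J - {j0} \<Longrightarrow> y j = 0" "\<exists>j. y j \<noteq> 0" "\<And>i. i \<in> I \<Longrightarrow> L i y = 0"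
  proof -
    have "\<exists>y. (\<forall>j. j \<notin> J - {j0} \<longrightarrow> y j = 0) \<and> (\<exists>j. y j \<noteq> 0) \<and> (\<forall>i\<in>I. L i y = 0)"
      by (rule insert.IH) (use insert.prems \<open>card I < card (J - {j0})\<close> in simp_all)
    then show thesis using that by blast
  qed
  show ?case
  proof (cases "L i y = 0")
    case True
    then show ?thesis using y by (intro exI[of _ y]) auto
  next
    case False
    define z where "z = (\<lambda>j. 1 * x j + (- L i x / L i y) * y j)"
    have Lz: "L k z = 1 * L k x + (- L i x / L i y) * L k y" if "k \<in> insert i I" for k
      unfolding z_def by (rule insert.prems(3)[OF that])
    have "z j0 \<noteq> 0" using j0 y(1)[of j0] by (simp add: z_def)
    moreover have "L k z = 0" if "k \<in> insert i I" for k
      using Lz[OF that] x(3)[of k] y(3)[of k] that False by auto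
    moreover have "z j = 0" if "j \<notin> J" for j using that x(1)[of j] y(1)[of j] by (simp add: z_def)
    ultimately show ?thesis by blast
  qed
qed

section \<open>Primitives and the periodic Bernoulli function\<close>

lemma continuous_antiderivative:
  fixes g :: "real \<Rightarrow> real"
  assumes g: "continuous_on UNIV g"
  obtains G where "\<And>t. (G has_real_derivative g t) (at t)"
proof -
  define G where "G = (\<lambda>x. integral {0..x} g - integral {x..0} g)"
  have "(G has_real_derivative g t) (at t)" for t
  proof -
    \<comment> \<open>On the interval from -R to R the signed integral from 0 differs from the
      integral from -R by a constant only.\<close>
    define R where "R = \<bar>t\<bar> + 1"
    have R: "t \<in> {-R<..<R}" "0 \<in> {-R<..<R}" by (auto simp: R_def)
    have int: "g integrable_on {x..y}" for x y
      by (intro integrable_continuous_real continuous_on_subset[OF g]) auto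
    have "((\<lambda>x. integral {-R..x} g) has_real_derivative g t) (at t within {-R..R})"
      using R by (intro integral_has_real_derivative continuous_on_subset[OF g]) auto
    then have "((\<lambda>x. integral {-R..x} g) has_real_derivative g t) (at t)"
      using R by (simp add: at_within_Icc_at)
    then have D: "((\<lambda>x. integral {-R..x} g - integral {-R..0} g) has_real_derivative g t) (at t)"
      by (auto intro!: derivative_eq_intros)
    show ?thesis
    proof (rule has_field_derivative_transform_within_open[OF D])
      fix x assume x: "x \<in> {-R<..<R}"
      show "integral {-R..x} g - integral {-R..0} g = G x"
      proof (cases "x \<ge> 0")
        case True
        then show ?thesis
          using Henstock_Kurzweil_Integration.integral_combine[of "-R" 0 x g] R int by (cases "x = 0") (auto simp: G_def)
      next
        case False
        then show ?thesis
          using Henstock_Kurzweil_Integration.integral_combine[of "-R" x 0 g] x int by (auto simp: G_def)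
      qed
    qed (use R in auto)
  qed
  then show thesis by (rule that)
qed

text \<open>Mean zero is what makes a primitive periodic, and the constant of integration can be
  chosen to restore it; so primitives can be taken repeatedly.\<close>

definition centred :: "(real \<Rightarrow> real) \<Rightarrow> bool" where
  "centred g \<longleftrightarrow> periodic g \<and> continuous_on UNIV g \<and> integral {0..2*pi} g = 0"

lemma centred_primitive:
  assumes g: "centred g"
  obtains G where "centred G" "\<And>t. (G has_real_derivative g t) (at t)"
proof -
  obtain H where H: "\<And>t. (H has_real_derivative g t) (at t)"
    using continuous_antiderivative g unfolding centred_def by blast
  define c where "c = integral {0..2*pi} H / (2 * pi)"
  define G where "G = (\<lambda>t. H t - c)"
  have D: "(G has_real_derivative g t) (at t)" for t
    unfolding G_def by (auto intro!: derivative_eq_intros H)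
  have per_g: "g (t + 2 * pi) = g t" for t using g by (simp add: centred_def periodic_def)
  have "((\<lambda>t. G (t + 2 * pi) - G t) has_real_derivative 0) (at t)" for t
  proof -
    have "((\<lambda>t. G (t + 2 * pi)) has_real_derivative g t) (at t)"
      using D[of "t + 2 * pi"] by (simp add: DERIV_shift per_g)
    then show ?thesis using DERIV_diff[OF _ D[of t]] by fastforce
  qed
  then have const: "G (t + 2 * pi) - G t = G (0 + 2 * pi) - G 0" for t
    by (rule DERIV_isconst_all[rule_format, of "\<lambda>t. G (t + 2 * pi) - G t"])
  have "(g has_integral G (2 * pi) - G 0) {0..2*pi}"
    by (rule fundamental_theorem_of_calculus)
      (use D in \<open>auto simp: has_real_derivative_iff_has_vector_derivative[symmetric] intro: has_field_derivative_at_within\<close>)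
  then have "G (2 * pi) - G 0 = 0" using g by (simp add: centred_def integral_unique)
  then have "periodic G" using const by (simp add: periodic_def)
  moreover have cont: "continuous_on A G" "continuous_on A H" for A
    using D H by (meson DERIV_isCont continuous_at_imp_continuous_on)+
  moreover have "integral {0..2*pi} G = 0"
  proof -
    have "integral {0..2*pi} G = integral {0..2*pi} H - integral {0..2*pi} (\<lambda>_. c)"
      unfolding G_def by (intro integral_diff integrable_continuous_real cont continuous_on_const)
    then show ?thesis by (simp add: c_def)
  qed
  ultimately show thesis using D by (intro that[of G]) (auto simp: centred_def)
qed

text \<open>The periodic Bernoulli function of degree 2, scaled so that its derivative jumps by -1 at 0:
  differences of its translates are the periodic piecewise affine functions with prescribed slopes.\<close>

definition bern :: "real \<Rightarrow> real" where
  "bern t = (let x = t - 2 * pi * of_int \<lfloor>t / (2 * pi)\<rfloor> in x\<^sup>2 / (4 * pi) - x / 2 + pi / 6)"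

lemma bern_periodic: "periodic bern"
proof -
  have "(t + 2 * pi) / (2 * pi) = t / (2 * pi) + of_int 1" for t by (simp add: field_simps)
  then have "\<lfloor>(t + 2 * pi) / (2 * pi)\<rfloor> = \<lfloor>t / (2 * pi)\<rfloor> + 1" for t by (metis floor_add_int)
  then show ?thesis by (simp add: periodic_def bern_def algebra_simps)
qed

text \<open>The formula extends to the right end \<open>2 * pi\<close> because the quadratic takes
  the same value there as at 0.\<close>

lemma bern_eq: "0 \<le> t \<Longrightarrow> t \<le> 2 * pi \<Longrightarrow> bern t = t\<^sup>2 / (4 * pi) - t / 2 + pi / 6"
proof (cases "t = 2 * pi")
  case True
  have "bern (2 * pi) = bern 0" using bern_periodic by (auto simp: periodic_def dest: spec[of _ 0])
  also have "\<dots> = pi / 6" by (simp add: bern_def)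
  finally show ?thesis using True by (simp add: field_simps power2_eq_square)
next
  case False
  assume "0 \<le> t" "t \<le> 2 * pi"
  then have "\<lfloor>t / (2 * pi)\<rfloor> = 0" using False by (simp add: floor_eq_iff)
  then show ?thesis by (simp add: bern_def)
qed

lemma bern_eq_minus:
  assumes "- (2 * pi) \<le> t" "t \<le> 0"
  shows "bern t = (t + 2 * pi)\<^sup>2 / (4 * pi) - (t + 2 * pi) / 2 + pi / 6"
  using bern_eq[of "t + 2 * pi"] bern_periodic assms by (simp add: periodic_def)

text \<open>Reduce x to the basic period and y to the period that starts at the reduced x, which
  does not increase their distance. If y then lies beyond \<open>2 * pi\<close>, split the step
  there.\<close>

lemma periodic_lipschitz:
  assumes g: "periodic g" and L: "L-lipschitz_on {0..2*pi} g"
  shows "L-lipschitz_on UNIV g"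
proof -
  have L0: "L \<ge> 0" using L by (rule lipschitz_on_nonneg)
  have per: "g (t + 2 * pi) = g t" for t using g by (simp add: periodic_def)
  have Lip: "\<bar>g y - g x\<bar> \<le> L * \<bar>y - x\<bar>" if "x \<in> {0..2*pi}" "y \<in> {0..2*pi}" for x y
    using lipschitz_onD[OF L that(2,1)] by (simp add: dist_real_def)
  have 1: "\<bar>g y - g x\<bar> \<le> L * (y - x)" if xy: "0 \<le> x" "x \<le> 2 * pi" "x \<le> y" "y < x + 2 * pi" for x y
  proof (cases "y \<le> 2 * pi")
    case True
    then show ?thesis using Lip[of x y] xy by simp
  next
    case False
    have "\<bar>g (y - 2 * pi) - g 0\<bar> \<le> L * (y - 2 * pi)" using Lip[of 0 "y - 2 * pi"] xy False by simp
    moreover have "g (y - 2 * pi) = g y" "g 0 = g (2 * pi)" using per[of "y - 2 * pi"] per[of 0] by simp_all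
    moreover have "\<bar>g (2 * pi) - g x\<bar> \<le> L * (2 * pi - x)" using Lip[of x "2 * pi"] xy by simp
    ultimately have "\<bar>g y - g x\<bar> \<le> L * (y - 2 * pi) + L * (2 * pi - x)" by linarith
    then show ?thesis by (simp add: algebra_simps)
  qed
  have 2: "\<bar>g y - g x\<bar> \<le> L * (y - x)" if "x \<le> y" for x y
  proof -
    obtain i :: int where i: "x - 2 * pi * of_int i \<in> {0..<2*pi}" by (rule periodic_reduce)
    obtain j :: int where j: "(y - x) - 2 * pi * of_int j \<in> {0..<2*pi}" by (rule periodic_reduce)
    define x' where "x' = x - 2 * pi * of_int i"
    define y' where "y' = x' + ((y - x) - 2 * pi * of_int j)"
    have "of_int j \<ge> (0::real)"
    proof (rule ccontr)
      assume "\<not> of_int j \<ge> (0::real)"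
      then have "j \<le> -1" by simp
      then have "of_int j \<le> (-1::real)" by linarith
      then have "2 * pi * of_int j \<le> 2 * pi * (-1)" by (intro mult_left_mono) auto
      then show False using j that by auto
    qed
    then have "y' - x' \<le> y - x" by (simp add: y'_def)
    moreover have "\<bar>g y' - g x'\<bar> \<le> L * (y' - x')" using 1[of x' y'] i j by (auto simp: x'_def y'_def)
    moreover have "g x' = g x" using periodic_add_int[OF g, of x' i] by (simp add: x'_def)
    moreover have "g y' = g y" using periodic_add_int[OF g, of y' "i + j"]
      by (simp add: x'_def y'_def algebra_simps)
    ultimately show ?thesis using L0 mult_left_mono[of "y' - x'" "y - x" L] by simp
  qed
  show ?thesis unfolding lipschitz_real_iff
  proof (intro conjI allI L0)
    fix x y show "\<bar>g y - g x\<bar> \<le> L * \<bar>y - x\<bar>"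
      using 2[of x y] 2[of y x] by (cases "x \<le> y") (auto simp: abs_minus_commute)
  qed
qed

lemma bern_lipschitz: "1-lipschitz_on UNIV bern"
proof (rule periodic_lipschitz[OF bern_periodic], rule lipschitz_onI)
  fix x y assume xy: "x \<in> {0..2*pi}" "y \<in> {0..2*pi}"
  have "bern x - bern y = (x - y) * ((x + y - 2 * pi) / (4 * pi))"
    using xy by (simp add: bern_eq field_simps power2_eq_square)
  moreover have "\<bar>(x + y - 2 * pi) / (4 * pi)\<bar> \<le> 1" using xy by (simp add: abs_le_iff divide_le_eq le_divide_eq)
  ultimately show "dist (bern x) (bern y) \<le> 1 * dist x y"
    using mult_left_mono[of "\<bar>(x + y - 2 * pi) / (4 * pi)\<bar>" 1 "\<bar>x - y\<bar>"] by (simp add: dist_real_def abs_mult)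
qed simp

lemma bern_centred: "centred bern"
proof -
  have "((\<lambda>t. t\<^sup>2 / (4 * pi) - t / 2 + pi / 6) has_integral
      ((2*pi)^3 / (12 * pi) - (2*pi)\<^sup>2 / 4 + pi * (2*pi) / 6) - (0^3 / (12 * pi) - 0\<^sup>2 / 4 + pi * 0 / 6)) {0..2*pi}"
    by (rule fundamental_theorem_of_calculus)
      (auto intro!: derivative_eq_intros simp: has_real_derivative_iff_has_vector_derivative[symmetric] field_simps)
  moreover have "((2*pi)^3 / (12 * pi) - (2*pi)\<^sup>2 / 4 + pi * (2*pi) / 6) - (0^3 / (12 * pi) - 0\<^sup>2 / 4 + pi * 0 / 6) = 0"
    by (simp add: field_simps power3_eq_cube power2_eq_square)
  ultimately have "((\<lambda>t. t\<^sup>2 / (4 * pi) - t / 2 + pi / 6) has_integral 0) {0..2*pi}" by simp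
  then have "(bern has_integral 0) {0..2*pi}" by (rule has_integral_eq[rotated]) (simp add: bern_eq)
  then show ?thesis
    using bern_periodic lipschitz_on_continuous_on[OF bern_lipschitz] by (simp add: centred_def integral_unique)
qed

lemma bern_primitives:
  obtains B :: "nat \<Rightarrow> real \<Rightarrow> real" where "B 0 = bern" "\<And>j. periodic (B j)"
    "\<And>j t. (B (Suc j) has_real_derivative B j t) (at t)"
proof -
  have "\<exists>B. \<forall>j. (centred (B j) \<and> (j = 0 \<longrightarrow> B j = bern)) \<and> (\<forall>t. (B (Suc j) has_real_derivative B j t) (at t))"
  proof (rule dependent_nat_choice)
    show "\<exists>g. centred g \<and> (0 = (0::nat) \<longrightarrow> g = bern)" using bern_centred by blast
    show "\<exists>G. (centred G \<and> (Suc j = 0 \<longrightarrow> G = bern)) \<and> (\<forall>t. (G has_real_derivative g t) (at t))"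
      if "centred g \<and> (j = 0 \<longrightarrow> g = bern)" for g :: "real \<Rightarrow> real" and j :: nat
      using centred_primitive that by (metis nat.distinct(1))
  qed
  then show thesis using that unfolding centred_def by blast
qed

text \<open>For \<open>bern\<close> the quadratic terms cancel: the slope is 1 between l and r and 0
  in the rest of the period, lowered throughout by the mean \<open>(r - l) / (2 * pi)\<close> as
  periodicity demands. A general B covers the iterated primitives as well.\<close>

definition ramp :: "(real \<Rightarrow> real) \<Rightarrow> real \<Rightarrow> real \<Rightarrow> real \<Rightarrow> real" where
  "ramp B l r t = B (t - r) - B (t - l)"

lemma ramp_periodic: "periodic B \<Longrightarrow> periodic (ramp B l r)"
proof -
  have "t + 2 * pi - s = (t - s) + 2 * pi" for t s :: real by simp
  then show "periodic B \<Longrightarrow> periodic (ramp B l r)" by (simp only: periodic_def ramp_def) simp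
qed

lemma ramp_inside:
  assumes "l \<le> x" "x \<le> r" "l \<le> y" "y \<le> r" "r \<le> l + 2 * pi"
  shows "ramp bern l r y - ramp bern l r x = (1 - (r - l) / (2 * pi)) * (y - x)"
  using assms by (simp add: ramp_def bern_eq bern_eq_minus field_simps power2_eq_square)

lemma ramp_outside:
  assumes "r \<le> x" "x \<le> l + 2 * pi" "r \<le> y" "y \<le> l + 2 * pi" "l \<le> r"
  shows "ramp bern l r y - ramp bern l r x = - ((r - l) / (2 * pi)) * (y - x)"
  using assms by (simp add: ramp_def bern_eq field_simps power2_eq_square)

section \<open>Comparison, uniqueness and existence of interpolating splines\<close>

lemma affine_on_lincomb:
  assumes "affine_on S c l r" "affine_on S' c' l r"
  shows "affine_on (\<lambda>t. \<alpha> * S t + \<beta> * S' t) (\<alpha> * c + \<beta> * c') l r"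
  unfolding affine_on_def
proof (intro ballI)
  fix x y assume xy: "x \<in> {l..r}" "y \<in> {l..r}"
  have "S y - S x = c * (y - x)" "S' y - S' x = c' * (y - x)"
    using assms xy by (auto simp: affine_on_def)
  then have "\<alpha> * (S y - S x) + \<beta> * (S' y - S' x) = \<alpha> * (c * (y - x)) + \<beta> * (c' * (y - x))" by simp
  then show "(\<alpha> * S y + \<beta> * S' y) - (\<alpha> * S x + \<beta> * S' x) = (\<alpha> * c + \<beta> * c') * (y - x)"
    by (simp add: algebra_simps)
qed

lemma lipschitz_lincomb:
  fixes f g :: "real \<Rightarrow> real"
  assumes f: "L-lipschitz_on UNIV f" and g: "K-lipschitz_on UNIV g"
  shows "(\<bar>\<alpha>\<bar> * L + \<bar>\<beta>\<bar> * K)-lipschitz_on UNIV (\<lambda>t. \<alpha> * f t + \<beta> * g t)"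
  using lipschitz_on_add[OF lipschitz_on_cmult_real[OF f, of \<alpha>] lipschitz_on_cmult_real[OF g, of \<beta>]]
  by simp

lemma affine_on_shift:
  assumes S: "periodic S" and aff: "affine_on S c l r"
  shows "affine_on S c (l + 2 * pi * real j) (r + 2 * pi * real j)"
  unfolding affine_on_def
proof (intro ballI)
  fix x y assume xy: "x \<in> {l + 2 * pi * real j..r + 2 * pi * real j}" "y \<in> {l + 2 * pi * real j..r + 2 * pi * real j}"
  have "S (y - 2 * pi * real j) - S (x - 2 * pi * real j) = c * ((y - 2 * pi * real j) - (x - 2 * pi * real j))"
    by (rule affine_onD[OF aff]) (use xy in auto)
  then show "S y - S x = c * (y - x)"
    using periodic_add_nat[OF S, of "y - 2 * pi * real j" j] periodic_add_nat[OF S, of "x - 2 * pi * real j" j] by simp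
qed

lemma periodic_lincomb: "periodic f \<Longrightarrow> periodic g \<Longrightarrow> periodic (\<lambda>t. \<alpha> * f t + \<beta> * g t)"
  by (simp add: periodic_def)

context spline_frame
begin

lemma spline_lincomb:
  assumes "spline s" "spline s'"
  shows "spline (\<lambda>t. \<alpha> * s t + \<beta> * s' t)"
proof -
  obtain L L' c1 c2 c1' c2' where s: "periodic s" "smooth q s" "L-lipschitz_on UNIV (nderiv q s)"
      "spline_pieces (nderiv q s) c1 c2" "c1 (2 * n) = c1 0"
    and s': "periodic s'" "smooth q s'" "L'-lipschitz_on UNIV (nderiv q s')"
      "spline_pieces (nderiv q s') c1' c2'" "c1' (2 * n) = c1' 0"
    using assms unfolding spline_def by blast
  have nd: "nderiv q (\<lambda>t. \<alpha> * s t + \<beta> * s' t) = (\<lambda>t. \<alpha> * nderiv q s t + \<beta> * nderiv q s' t)"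
    by (rule smooth_lincomb[OF s(2) s'(2)]) simp
  have "spline_pieces (\<lambda>t. \<alpha> * nderiv q s t + \<beta> * nderiv q s' t)
    (\<lambda>k. \<alpha> * c1 k + \<beta> * c1' k) (\<lambda>k. \<alpha> * c2 k + \<beta> * c2' k)" (is "spline_pieces _ ?c1 ?c2")
    using s(4) s'(4) affine_on_lincomb[of "nderiv q s" _ _ _ "nderiv q s'" _ \<alpha> \<beta>]
      affine_on_lincomb[of "nderiv q s" 0 _ _ "nderiv q s'" 0 \<alpha> \<beta>]
    unfolding spline_pieces_def by simp
  moreover have "?c1 (2 * n) = ?c1 0" using s(5) s'(5) by simp
  ultimately show ?thesis
    unfolding spline_def nd
    using periodic_lincomb[OF s(1) s'(1)] smooth_lincomb(1)[OF s(2) s'(2)] lipschitz_lincomb[OF s(3) s'(3)] by blast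
qed

lemma comparison:
  assumes U: "finite U" "card U = 2 * n" "U \<subseteq> {0..<2*pi}" "\<And>z. z \<in> U \<Longrightarrow> \<phi> z = 0"
    and x: "x \<in> unit_class (Suc q)"
    and xN: "\<And>k t. a k < b k \<Longrightarrow> \<bar>nderiv (Suc q) x t\<bar> \<le> N"
    and xM: "\<And>k t. \<bar>f (T (Suc k))\<bar> = M \<Longrightarrow> \<bar>nderiv q x t\<bar> \<le> M"
    and s: "spline s" "\<And>z. z \<in> U \<Longrightarrow> s z = x z"
  shows "\<bar>x \<tau> - s \<tau>\<bar> \<le> \<bar>\<phi> \<tau>\<bar>"
proof (rule ccontr)
  assume neg: "\<not> ?thesis"
  obtain j :: int where j: "\<tau> - 2 * pi * of_int j \<in> {0..<2*pi}" by (rule periodic_reduce)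
  define t where "t = \<tau> - 2 * pi * of_int j"
  obtain L c1 c2 where sp: "periodic s" "smooth q s" "L-lipschitz_on UNIV (nderiv q s)"
      "spline_pieces (nderiv q s) c1 c2"
    using s(1) unfolding spline_def by blast
  have xp: "periodic x" "smooth (Suc q) x" "1-lipschitz_on UNIV (nderiv (Suc q) x)"
    using x by (auto simp: unit_class_def)
  have "\<phi> t = \<phi> \<tau>" "x t = x \<tau>" "s t = s \<tau>"
    using periodic_add_int[OF phi(1), of t j] periodic_add_int[OF xp(1), of t j]
      periodic_add_int[OF sp(1), of t j] by (simp_all add: t_def)
  then have less: "\<bar>\<phi> t\<bar> < \<bar>x t - s t\<bar>" using neg by simp
  then have tU: "t \<notin> U" using s(2)[of t] by auto
  \<comment> \<open>This value makes \<open>\<delta>\<close> vanish at t. At the points of U both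
    \<phi> and the error vanish anyway, and t is not one of them because the error is not 0
    there.\<close>
  define \<gamma> where "\<gamma> = \<phi> t / (x t - s t)"
  have \<gamma>: "\<bar>\<gamma>\<bar> < 1" using less by (simp add: \<gamma>_def abs_divide)
  define e where "e = (\<lambda>t. 1 * x t + (-1) * s t)"
  define \<delta> where "\<delta> = (\<lambda>t. 1 * \<phi> t + (- \<gamma>) * e t)"
  have e: "smooth q e" "nderiv q e = (\<lambda>t. 1 * nderiv q x t + (-1) * nderiv q s t)"
    unfolding e_def by (rule smooth_lincomb[OF smooth_mono[OF xp(2)] sp(2)]; simp)+
  have \<delta>: "smooth q \<delta>" "nderiv q \<delta> = (\<lambda>t. 1 * f t + (- \<gamma>) * nderiv q e t)"
    unfolding \<delta>_def by (rule smooth_lincomb[OF smooth_mono[OF phi(2)] e(1)]; simp)+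
  have per_\<delta>: "periodic \<delta>"
    unfolding \<delta>_def e_def by (intro periodic_lincomb phi(1) xp(1) sp(1))
  have "zero_rate (T 2) (card (insert t U)) \<delta>"
  proof (rule zero_rateI[OF per_\<delta>, where b = 0])
    show "\<delta> z = 0" if "z \<in> insert t U" for z
      using that U(4)[of z] s(2)[of z] less by (auto simp: \<delta>_def e_def \<gamma>_def)
  qed (use U(1,3) j in \<open>auto simp: t_def\<close>)
  then have "zero_rate (T 2) (2 * n + 1) \<delta>" using U(1,2) tU by simp
  then have "zero_rate (T 2) (2 * n + 1) (nderiv q \<delta>)"
    by (rule zero_rate_nderiv[rotated 2]) (use \<delta>(1) in auto)
  then have zr: "zero_rate (T 2) (2 * n + 1) (\<lambda>t. f t - \<gamma> * (nderiv q x t - nderiv q s t))"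
    by (simp add: \<delta>(2) e(2))
  have Dx: "(nderiv q x has_real_derivative nderiv (Suc q) x t) (at t)" for t
    using xp(2) unfolding smooth_def by blast
  have "2 * n + 1 \<le> 2 * n"
    by (rule comparison_zero_rate[OF Dx xp(3) xN xM lipschitz_on_continuous_on[OF sp(3)] sp(4) \<gamma> zr])
  then show False by simp
qed

lemma zero_unit_class: "(\<lambda>_. 0) \<in> unit_class m"
  by (simp add: unit_class_def periodic_def smooth_zero nderiv_zero lipschitz_on_def)

lemma spline_zero:
  assumes U: "finite U" "card U = 2 * n" "U \<subseteq> {0..<2*pi}" "\<And>z. z \<in> U \<Longrightarrow> \<phi> z = 0"
    and s: "spline s" "\<And>z. z \<in> U \<Longrightarrow> s z = 0"
  shows "s = (\<lambda>_. 0)"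
proof
  fix \<tau>
  have *: "\<bar>0 - (c * s \<tau> + 0 * s \<tau>)\<bar> \<le> \<bar>\<phi> \<tau>\<bar>" for c
    by (rule comparison[OF U zero_unit_class _ _ spline_lincomb[OF s(1,1)]])
      (use M N s(2) in \<open>auto simp: nderiv_zero simp del: funpow.simps\<close>)
  show "s \<tau> = 0"
  proof (rule ccontr)
    assume "s \<tau> \<noteq> 0"
    then show False using *[of "(\<bar>\<phi> \<tau>\<bar> + 1) / s \<tau>"] by simp
  qed
qed

section \<open>Periodic piecewise affine functions with prescribed slopes\<close>

lemma T_add_period: "T (Suc k) \<le> T k + 2 * pi"
proof -
  have "T (Suc k) \<le> T (k + 2 * n)" using n by (intro strict_mono_mono[OF T_mono, THEN monoD]) simp
  then show ?thesis by (simp add: per(1))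
qed

text \<open>The other interval lies behind r or before l. In the second case it is moved by
  \<open>2 * pi\<close> so as to fall between r and \<open>l + 2 * pi\<close>. The slope is written
  with \<open>0 -\<close> to fit the pattern in \<open>comb_affine\<close>.\<close>

lemma ramp_affine_outside:
  assumes km: "k < 2 * n" "m < 2 * n" and lr: "T k \<le> l" "l \<le> r" "r \<le> T (Suc k)"
    and lr': "T m \<le> l'" "r' \<le> T (Suc m)" and sep: "k \<noteq> m \<or> r \<le> l' \<or> r' \<le> l"
  shows "affine_on (ramp bern l r) (0 - (r - l) / (2 * pi)) l' r'"
proof -
  have mono: "T i \<le> T j" if "i \<le> j" for i j using that T_mono by (simp add: strict_mono_less_eq)
  consider "r \<le> l'" "r' \<le> l + 2 * pi" | "r' \<le> l" "r \<le> l' + 2 * pi"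
  proof -
    consider "k < m" | "m < k" | "k = m" by linarith
    then show thesis
    proof cases
      case 1
      then have "T (Suc k) \<le> T m" "T (Suc m) \<le> T (k + 2 * n)" using km by (auto intro!: mono)
      then show thesis using lr lr' that(1) by (simp add: per(1))
    next
      case 2
      then have "T (Suc m) \<le> T k" "T (Suc k) \<le> T (m + 2 * n)" using km by (auto intro!: mono)
      then show thesis using lr lr' that(2) by (simp add: per(1))
    next
      case 3
      then show thesis using sep lr lr' that T_add_period[of k] by fastforce
    qed
  qed
  then show ?thesis
  proof cases
    case 1
    then show ?thesis unfolding affine_on_def using ramp_outside[of r _ l] lr(2) by auto
  next
    case 2
    have "ramp bern l r (y + 2 * pi) = ramp bern l r y" for y
      using ramp_periodic[OF bern_periodic] by (simp add: periodic_def)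
    moreover have "ramp bern l r (y + 2 * pi) - ramp bern l r (x + 2 * pi) = - ((r - l) / (2 * pi)) * ((y + 2 * pi) - (x + 2 * pi))"
      if "x \<in> {l'..r'}" "y \<in> {l'..r'}" for x y
      using that 2 lr(2) by (intro ramp_outside) auto
    ultimately show ?thesis unfolding affine_on_def by simp
  qed
qed

lemma ramp_affine_inside:
  assumes "T k \<le> l" "l \<le> r" "r \<le> T (Suc k)"
  shows "affine_on (ramp bern l r) (1 - (r - l) / (2 * pi)) l r"
  unfolding affine_on_def using ramp_inside[of l _ r] assms T_add_period[of k] by auto

text \<open>In a coefficient vector x, the entries \<open>x (0, k)\<close> and \<open>x (1, k)\<close> are the slopes of the
  spline on the first and third part of the interval k, \<open>x (2, 0)\<close> is an additive constant and
  \<open>x (2, 1)\<close> the factor of the prescribed values.\<close>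

definition comb :: "(nat \<times> nat \<Rightarrow> real) \<Rightarrow> (real \<Rightarrow> real) \<Rightarrow> real \<Rightarrow> real" where
  "comb x B t = (\<Sum>k<2 * n. x (0, k) * ramp B (T k) (a k) t + x (1, k) * ramp B (b k) (d k) t)"

definition slope_sum :: "(nat \<times> nat \<Rightarrow> real) \<Rightarrow> real" where
  "slope_sum x = (\<Sum>k<2 * n. x (0, k) * (a k - T k) + x (1, k) * (d k - b k))"

lemma comb_lincomb: "comb (\<lambda>j. p * x j + r * y j) B t = p * comb x B t + r * comb y B t"
  by (simp add: comb_def sum_distrib_left sum.distrib[symmetric] algebra_simps)

lemma slope_sum_lincomb: "slope_sum (\<lambda>j. p * x j + r * y j) = p * slope_sum x + r * slope_sum y"
  by (simp add: slope_sum_def sum_distrib_left sum.distrib[symmetric] algebra_simps)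

text \<open>Every ramp carries its own mean slope. Together these amount to
  \<open>slope_sum x / (2 * pi)\<close>, which is 0, and only the two ramps of interval m contribute
  anything else.\<close>

lemma comb_affine:
  assumes m: "m < 2 * n" and x: "slope_sum x = 0"
    and 1: "\<And>k. k < 2 * n \<Longrightarrow> affine_on (ramp bern (T k) (a k)) ((if k = m then e1 else 0) - (a k - T k) / (2 * pi)) l r"
    and 2: "\<And>k. k < 2 * n \<Longrightarrow> affine_on (ramp bern (b k) (d k)) ((if k = m then e2 else 0) - (d k - b k) / (2 * pi)) l r"
  shows "affine_on (comb x bern) (x (0, m) * e1 + x (1, m) * e2) l r"
  unfolding affine_on_def
proof (intro ballI)
  fix s t assume st: "s \<in> {l..r}" "t \<in> {l..r}"
  have "comb x bern t - comb x bern s = (\<Sum>k<2 * n. x (0, k) * (ramp bern (T k) (a k) t - ramp bern (T k) (a k) s)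
      + x (1, k) * (ramp bern (b k) (d k) t - ramp bern (b k) (d k) s))"
    by (simp add: comb_def sum_subtractf[symmetric] algebra_simps)
  also have "\<dots> = (\<Sum>k<2 * n. x (0, k) * (((if k = m then e1 else 0) - (a k - T k) / (2 * pi)) * (t - s))
      + x (1, k) * (((if k = m then e2 else 0) - (d k - b k) / (2 * pi)) * (t - s)))"
  proof (rule sum.cong[OF refl])
    fix k assume "k \<in> {..<2 * n}"
    then have k: "k < 2 * n" by simp
    show "x (0, k) * (ramp bern (T k) (a k) t - ramp bern (T k) (a k) s)
      + x (1, k) * (ramp bern (b k) (d k) t - ramp bern (b k) (d k) s) =
      x (0, k) * (((if k = m then e1 else 0) - (a k - T k) / (2 * pi)) * (t - s))
      + x (1, k) * (((if k = m then e2 else 0) - (d k - b k) / (2 * pi)) * (t - s))"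
      using affine_onD[OF 1[OF k], of s t] affine_onD[OF 2[OF k], of s t] st by simp
  qed
  also have "\<dots> = (\<Sum>k<2 * n. (if k = m then (x (0, k) * e1 + x (1, k) * e2) * (t - s) else 0)
      - (x (0, k) * (a k - T k) + x (1, k) * (d k - b k)) * ((t - s) / (2 * pi)))"
    by (intro sum.cong refl) (simp add: field_simps)
  also have "\<dots> = (x (0, m) * e1 + x (1, m) * e2) * (t - s) - slope_sum x * ((t - s) / (2 * pi))"
    using m by (simp only: sum_subtractf sum_distrib_right[symmetric] slope_sum_def) (simp add: sum.delta)
  finally show "comb x bern t - comb x bern s = (x (0, m) * e1 + x (1, m) * e2) * (t - s)" by (simp add: x)
qed

lemma comb_pieces:
  assumes m: "m < 2 * n" and x: "slope_sum x = 0"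
  shows "affine_on (comb x bern) (x (0, m)) (T m) (a m)" "affine_on (comb x bern) 0 (a m) (b m)"
    "affine_on (comb x bern) (x (1, m)) (b m) (d m)" "affine_on (comb x bern) 0 (d m) (T (Suc m))"
proof -
  note o = order[of m]
  have out: "affine_on (ramp bern (T k) (a k)) ((if k = m then 0 else 0) - (a k - T k) / (2 * pi)) l r"
    if "k < 2 * n" "T m \<le> l" "r \<le> T (Suc m)" "k \<noteq> m \<or> a m \<le> l" for k l r
    using ramp_affine_outside[OF that(1) m, of "T k" "a k" l r] that order[of k] by auto
  have out': "affine_on (ramp bern (b k) (d k)) ((if k = m then 0 else 0) - (d k - b k) / (2 * pi)) l r"
    if "k < 2 * n" "T m \<le> l" "r \<le> T (Suc m)" "k \<noteq> m \<or> d m \<le> l \<or> r \<le> b m" for k l r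
    using ramp_affine_outside[OF that(1) m, of "b k" "d k" l r] that order[of k] by auto
  have "affine_on (comb x bern) (x (0, m) * 1 + x (1, m) * 0) (T m) (a m)"
  proof (rule comb_affine[OF m x])
    fix k assume k: "k < 2 * n"
    show "affine_on (ramp bern (T k) (a k)) ((if k = m then 1 else 0) - (a k - T k) / (2 * pi)) (T m) (a m)"
      using out[OF k, of "T m" "a m"] ramp_affine_inside[of m "T m" "a m"] o by (cases "k = m") auto
    show "affine_on (ramp bern (b k) (d k)) ((if k = m then 0 else 0) - (d k - b k) / (2 * pi)) (T m) (a m)"
      by (rule out'[OF k]) (use o in auto)
  qed
  then show "affine_on (comb x bern) (x (0, m)) (T m) (a m)" by simp
  have "affine_on (comb x bern) (x (0, m) * 0 + x (1, m) * 1) (b m) (d m)"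
  proof (rule comb_affine[OF m x])
    fix k assume k: "k < 2 * n"
    show "affine_on (ramp bern (b k) (d k)) ((if k = m then 1 else 0) - (d k - b k) / (2 * pi)) (b m) (d m)"
      using out'[OF k, of "b m" "d m"] ramp_affine_inside[of m "b m" "d m"] o by (cases "k = m") auto
    show "affine_on (ramp bern (T k) (a k)) ((if k = m then 0 else 0) - (a k - T k) / (2 * pi)) (b m) (d m)"
      by (rule out[OF k]) (use o in auto)
  qed
  then show "affine_on (comb x bern) (x (1, m)) (b m) (d m)" by simp
  have "affine_on (comb x bern) (x (0, m) * 0 + x (1, m) * 0) (a m) (b m)"
    by (rule comb_affine[OF m x]; (rule out | rule out')) (use o in auto)
  then show "affine_on (comb x bern) 0 (a m) (b m)" by simp
  have "affine_on (comb x bern) (x (0, m) * 0 + x (1, m) * 0) (d m) (T (Suc m))"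
    by (rule comb_affine[OF m x]; (rule out | rule out')) (use o in auto)
  then show "affine_on (comb x bern) 0 (d m) (T (Suc m))" by simp
qed

lemma comb_lipschitz: "\<exists>L. L-lipschitz_on UNIV (comb x bern)"
proof -
  have tr: "1-lipschitz_on UNIV (\<lambda>t. bern (t - c))" for c
  proof (rule lipschitz_onI)
    fix s t show "dist (bern (s - c)) (bern (t - c)) \<le> 1 * dist s t"
      using lipschitz_onD[OF bern_lipschitz, of "s - c" "t - c"] by (simp add: dist_real_def)
  qed simp
  have "\<exists>L. L-lipschitz_on UNIV (ramp bern l r)" for l r
    unfolding ramp_def using lipschitz_on_diff[OF tr tr] by blast
  then obtain R where R: "\<And>l r. (R l r)-lipschitz_on UNIV (ramp bern l r)" by metis
  have "\<exists>L. L-lipschitz_on UNIV (\<lambda>t. \<Sum>k\<in>K. x (0, k) * ramp bern (T k) (a k) t + x (1, k) * ramp bern (b k) (d k) t)"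
    if "finite K" for K :: "nat set"
    using that
  proof (induction K rule: finite_induct)
    case empty
    show ?case by (auto simp: lipschitz_on_def)
  next
    case (insert k K)
    then obtain L where "L-lipschitz_on UNIV (\<lambda>t. \<Sum>k\<in>K. x (0, k) * ramp bern (T k) (a k) t + x (1, k) * ramp bern (b k) (d k) t)"
      by blast
    from lipschitz_on_add[OF lipschitz_lincomb[OF R[of "T k" "a k"] R[of "b k" "d k"], of "x (0, k)" "x (1, k)"] this]
    show ?case using insert.hyps by auto
  qed
  then show ?thesis unfolding comb_def[abs_def] by blast
qed

lemma comb_periodic: "periodic B \<Longrightarrow> periodic (comb x B)"
  using ramp_periodic[of B] by (simp add: periodic_def comb_def)

lemma comb_DERIV:
  assumes "\<And>t. (B' has_real_derivative B t) (at t)"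
  shows "(comb x B' has_real_derivative comb x B t) (at t)"
proof -
  have "((\<lambda>t. B' (t - c)) has_real_derivative B (t - c)) (at t)" for t c
    using DERIV_shift[of B' "B (t - c)" t "- c"] assms[of "t - c"] by simp
  then have "(ramp B' l r has_real_derivative ramp B l r t) (at t)" for l r
    unfolding ramp_def[abs_def] by (intro DERIV_diff)
  then show ?thesis
    unfolding comb_def[abs_def] by (intro DERIV_sum DERIV_add DERIV_cmult)
qed

lemma T_reduce:
  "T k = T (k mod (2 * n)) + 2 * pi * real (k div (2 * n))"
  "a k = a (k mod (2 * n)) + 2 * pi * real (k div (2 * n))"
  "b k = b (k mod (2 * n)) + 2 * pi * real (k div (2 * n))"
  "d k = d (k mod (2 * n)) + 2 * pi * real (k div (2 * n))"
  "T (Suc k) = T (Suc (k mod (2 * n))) + 2 * pi * real (k div (2 * n))"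
proof -
  have *: "g (i + 2 * n * l) = g i + 2 * pi * real l" if "\<And>k. g (k + 2 * n) = g k + 2 * pi" for g i l
  proof (induction l)
    case (Suc l)
    have "g (i + 2 * n * Suc l) = g ((i + 2 * n * l) + 2 * n)" by (simp add: algebra_simps)
    then show ?case using Suc that[of "i + 2 * n * l"] by (simp add: algebra_simps)
  qed simp
  have k: "k = k mod (2 * n) + 2 * n * (k div (2 * n))" by simp
  show "T k = T (k mod (2 * n)) + 2 * pi * real (k div (2 * n))"
    "a k = a (k mod (2 * n)) + 2 * pi * real (k div (2 * n))"
    "b k = b (k mod (2 * n)) + 2 * pi * real (k div (2 * n))"
    "d k = d (k mod (2 * n)) + 2 * pi * real (k div (2 * n))"
    using *[of T, OF per(1), of "k mod (2 * n)" "k div (2 * n)"] *[of a, OF per(2), of "k mod (2 * n)" "k div (2 * n)"]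
      *[of b, OF per(3), of "k mod (2 * n)" "k div (2 * n)"] *[of d, OF per(4), of "k mod (2 * n)" "k div (2 * n)"] by simp_all
  show "T (Suc k) = T (Suc (k mod (2 * n))) + 2 * pi * real (k div (2 * n))"
    using *[of T, OF per(1), of "Suc (k mod (2 * n))" "k div (2 * n)"] by simp
qed

lemma f_knot: "f (T (Suc k)) = f (T (Suc (k mod (2 * n))))"
  using periodic_add_nat[OF periodic_nderiv[OF phi(1)], of q "T (Suc (k mod (2 * n)))" "k div (2 * n)"]
  by (simp flip: T_reduce(5))

text \<open>Knot conditions, interpolation conditions and the vanishing mean slope are \<open>4n + 1\<close> homogeneous
  linear equations for \<open>4n + 2\<close> unknowns. In a nontrivial solution the factor of v is not 0, since
  otherwise the spline, and then every coefficient, would vanish.\<close>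

lemma spline_exists:
  assumes u: "strict_mono_on {1..2*n} u" "u ` {1..2*n} \<subseteq> {0..<2*pi}" "\<And>k. k \<in> {1..2*n} \<Longrightarrow> \<phi> (u k) = 0"
  shows "\<exists>s. spline s \<and> (\<forall>k\<in>{1..2*n}. s (u k) = v k)"
proof -
  obtain B where B: "B 0 = bern" "\<And>j. periodic (B j)" "\<And>j t. (B (Suc j) has_real_derivative B j t) (at t)"
    by (rule bern_primitives) blast
  define s where "s = (\<lambda>x t. x (2, 0) + comb x (B q) t)"
  \<comment> \<open>The derivative of s of order q, in which the additive constant survives only for
    \<open>q = 0\<close>.\<close>
  define S where "S = (\<lambda>x t. (if q = 0 then x (2, 0) else 0) + comb x bern t)"
  define D where "D = (\<lambda>x j t. (if j = 0 then x (2, 0) else 0) + comb x (B (q - j)) t)"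
  have D: "D x 0 = s x" "D x q = S x" "j < q \<Longrightarrow> (D x j has_real_derivative D x (Suc j) t) (at t)" for x j t
  proof -
    show "D x 0 = s x" "D x q = S x" by (auto simp: D_def s_def S_def B(1))
    assume "j < q"
    then have "Suc (q - Suc j) = q - j" by simp
    then have "(comb x (B (q - j)) has_real_derivative comb x (B (q - Suc j)) t) (at t)"
      using comb_DERIV[OF B(3), of x "q - Suc j" t] by simp
    then show "(D x j has_real_derivative D x (Suc j) t) (at t)"
      unfolding D_def by (auto intro!: derivative_eq_intros)
  qed
  have s_smooth: "smooth q (s x)" "nderiv q (s x) = S x" for x
    using smoothI[of "D x" "s x" q] nderiv_eqI[of "D x" "s x" q q] D by simp_all
  have s_per: "periodic (s x)" "periodic (S x)" for x
    using comb_periodic[OF B(2), of x q] comb_periodic[OF bern_periodic, of x] by (auto simp: periodic_def s_def S_def)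
  \<comment> \<open>First index 0: knot conditions. First index 1: interpolation, made homogeneous
    by the unknown factor \<open>x (2, 1)\<close>. First index 2: vanishing mean slope.\<close>
  define L :: "nat \<times> nat \<Rightarrow> (nat \<times> nat \<Rightarrow> real) \<Rightarrow> real" where
    "L = (\<lambda>i x. if fst i = 0 then
        (if \<bar>f (T (Suc (snd i)))\<bar> = M then S x (T (Suc (snd i))) else x (1, snd i) - x (0, Suc (snd i) mod (2 * n)))
      else if fst i = 1 then s x (u (Suc (snd i))) - x (2, 1) * v (Suc (snd i))
      else slope_sum x)"
  let ?I = "{0, 1} \<times> {..<2 * n} \<union> {(2, 0)} :: (nat \<times> nat) set"
  let ?J = "{0, 1} \<times> {..<2 * n} \<union> {(2, 0), (2, 1)} :: (nat \<times> nat) set"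
  have "\<exists>x. (\<forall>j. j \<notin> ?J \<longrightarrow> x j = 0) \<and> (\<exists>j. x j \<noteq> 0) \<and> (\<forall>i\<in>?I. L i x = 0)"
  proof (rule linear_system_solution[of ?I ?J L])
    let ?P = "{0, 1} \<times> {..<2 * n} :: (nat \<times> nat) set"
    have I: "?I = insert (2, 0) ?P"
      by (simp only: Un_insert_right Un_empty_right)
    have J: "?J = insert (2, 0) (insert (2, 1) ?P)"
      by (simp only: Un_insert_right Un_empty_right)
    have P: "finite ?P" by (intro finite_cartesian_product) simp_all
    then show "finite ?I" "finite ?J" by (simp_all only: I J finite_insert)
    have nP: "(2, i) \<notin> ?P" for i by simp
    have "(2, 0::nat) \<notin> insert (2, 1) ?P" using nP[of 0] by simp
    then show "card ?I < card ?J" unfolding I J using P nP[of 0] nP[of 1] by (simp only: card_insert_disjoint finite_insert not_False_eq_True lessI)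
    show "L i (\<lambda>j. p * x j + r * y j) = p * L i x + r * L i y" for i x y p r
      by (simp add: L_def S_def s_def comb_lincomb slope_sum_lincomb algebra_simps)
  qed
  then obtain x where sol: "(\<forall>j. j \<notin> ?J \<longrightarrow> x j = 0) \<and> (\<exists>j. x j \<noteq> 0) \<and> (\<forall>i\<in>?I. L i x = 0)"
    by (elim exE)
  note x = conjunct1[OF sol, rule_format] conjunct1[OF conjunct2[OF sol]] conjunct2[OF conjunct2[OF sol], rule_format]
  have slope0: "slope_sum x = 0" using x(3)[of "(2, 0)"] by (simp add: L_def)
  have interp: "s x (u k) = x (2, 1) * v k" if "k \<in> {1..2*n}" for k
    using x(3)[of "(1, k - 1)"] that by (auto simp: L_def)
  define c1 where "c1 = (\<lambda>k. x (0, k mod (2 * n)))"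
  define c2 where "c2 = (\<lambda>k. x (1, k mod (2 * n)))"
  have pieces: "spline_pieces (S x) c1 c2"
    unfolding spline_pieces_def
  proof
    fix k
    define m where "m = k mod (2 * n)"
    have m: "m < 2 * n" using n by (simp add: m_def)
    have sh: "affine_on (S x) c (l + 2 * pi * real (k div (2 * n))) (r + 2 * pi * real (k div (2 * n)))"
      if "affine_on (comb x bern) c l r" for c l r
      by (rule affine_on_shift[OF s_per(2)]) (use that in \<open>simp add: affine_on_def S_def\<close>)
    note A = comb_pieces[OF m slope0, THEN sh, unfolded m_def, folded T_reduce]
    have "if \<bar>f (T (Suc m))\<bar> = M then S x (T (Suc m)) = 0 else x (1, m) = x (0, Suc m mod (2 * n))"
      using x(3)[of "(0, m)"] m by (auto simp: L_def split: if_splits)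
    moreover have "S x (T (Suc k)) = S x (T (Suc m))"
      unfolding T_reduce(5)[of k] m_def by (rule periodic_add_nat[OF s_per(2)])
    moreover have "Suc m mod (2 * n) = Suc k mod (2 * n)" by (simp add: m_def mod_Suc_eq)
    ultimately have "if \<bar>f (T (Suc k))\<bar> = M then S x (T (Suc k)) = 0 else c2 k = c1 (Suc k)"
      by (simp add: f_knot[of k] c1_def c2_def split: if_splits flip: m_def)
    then show "affine_on (S x) (c1 k) (T k) (a k) \<and> affine_on (S x) 0 (a k) (b k) \<and>
      affine_on (S x) (c2 k) (b k) (d k) \<and> affine_on (S x) 0 (d k) (T (Suc k)) \<and>
      (if \<bar>f (T (Suc k))\<bar> = M then S x (T (Suc k)) = 0 else c2 k = c1 (Suc k))"
      using A by (simp add: c1_def c2_def)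
  qed
  obtain K where "K-lipschitz_on UNIV (comb x bern)" using comb_lipschitz by blast
  then have "K-lipschitz_on UNIV (S x)" by (simp add: S_def lipschitz_on_def dist_real_def)
  have spl: "spline (s x)"
  proof -
    have "c1 (2 * n) = c1 0" by (simp add: c1_def)
    then show ?thesis unfolding spline_def s_smooth(2) using s_per(1) s_smooth(1) pieces \<open>K-lipschitz_on UNIV (S x)\<close> by blast
  qed
  have U: "finite (u ` {1..2*n})" "card (u ` {1..2*n}) = 2 * n" "u ` {1..2*n} \<subseteq> {0..<2*pi}"
    "\<And>z. z \<in> u ` {1..2*n} \<Longrightarrow> \<phi> z = 0"
    using u by (auto simp: card_image strict_mono_on_imp_inj_on)
  have "x (2, 1) \<noteq> 0"
  proof
    assume x21: "x (2, 1) = 0"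
    have s0: "s x = (\<lambda>_. 0)"
      by (rule spline_zero[OF U spl]) (use interp x21 in auto)
    then have S0: "S x = (\<lambda>_. 0)" using s_smooth(2)[of x] nderiv_zero[of q] by simp
    have zero: "c = 0" if "affine_on (S x) c l r" "l < r" for c l r
      using affine_onD[OF that(1), of l r] that(2) by (simp add: S0)
    \<comment> \<open>The zero spline has slope 0 on every part of positive length. At a peak both
      adjacent parts have positive length; elsewhere the two slopes agree and one of the parts
      has.\<close>
    have c0: "c2 k = 0 \<and> c1 (Suc k) = 0" for k
    proof (cases "\<bar>f (T (Suc k))\<bar> = M")
      case True
      then show ?thesis using pieces peak_nondegenerate[OF True] zero unfolding spline_pieces_def by blast
    next
      case False
      then have "c2 k = c1 (Suc k)" using pieces unfolding spline_pieces_def by metis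
      then show ?thesis using pieces nondegenerate[of k] zero unfolding spline_pieces_def by metis
    qed
    have x1: "x (1, k) = 0" if "k < 2 * n" for k using c0[of k] that by (simp add: c2_def)
    have x0: "x (0, k) = 0" if "k < 2 * n" for k
    proof -
      \<comment> \<open>Adding \<open>2 * n\<close> writes the index as a successor also for
        \<open>k = 0\<close>.\<close>
      have "c1 (Suc (k + 2 * n - 1)) = 0" using c0 by blast
      then show ?thesis using that n by (simp add: c1_def)
    qed
    have "comb x (B q) 0 = 0" using x0 x1 by (simp add: comb_def)
    then have "x (2, 0) = 0" using fun_cong[OF s0, of 0] by (simp add: s_def)
    then have "x j = 0" for j using x(1)[of j] x0 x1 x21 by (cases "j \<in> ?J") auto
    then show False using x(2) by blast
  qed
  then have "(1 / x (2, 1)) * s x (u k) + 0 * s x (u k) = v k" if "k \<in> {1..2*n}" for k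
    using interp[OF that] by simp
  then show ?thesis using spline_lincomb[OF spl spl, of "1 / x (2, 1)" 0] by blast
qed

end

section \<open>The three kinds of ideal splines\<close>

text \<open>Data numbered from 1 on one period become a periodic sequence numbered from 0, as the
  frame expects.\<close>

definition ext :: "nat \<Rightarrow> (nat \<Rightarrow> 'a) \<Rightarrow> nat \<Rightarrow> 'a" where
  "ext n g k = g (1 + k mod (2 * n))"

definition knots :: "nat \<Rightarrow> (nat \<Rightarrow> real) \<Rightarrow> nat \<Rightarrow> real" where
  "knots n t k = ext n t k + 2 * pi * real (k div (2 * n))"

lemma ext_add: "ext n g (k + 2 * n) = ext n g k"
  by (simp add: ext_def)

lemma ext_Suc:
  assumes "n \<ge> 1" "g (2 * n + 1) = g 1"
  shows "ext n g (Suc k) = g (1 + k mod (2 * n) + 1)"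
proof (cases "Suc (k mod (2 * n)) = 2 * n")
  case True
  then have "Suc k mod (2 * n) = 0" by (simp add: mod_Suc)
  then show ?thesis using assms True by (simp add: ext_def add.commute)
next
  case False
  then show ?thesis by (simp add: ext_def mod_Suc)
qed

lemma knots_Suc:
  assumes "n \<ge> 1" "t (2 * n + 1) = t 1 + 2 * pi"
  shows "knots n t (Suc k) = t (1 + k mod (2 * n) + 1) + 2 * pi * real (k div (2 * n))"
proof (cases "Suc (k mod (2 * n)) = 2 * n")
  case True
  then have "Suc k mod (2 * n) = 0" "Suc k div (2 * n) = Suc (k div (2 * n))" by (simp_all add: mod_Suc div_Suc)
  then show ?thesis using assms True by (simp add: knots_def ext_def add.commute algebra_simps)
next
  case False
  then have "Suc k mod (2 * n) = Suc (k mod (2 * n))" "Suc k div (2 * n) = k div (2 * n)" by (simp_all add: mod_Suc div_Suc)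
  then show ?thesis by (simp add: knots_def ext_def)
qed

lemma knots_add: "n \<ge> 1 \<Longrightarrow> knots n t (k + 2 * n) = knots n t k + 2 * pi"
  by (simp add: knots_def ext_def algebra_simps)

lemma ext_index: "n \<ge> 1 \<Longrightarrow> 1 + k mod (2 * n) \<in> {1..2*n}" for n k :: nat
  by (simp add: Suc_leI)

lemma const_on_shift:
  assumes "periodic g" "const_on g c l r"
  shows "const_on g c (l + 2 * pi * real j) (r + 2 * pi * real j)"
  unfolding const_on_def
proof
  fix x assume "x \<in> {l + 2 * pi * real j<..<r + 2 * pi * real j}"
  then have "g (x - 2 * pi * real j) = c" using assms(2) by (simp add: const_on_def)
  then show "g x = c" using periodic_add_nat[OF assms(1), of "x - 2 * pi * real j" j] by simp
qed

lemma const_on_deriv_iff: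
  assumes "loc_abs_cont S"
  shows "const_on (deriv S) c l r \<longleftrightarrow> affine_on S c l r"
proof
  show "const_on (deriv S) c l r \<Longrightarrow> affine_on S c l r"
    using loc_abs_cont_affine[OF assms, of c l r] by (auto simp: affine_on_def)
  show "affine_on S c l r \<Longrightarrow> const_on (deriv S) c l r"
    unfolding const_on_def using DERIV_imp_deriv[OF affine_on_DERIV] by simp
qed

lemma affine_on_unshift:
  assumes "periodic S"
  shows "affine_on S c (l + 2 * pi * real j) (r + 2 * pi * real j) \<longleftrightarrow> affine_on S c l r"
proof
  assume aff: "affine_on S c (l + 2 * pi * real j) (r + 2 * pi * real j)"
  show "affine_on S c l r" unfolding affine_on_def
  proof (intro ballI)
    fix x y assume xy: "x \<in> {l..r}" "y \<in> {l..r}"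
    have "S (y + 2 * pi * real j) - S (x + 2 * pi * real j) = c * ((y + 2 * pi * real j) - (x + 2 * pi * real j))"
      by (rule affine_onD[OF aff]) (use xy in auto)
    then show "S y - S x = c * (y - x)" by (simp add: periodic_add_nat[OF assms])
  qed
qed (rule affine_on_shift[OF assms])

text \<open>Splines of the types \<open>W2\<close> and \<open>W12\<close>, in which the first and third part of each knot interval
  have equal length.\<close>

lemma symmetric_spline_frame:
  assumes n: "n \<ge> 1" and M: "M > 0" and N: "N > 0"
    and T_less: "\<And>k. T k < T (Suc k)"
    and per: "\<And>k. T (k + 2 * n) = T k + 2 * pi" "\<And>k. a (k + 2 * n) = a k + 2 * pi"
      "\<And>k. b (k + 2 * n) = b k + 2 * pi" "\<And>k. d (k + 2 * n) = d k + 2 * pi"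
    and order: "\<And>k. T k \<le> a k" "\<And>k. a k \<le> b k" "\<And>k. b k \<le> d k" "\<And>k. d k \<le> T (Suc k)"
    and sign: "\<And>k. \<epsilon> k = 1 \<or> \<epsilon> k = -1" "\<And>k. \<epsilon> (Suc k) = - \<epsilon> k"
    and phi: "periodic \<phi>" "smooth (Suc q) \<phi>" "continuous_on UNIV (nderiv (Suc q) \<phi>)"
    and up: "\<And>k. affine_on (nderiv (Suc q) \<phi>) (\<epsilon> k) (T k) (a k)"
    and flat_N: "\<And>k t. a k < t \<Longrightarrow> t < b k \<Longrightarrow> nderiv (Suc q) \<phi> t = \<epsilon> k * N"
    and down: "\<And>k. affine_on (nderiv (Suc q) \<phi>) (- \<epsilon> k) (b k) (d k)"
    and flat_M: "\<And>k t. d k < t \<Longrightarrow> t < T (Suc k) \<Longrightarrow> nderiv q \<phi> t = \<epsilon> k * M"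
    and bound: "\<And>t. \<bar>nderiv q \<phi> t\<bar> \<le> M"
    and sym: "\<And>k. a k - T k = d k - b k"
  shows "spline_frame n q T a b d \<epsilon> M N \<phi>"
proof -
  define f where "f = nderiv q \<phi>"
  define h where "h = nderiv (Suc q) \<phi>"
  have D: "(f has_real_derivative h t) (at t)" for t
    using phi(2) unfolding smooth_def f_def h_def by blast
  have cf: "continuous_on UNIV f" using DERIV_isCont[OF D] by (simp add: continuous_at_imp_continuous_on)
  have ch: "continuous_on UNIV h" using phi(3) by (simp add: h_def)
  have fM: "\<bar>f t\<bar> \<le> M" for t using bound by (simp add: f_def)
  have fb: "\<epsilon> k * f t \<le> M" "- (\<epsilon> k * f t) \<le> M" for k t using fM[of t] sign(1)[of k] by auto
  have nz: "\<epsilon> k * N \<noteq> 0" "\<epsilon> k * M \<noteq> - (\<epsilon> k * M)" "\<epsilon> k \<noteq> 0" "\<epsilon> k * \<epsilon> k = 1" for k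
    using sign(1)[of k] M N by auto
  have hN: "h t = \<epsilon> k * N" if "a k < b k" "a k \<le> t" "t \<le> b k" for k t
    by (rule constant_closed_interval[OF ch _ that(1)]) (use flat_N that in \<open>auto simp: h_def\<close>)
  have fD: "f t = \<epsilon> k * M" if "d k < T (Suc k)" "d k \<le> t" "t \<le> T (Suc k)" for k t
    by (rule constant_closed_interval[OF cf _ that(1)]) (use flat_M that in \<open>auto simp: f_def\<close>)
  \<comment> \<open>A value of modulus M is a global extremum of f.\<close>
  have crit: "h t = 0" if "\<bar>f t\<bar> = M" for t
  proof (cases "f t \<ge> 0")
    case True
    then have "f s \<le> f t" for s using that fM[of s] by auto
    then show ?thesis using DERIV_local_max[OF D zero_less_one] by blast
  next
    case False
    then have "f t \<le> f s" for s using that fM[of s] by auto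
    then show ?thesis using DERIV_local_min[OF D zero_less_one] by blast
  qed
  have step: "\<sigma> * f l < \<sigma> * f r"
    if "l < r" "\<And>t. l < t \<Longrightarrow> t < r \<Longrightarrow> \<sigma> * h t > 0" for l r \<sigma>
  proof (rule DERIV_pos_imp_increasing_open[OF that(1)])
    show "continuous_on {l..r} (\<lambda>t. \<sigma> * f t)" by (intro continuous_intros continuous_on_subset[OF cf]) auto
    show "\<exists>y. ((\<lambda>t. \<sigma> * f t) has_real_derivative y) (at t) \<and> 0 < y" if "l < t" "t < r" for t
      using DERIV_cmult[OF D] \<open>\<And>t. l < t \<Longrightarrow> t < r \<Longrightarrow> \<sigma> * h t > 0\<close>[OF that] by blast
  qed
  have peak: "f (T (Suc k)) = \<epsilon> k * M" if pk: "\<bar>f (T (Suc k))\<bar> = M" for k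
  proof (rule ccontr)
    assume ne: "f (T (Suc k)) \<noteq> \<epsilon> k * M"
    let ?K = "Suc k"
    have fT: "f (T ?K) = \<epsilon> ?K * M" using pk ne sign(1)[of k] sign(2)[of k] by auto
    have h0: "h (T ?K) = 0" by (rule crit[OF pk])
    have "a ?K = T ?K"
    proof (rule ccontr)
      assume "a ?K \<noteq> T ?K"
      then have l: "T ?K < a ?K" using order(1)[of ?K] by simp
      have "\<epsilon> ?K * f (T ?K) < \<epsilon> ?K * f (a ?K)"
      proof (rule step[OF l])
        fix t assume t: "T ?K < t" "t < a ?K"
        have "h t - h (T ?K) = \<epsilon> ?K * (t - T ?K)"
          using t affine_onD[OF up[of ?K], of "T ?K" t] by (simp add: h_def)
        then have "\<epsilon> ?K * h t = (\<epsilon> ?K * \<epsilon> ?K) * (t - T ?K)" using h0 by simp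
        then show "\<epsilon> ?K * h t > 0" using t nz(4)[of ?K] by simp
      qed
      then show False using fb(1)[of ?K "a ?K"] fT nz(4)[of ?K] by (simp flip: mult.assoc)
    qed
    moreover have "b ?K = a ?K" using hN[of ?K "a ?K"] order(2)[of ?K] h0 nz(1)[of ?K] calculation
      by (cases "a ?K < b ?K") auto
    moreover have "d ?K = b ?K" using sym[of ?K] calculation by simp
    have dk: "d k = T ?K"
      using fD[of k "T ?K"] order(4)[of k] ne by (cases "d k < T ?K") auto
    \<comment> \<open>If the third part is not empty, \<epsilon> k f increases on it up to the value
      -M at the knot, so it would be smaller than -M before. If it is empty, h equals \<epsilon> k N
      at the knot, although h vanishes at an extremum.\<close>
    show False
    proof (cases "b k < d k")
      case True
      have "(- \<epsilon> k) * f (d k) < (- \<epsilon> k) * f (b k)"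
      proof -
        have "\<epsilon> k * f (b k) < \<epsilon> k * f (d k)"
        proof (rule step[OF True])
          fix t assume t: "b k < t" "t < d k"
          have "h (T ?K) - h t = - \<epsilon> k * (T ?K - t)"
            using t affine_onD[OF down[of k], of t "T ?K"] dk by (simp add: h_def)
          then have "\<epsilon> k * h t = (\<epsilon> k * \<epsilon> k) * (T ?K - t)" using h0 by simp
          then show "\<epsilon> k * h t > 0" using t nz(4)[of k] dk by simp
        qed
        then show ?thesis using fb[of k "b k"] fT dk sign(2)[of k] nz(4)[of k] by (simp flip: mult.assoc)
      qed
      then show False using fb(2)[of k "b k"] fT dk sign(2)[of k] nz(4)[of k] by (simp flip: mult.assoc)
    next
      case False
      then have "b k = d k" "a k = T k" using order(3)[of k] sym[of k] by auto
      then have "h (T ?K) = \<epsilon> k * N" using hN[of k "T ?K"] T_less[of k] dk by simp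
      then show False using h0 nz(1)[of k] by simp
    qed
  qed
  \<comment> \<open>\<open>peak\<close> speaks about the knots \<open>T (Suc k)\<close>; every T k
    is reached as such a knot one period later, with unchanged signs because 2n is even.\<close>
  have shift: "f (T k) = - \<epsilon> k * M" if "\<bar>f (T k)\<bar> = M" for k
  proof -
    obtain j where j: "k + 2 * n = Suc j" using n by (cases "k + 2 * n") auto
    have fj: "f (T (Suc j)) = f (T k)"
      using periodic_nderiv[OF phi(1), of q] per(1)[of k] by (simp add: f_def periodic_def flip: j)
    have "\<epsilon> (k + 2 * m) = \<epsilon> k" for m
      by (induction m) (simp_all add: sign(2))
    then have "\<epsilon> j = - \<epsilon> k" using sign(2)[of j] by (metis j minus_minus)
    then show ?thesis using peak[of j] that fj by simp
  qed
  have right: "T k < a k" if pk: "\<bar>f (T k)\<bar> = M" for k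
  proof (rule ccontr)
    assume "\<not> T k < a k"
    then have a: "a k = T k" using order(1)[of k] by simp
    then have b: "b k = T k" using hN[of k "T k"] order(2)[of k] crit[OF pk] nz(1)[of k] by (cases "a k < b k") auto
    then have "d k = T k" using sym[of k] a by simp
    then have "f (T k) = \<epsilon> k * M" using fD[of k "T k"] T_less[of k] by simp
    then show False using shift[OF pk] nz(2)[of k] by simp
  qed
  \<comment> \<open>If the third part is empty, so is the first, by \<open>sym\<close>. Then either
    the plateau fills the whole interval and f has the wrong sign at \<open>T k\<close>, or h would
    be both \<epsilon> k N and 0 at \<open>d k\<close>.\<close>
  have left: "b k < d k" if pk: "\<bar>f (T (Suc k))\<bar> = M" for k
  proof (rule ccontr)
    assume "\<not> b k < d k"
    then have bd: "b k = d k" "a k = T k" using order(3)[of k] sym[of k] by auto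
    have Nab: "a k < b k"
    proof (rule ccontr)
      assume "\<not> a k < b k"
      then have "d k = T k" using bd order(2)[of k] by simp
      then have "f (T k) = \<epsilon> k * M" using fD[of k "T k"] T_less[of k] by simp
      moreover from this have "\<bar>f (T k)\<bar> = M" using sign(1)[of k] M by auto
      ultimately show False using shift[of k] nz(2)[of k] by simp
    qed
    show False
    proof (cases "d k < T (Suc k)")
      case True
      have z: "h t = 0" if "d k < t" "t < T (Suc k)" for t
        using crit[of t] fD[OF True, of t] that sign(1)[of k] M by auto
      have "d k \<in> {d k..T (Suc k)}" using order(4)[of k] by simp
      then have "h (d k) = 0" using constant_closed_interval[OF ch z True, of "d k"] by blast
      then show False using hN[OF Nab, of "d k"] bd Nab nz(1)[of k] by simp
    next
      case False
      then have "d k = T (Suc k)" using order(4)[of k] by simp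
      then show False using hN[OF Nab, of "d k"] bd Nab nz(1)[of k] crit[OF pk] by simp
    qed
  qed
  \<comment> \<open>If both parts adjacent to the knot were empty, h would equal \<epsilon> k N
    there from the left and \<epsilon> (Suc k) N from the right.\<close>
  have nondeg: "b k < d k \<or> T (Suc k) < a (Suc k)" for k
  proof (rule ccontr)
    assume neg: "\<not> ?thesis"
    then have np: "\<bar>f (T (Suc k))\<bar> \<noteq> M" using left by blast
    have bd: "b k = d k" "a k = T k" "a (Suc k) = T (Suc k)" "b (Suc k) = d (Suc k)"
      using neg order(3)[of k] order(1)[of "Suc k"] sym[of k] sym[of "Suc k"] by auto
    have "d k = T (Suc k)"
      using fD[of k "T (Suc k)"] order(4)[of k] np sign(1)[of k] M by (cases "d k < T (Suc k)") auto
    then have 1: "h (T (Suc k)) = \<epsilon> k * N" using hN[of k "T (Suc k)"] bd T_less[of k] by simp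
    have "a (Suc k) < b (Suc k)"
    proof (rule ccontr)
      assume "\<not> a (Suc k) < b (Suc k)"
      then have "d (Suc k) = T (Suc k)" using bd order(2)[of "Suc k"] by simp
      then have "f (T (Suc k)) = \<epsilon> (Suc k) * M" using fD[of "Suc k" "T (Suc k)"] T_less[of "Suc k"] by simp
      then show False using np sign(1)[of "Suc k"] M by auto
    qed
    then have "h (T (Suc k)) = \<epsilon> (Suc k) * N" using hN[of "Suc k" "T (Suc k)"] bd by simp
    then show False using 1 sign(2)[of k] nz(1)[of k] by simp
  qed
  have pn: "b k < d k \<and> T (Suc k) < a (Suc k)" if "\<bar>nderiv q \<phi> (T (Suc k))\<bar> = M" for k
    using left right that unfolding f_def by blast
  show ?thesis
    by (unfold_locales; (fact assms | fact peak[unfolded f_def] | fact pn | fact nondeg | rule bound))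
qed

text \<open>For \<open>W1\<close>, the function h is the derivative of order \<open>r - 1\<close> of the ideal spline. It has at most
  one zero between consecutive knots, and at most one in the union of two knot intervals with equal
  signs; hence 2n zeros in a period force alternating signs.\<close>

lemma alternating_signs:
  fixes h :: "real \<Rightarrow> real"
  assumes n: "n \<ge> 1" and M: "M > 0" and T_less: "\<And>k. T k < T (Suc k)"
    and per: "\<And>k. T (k + 2 * n) = T k + 2 * pi" "\<And>k. \<epsilon> (k + 2 * n) = \<epsilon> k"
    and order: "\<And>k. T k \<le> a k" "\<And>k. a k \<le> T (Suc k)"
    and sign: "\<And>k. \<epsilon> k = 1 \<or> \<epsilon> k = -1"
    and h: "continuous_on UNIV h" and up: "\<And>k. affine_on h (\<epsilon> k) (T k) (a k)"
    and flat: "\<And>k t. a k < t \<Longrightarrow> t < T (Suc k) \<Longrightarrow> h t = \<epsilon> k * M"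
    and zeros: "\<And>s. zero_rate s (2 * n) h"
  shows "\<epsilon> (Suc k) = - \<epsilon> k"
proof (rule ccontr)
  assume "\<epsilon> (Suc k) \<noteq> - \<epsilon> k"
  then have eq: "\<epsilon> (Suc k) = \<epsilon> k" using sign[of k] sign[of "Suc k"] by auto
  have mono: "strict_mono T" using T_less by (simp add: strict_mono_Suc_iff)
  have Tl: "T (j + 2 * n * l) = T j + 2 * pi * real l" for j l
  proof (induction l)
    case (Suc l)
    have "T (j + 2 * n * Suc l) = T ((j + 2 * n * l) + 2 * n)" by (simp add: algebra_simps)
    then show ?case using Suc per(1)[of "j + 2 * n * l"] by (simp add: algebra_simps)
  qed simp
  have el: "\<epsilon> (j + 2 * n * l) = \<epsilon> j" for j l
  proof (induction l)
    case (Suc l)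
    have "\<epsilon> (j + 2 * n * Suc l) = \<epsilon> ((j + 2 * n * l) + 2 * n)" by (simp add: algebra_simps)
    then show ?case using Suc per(2)[of "j + 2 * n * l"] by simp
  qed simp
  have hM: "h t = \<epsilon> k * M" if "a k < T (Suc k)" "a k \<le> t" "t \<le> T (Suc k)" for k t
    by (rule constant_closed_interval[OF h _ that(1)]) (use flat that in auto)
  have nz: "\<epsilon> k * M \<noteq> 0" "\<epsilon> k * \<epsilon> k = 1" for k using sign[of k] M by auto
  have za: "x < a k" if x: "T k \<le> x" "x < T (Suc k)" "h x = 0" for k x
    using hM[of k x] x nz(1)[of k] by (cases "x < a k") auto
  \<comment> \<open>Past a zero, \<epsilon> k h is positive up to the right end of the interval; at
    the left end of an interval with a zero it is not positive. For equal signs the two clash at the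
    common knot.\<close>
  have after: "\<epsilon> k * h y > 0" if x: "T k \<le> x" "h x = 0" "x < y" "y \<le> T (Suc k)" for k x y
  proof (cases "y \<le> a k")
    case True
    have "h y - h x = \<epsilon> k * (y - x)" by (rule affine_onD[OF up]) (use x True in auto)
    then have "\<epsilon> k * h y = (\<epsilon> k * \<epsilon> k) * (y - x)" using x by simp
    then show ?thesis using x nz(2)[of k] by simp
  next
    case False
    then have "h y = \<epsilon> k * M" using hM[of k y] x by auto
    then show ?thesis using nz(2)[of k] M by (simp flip: mult.assoc)
  qed
  have before: "\<epsilon> k * h (T k) \<le> 0" if y: "T k \<le> y" "h y = 0" "y < T (Suc k)" for k y
  proof -
    have "h y - h (T k) = \<epsilon> k * (y - T k)" by (rule affine_onD[OF up]) (use y za[OF y(1,3,2)] order(1)[of k] in auto)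
    then have "\<epsilon> k * h (T k) = - ((\<epsilon> k * \<epsilon> k) * (y - T k))" using y by (simp add: algebra_simps)
    then show ?thesis using y nz(2)[of k] by simp
  qed
  have single: "x = y" if "T k \<le> x" "x < T (Suc k)" "T k \<le> y" "y < T (Suc k)" "h x = 0" "h y = 0" for k x y
    using after[of k x y] after[of k y x] that by (cases x y rule: linorder_cases) auto
  have double: False if "T k \<le> x" "x < T (Suc k)" "T (Suc k) \<le> y" "y < T (Suc (Suc k))" "h x = 0" "h y = 0"
    "\<epsilon> (Suc k) = \<epsilon> k" for k x y
    using after[of k x "T (Suc k)"] before[of "Suc k" y] that by simp
  \<comment> \<open>Cell 0 of each period joins the intervals k and \<open>Suc k\<close>; the later
    cells are shifted by one, and \<open>2 * n - 1\<close> cells remain per period.\<close>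
  define J where "J = (\<lambda>l i. {T (k + 2 * n * l + (if i = 0 then 0 else i + 1))..<T (k + 2 * n * l + i + 2)})"
  have "2 * n \<le> 2 * n - 1"
  proof (rule zero_rate_le[OF zeros[of "T k"], where t = "T k" and J = J])
    fix x assume x: "h x = 0" "T k \<le> x"
    obtain L :: nat where L: "(x - T k) / (2 * pi) < L" using reals_Archimedean2 by blast
    then have "x < T (k + 2 * n * L)" unfolding Tl by (simp add: field_simps)
    then have ex: "\<exists>j. x < T (k + j)" by blast
    define j where "j = (LEAST j. x < T (k + j))"
    have j: "x < T (k + j)" unfolding j_def by (rule LeastI_ex[OF ex])
    then have "j \<noteq> 0" using x(2) by (cases j) auto
    then obtain m where m: "j = Suc m" by (cases j) auto
    have "T (k + m) \<le> x" using not_less_Least[of m "\<lambda>j. x < T (k + j)"] m by (simp add: j_def not_less)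
    then have xm: "T (k + m) \<le> x" "x < T (k + Suc m)" using j m by auto
    define l i where "l = m div (2 * n)" and "i = m mod (2 * n)"
    have m': "m = 2 * n * l + i" and i: "i < 2 * n" using n by (simp_all add: l_def i_def)
    have "T k + 2 * pi * real l \<le> x"
    proof -
      have "T (k + 2 * n * l) \<le> T (k + m)" using mono m' by (simp add: strict_mono_less_eq)
      then show ?thesis using xm by (simp add: Tl)
    qed
    moreover have "x \<in> J l (i - 1)"
    proof (cases "i = 0")
      case True
      have "T (k + Suc m) \<le> T (k + 2 * n * l + 0 + 2)" using mono m' True by (simp add: strict_mono_less_eq)
      then show ?thesis using xm m' True by (simp add: J_def add.assoc)
    next
      case False
      have "T (k + 2 * n * l + (if i - 1 = 0 then 0 else i - 1 + 1)) \<le> T (k + m)"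
        using mono m' False by (simp add: strict_mono_less_eq)
      moreover have "T (k + Suc m) = T (k + 2 * n * l + (i - 1) + 2)" using m' False by (intro arg_cong[of _ _ T]) simp
      ultimately show ?thesis using xm by (simp only: J_def atLeastLessThan_iff order_trans)
    qed
    moreover have "i - 1 < 2 * n - 1" using i n by arith
    ultimately show "\<exists>l i. i < 2 * n - 1 \<and> 2 * pi * real l \<le> x - T k \<and> x \<in> J l i" by (intro exI[of _ l] exI[of _ "i - 1"]) auto
  next
    fix l i x y assume xy: "x \<in> J l i" "y \<in> J l i" "h x = 0" "h y = 0"
    let ?K = "k + 2 * n * l"
    show "x = y"
    proof (cases "i = 0")
      case True
      have e: "\<epsilon> (Suc ?K) = \<epsilon> ?K" using el[of "Suc k" l] el[of k l] eq by simp
      have "T ?K \<le> x" "x < T (Suc (Suc ?K))" "T ?K \<le> y" "y < T (Suc (Suc ?K))"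
        using xy True by (simp_all add: J_def)
      then show ?thesis
        using single[of ?K x y] single[of "Suc ?K" x y] double[of ?K x y] double[of ?K y x] xy e
        by (cases "x < T (Suc ?K)"; cases "y < T (Suc ?K)") auto
    next
      case False
      then show ?thesis using xy single[of "?K + i + 1" x y] by (simp add: J_def)
    qed
  qed
  then show False using n by simp
qed

text \<open>The class \<open>W1\<close> bounds the order r - 1 only. Its M therefore takes the place
  of N in the frame, and the place of M goes to a number \<open>M'\<close> that the derivative of
  order q never reaches in modulus, so that no knot is a peak.\<close>

lemma one_sided_spline_frame:
  assumes n: "n \<ge> 1" and M: "M > 0" and M': "M' > 0" and T_less: "\<And>k. T k < T (Suc k)"
    and per: "\<And>k. T (k + 2 * n) = T k + 2 * pi" "\<And>k. a (k + 2 * n) = a k + 2 * pi" "\<And>k. \<epsilon> (k + 2 * n) = \<epsilon> k"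
    and order: "\<And>k. T k \<le> a k" "\<And>k. a k \<le> T (Suc k)"
    and sign: "\<And>k. \<epsilon> k = 1 \<or> \<epsilon> k = -1"
    and phi: "periodic \<phi>" "smooth (Suc q) \<phi>" "continuous_on UNIV (nderiv (Suc q) \<phi>)"
    and up: "\<And>k. affine_on (nderiv (Suc q) \<phi>) (\<epsilon> k) (T k) (a k)"
    and flat: "\<And>k t. a k < t \<Longrightarrow> t < T (Suc k) \<Longrightarrow> nderiv (Suc q) \<phi> t = \<epsilon> k * M"
    and bound: "\<And>t. \<bar>nderiv (Suc q) \<phi> t\<bar> \<le> M" "\<And>t. \<bar>nderiv q \<phi> t\<bar> < M'"
    and zeros: "\<And>s. zero_rate s (2 * n) \<phi>"
  shows "spline_frame n q T a (\<lambda>k. T (Suc k)) (\<lambda>k. T (Suc k)) \<epsilon> M' M \<phi>"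
proof -
  define h where "h = nderiv (Suc q) \<phi>"
  have "zero_rate s (2 * n) h" for s
    unfolding h_def by (rule zero_rate_nderiv[OF _ phi(2) zeros]) (use n in auto)
  then have alt: "\<epsilon> (Suc k) = - \<epsilon> k" for k
    using alternating_signs[of n M T \<epsilon> a h k] n M T_less per(1,3) order sign phi(3) up flat unfolding h_def by blast
  have hM: "h t = \<epsilon> k * M" if "a k < T (Suc k)" "a k \<le> t" "t \<le> T (Suc k)" for k t
    by (rule constant_closed_interval[OF phi(3)[folded h_def] _ that(1)]) (use flat that in \<open>auto simp: h_def\<close>)
  \<comment> \<open>If the first part were empty, h would be -\<epsilon> k M at its left knot. The
    preceding interval cannot end with this value: on a flat part h is \<epsilon> k M, and with no
    flat part \<epsilon> k h rises over the whole interval, so it would start below -M.\<close>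
  have nondeg: "T (Suc k) < a (Suc k)" for k
  proof (rule ccontr)
    assume "\<not> T (Suc k) < a (Suc k)"
    then have "h (T (Suc k)) = \<epsilon> (Suc k) * M"
      using hM[of "Suc k" "T (Suc k)"] order(1)[of "Suc k"] T_less[of "Suc k"] by simp
    then have hT: "h (T (Suc k)) = - \<epsilon> k * M" using alt[of k] by simp
    show False
    proof (cases "a k < T (Suc k)")
      case True
      then show False using hM[of k "T (Suc k)"] hT sign[of k] M by auto
    next
      case False
      then have "a k = T (Suc k)" using order(2)[of k] by simp
      then have "h (T (Suc k)) - h (T k) = \<epsilon> k * (T (Suc k) - T k)"
        using affine_onD[OF up[of k], of "T k" "T (Suc k)"] T_less[of k] by (simp add: h_def)
      then show False using hT bound(1)[of "T k"] sign[of k] T_less[of k] by (auto simp: h_def)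
    qed
  qed
  have nM: "\<bar>nderiv q \<phi> t\<bar> \<noteq> M'" for t using bound(2)[of t] by simp
  have triv: "affine_on S c x x" for S c x by (simp add: affine_on_def)
  have per': "T (Suc (k + 2 * n)) = T (Suc k) + 2 * pi" for k using per(1)[of "Suc k"] by simp
  show ?thesis
    by (unfold_locales; (fact assms | fact alt | fact per' | rule triv | rule order_refl | rule less_imp_le, rule bound
        | (use nM nondeg flat in \<open>simp del: funpow.simps\<close>)))
qed

section \<open>From one period to periodic sequences of knots\<close>

lemma const_on_empty: "b \<le> a \<Longrightarrow> const_on g c a b"
  by (simp add: const_on_def)

text \<open>The rule ends with the last interval of the period. Its sign is opposite to that of the
  first one, since \<open>2 * n - 1\<close> changes give an odd power of -1.\<close>

lemma alternating_wrap:
  fixes \<epsilon> :: "nat \<Rightarrow> real"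
  assumes n: "n \<ge> 1" and alt: "\<And>k. k \<in> {1..<2*n} \<Longrightarrow> \<epsilon> (k + 1) = - \<epsilon> k"
  shows "ext n \<epsilon> (Suc k) = - ext n \<epsilon> k"
proof (cases "Suc (k mod (2 * n)) = 2 * n")
  case True
  have "j < 2 * n \<Longrightarrow> \<epsilon> (1 + j) = (-1) ^ j * \<epsilon> 1" for j
  proof (induction j)
    case (Suc j)
    then show ?case using alt[of "1 + j"] by simp
  qed simp
  from this[of "2 * n - 1"] have "\<epsilon> (2 * n) = - \<epsilon> 1" using n by (simp add: uminus_power_if)
  moreover have "Suc k mod (2 * n) = 0" using True by (simp add: mod_Suc)
  ultimately show ?thesis using True by (simp add: ext_def)
next
  case False
  have "k mod (2 * n) < 2 * n" using n by simp
  then have "1 + k mod (2 * n) \<in> {1..<2*n}" using False by auto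
  then show ?thesis using alt[of "1 + k mod (2 * n)"] False by (simp add: ext_def mod_Suc)
qed

lemma unit_class_continuous: "x \<in> unit_class (Suc q) \<Longrightarrow> continuous_on UNIV (nderiv (Suc q) x)"
  by (auto simp: unit_class_def simp del: funpow.simps intro: lipschitz_on_continuous_on)

lemma unit_class_loc_abs_cont: "x \<in> unit_class m \<Longrightarrow> loc_abs_cont (nderiv m x)"
  by (intro lipschitz_imp_loc_abs_cont[of _ 1]) (auto simp: unit_class_def lipschitz_real_iff)

lemma affine_on_translates:
  assumes "periodic S" "affine_on S c (t (1 + k mod (2 * n)) + x) (t (1 + k mod (2 * n)) + y)"
  shows "affine_on S c (knots n t k + x) (knots n t k + y)"
  using affine_on_shift[OF assms, of "k div (2 * n)"] by (simp add: knots_def ext_def algebra_simps)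

lemma const_on_translates:
  assumes "periodic S" "const_on S c (t (1 + k mod (2 * n)) + x) (t (1 + k mod (2 * n)) + y)"
  shows "const_on S c (knots n t k + x) (knots n t k + y)"
  using const_on_shift[OF assms, of "k div (2 * n)"] by (simp add: knots_def ext_def algebra_simps)

text \<open>All end points are written as a knot plus an offset, the form in which translation
  carries one period to all others.\<close>

lemma W12_frame:
  assumes n: "n \<ge> 1" and M: "M > 0" and N: "N > 0"
    and phi: "\<phi> \<in> unit_class (Suc q)" "bounded_by (nderiv q \<phi>) M"
    and t: "strict_mono_on {1..2*n + 1} t" "t (2*n + 1) = t 1 + 2 * pi"
    and piece: "\<And>k. k \<in> {1..2*n} \<Longrightarrow> \<epsilon> k \<in> {1, -1} \<and>
      ideal_piece (W12 (q + 2) M N) \<phi> (t k) (t (k + 1)) (\<epsilon> k) (\<alpha> k) (\<beta> k)"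
    and alt: "\<And>k. k \<in> {1..<2*n} \<Longrightarrow> \<epsilon> (k + 1) = - \<epsilon> k"
  shows "spline_frame n q (knots n t) (\<lambda>k. knots n t k + ext n \<beta> k / 2)
    (\<lambda>k. knots n t k + (ext n \<alpha> k - ext n \<beta> k / 2)) (\<lambda>k. knots n t k + ext n \<alpha> k) (ext n \<epsilon>) M N \<phi>"
proof -
  define f where "f = nderiv q \<phi>"
  define h where "h = nderiv (Suc q) \<phi>"
  have lac: "loc_abs_cont h" unfolding h_def by (rule unit_class_loc_abs_cont[OF phi(1)])
  have per: "periodic f" "periodic h" unfolding f_def h_def using phi(1)
    by (auto simp: unit_class_def simp del: funpow.simps intro: periodic_nderiv)
  have nd: "nderiv (q + 2) \<phi> = deriv h" "nderiv (q + 2 - 1) \<phi> = h" "nderiv (q + 2 - 2) \<phi> = f"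
    by (simp_all add: h_def f_def)
  define i where "i = (\<lambda>k. 1 + k mod (2 * n))"
  have i: "i k \<in> {1..2*n}" for k unfolding i_def by (rule ext_index[OF n])
  have ext: "ext n g k = g (i k)" for g k by (simp add: ext_def i_def)
  have gap: "knots n t (Suc k) - knots n t k = t (i k + 1) - t (i k)" for k
    using knots_Suc[of n t k, OF n t(2)] by (simp add: knots_def ext_def i_def)
  have tr: "affine_on S c (knots n t k + x) (knots n t k + y)"
    if "periodic S" "affine_on S c (t (i k) + x) (t (i k) + y)" for S c k x y
    using affine_on_translates[OF that(1), of c t k n x y] that(2) unfolding i_def by blast
  have ctr: "const_on S c (knots n t k + x) (knots n t k + y)"
    if "periodic S" "const_on S c (t (i k) + x) (t (i k) + y)" for S c k x y
    using const_on_translates[OF that(1), of c t k n x y] that(2) unfolding i_def by blast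
  have P: "\<epsilon> (i k) = 1 \<or> \<epsilon> (i k) = -1" "0 \<le> \<alpha> (i k)" "\<alpha> (i k) \<le> t (i k + 1) - t (i k)" "0 \<le> \<beta> (i k)" "\<beta> (i k) \<le> \<alpha> (i k)"
     "const_on (deriv h) (\<epsilon> (i k)) (t (i k)) (t (i k) + \<beta> (i k)/2)"
     "const_on h (\<epsilon> (i k) * N) (t (i k) + \<beta> (i k)/2) (t (i k) + \<alpha> (i k) - \<beta> (i k)/2)"
     "const_on (deriv h) (- \<epsilon> (i k)) (t (i k) + \<alpha> (i k) - \<beta> (i k)/2) (t (i k) + \<alpha> (i k))"
     "const_on f (\<epsilon> (i k) * M) (t (i k) + \<alpha> (i k)) (t (i k + 1))" for k
    using piece[OF i[of k]] unfolding ideal_piece.simps nd by blast+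
  have tless: "t (i k) < t (i k + 1)" for k
    using strict_mono_onD[OF t(1), of "i k" "i k + 1"] i[of k] by simp
  show ?thesis
  proof (rule symmetric_spline_frame[OF n M N])
    fix k
    show "knots n t k < knots n t (Suc k)" using gap[of k] tless[of k] by linarith
    show "knots n t k + ext n \<alpha> k \<le> knots n t (Suc k)" using gap[of k] P(3)[of k] by (simp add: ext)
    show "knots n t k \<le> knots n t k + ext n \<beta> k / 2" using P(4)[of k] by (simp add: ext)
    show "knots n t k + ext n \<beta> k / 2 \<le> knots n t k + (ext n \<alpha> k - ext n \<beta> k / 2)"
      "knots n t k + (ext n \<alpha> k - ext n \<beta> k / 2) \<le> knots n t k + ext n \<alpha> k"
      using P(4,5)[of k] by (simp_all add: ext)
    show "knots n t (k + 2 * n) = knots n t k + 2 * pi" by (rule knots_add[OF n])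
    then show "knots n t (k + 2 * n) + ext n \<beta> (k + 2 * n) / 2 = knots n t k + ext n \<beta> k / 2 + 2 * pi"
      "knots n t (k + 2 * n) + (ext n \<alpha> (k + 2 * n) - ext n \<beta> (k + 2 * n) / 2) = knots n t k + (ext n \<alpha> k - ext n \<beta> k / 2) + 2 * pi"
      "knots n t (k + 2 * n) + ext n \<alpha> (k + 2 * n) = knots n t k + ext n \<alpha> k + 2 * pi"
      by (simp_all add: ext_add)
    show "ext n \<epsilon> k = 1 \<or> ext n \<epsilon> k = -1" using P(1)[of k] by (simp add: ext)
    show "ext n \<epsilon> (Suc k) = - ext n \<epsilon> k" by (rule alternating_wrap[where \<epsilon> = \<epsilon>, OF n alt])
    show "affine_on (nderiv (Suc q) \<phi>) (ext n \<epsilon> k) (knots n t k) (knots n t k + ext n \<beta> k / 2)"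
      using tr[OF per(2), of "\<epsilon> (i k)" k 0 "\<beta> (i k) / 2"] P(6)[of k]
      unfolding const_on_deriv_iff[OF lac] by (simp add: ext h_def[symmetric] del: funpow.simps)
    show "affine_on (nderiv (Suc q) \<phi>) (- ext n \<epsilon> k) (knots n t k + (ext n \<alpha> k - ext n \<beta> k / 2)) (knots n t k + ext n \<alpha> k)"
      using tr[OF per(2), of "- \<epsilon> (i k)" k "\<alpha> (i k) - \<beta> (i k) / 2" "\<alpha> (i k)"] P(8)[of k]
      unfolding const_on_deriv_iff[OF lac] by (simp add: ext h_def[symmetric] add_diff_eq del: funpow.simps)
    show "nderiv (Suc q) \<phi> s = ext n \<epsilon> k * N"
      if "knots n t k + ext n \<beta> k / 2 < s" "s < knots n t k + (ext n \<alpha> k - ext n \<beta> k / 2)" for s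
      using ctr[OF per(2), of "\<epsilon> (i k) * N" k "\<beta> (i k) / 2" "\<alpha> (i k) - \<beta> (i k) / 2"] P(7)[of k] that
      by (simp add: ext h_def[symmetric] add_diff_eq const_on_def del: funpow.simps)
    show "nderiv q \<phi> s = ext n \<epsilon> k * M"
      if "knots n t k + ext n \<alpha> k < s" "s < knots n t (Suc k)" for s
      using ctr[OF per(1), of "\<epsilon> (i k) * M" k "\<alpha> (i k)" "t (i k + 1) - t (i k)"] P(9)[of k] that gap[of k]
      by (simp add: ext f_def[symmetric] const_on_def algebra_simps)
    show "\<bar>nderiv q \<phi> s\<bar> \<le> M" for s using phi(2) by (simp add: bounded_by_def)
    show "knots n t k + ext n \<beta> k / 2 - knots n t k = knots n t k + ext n \<alpha> k - (knots n t k + (ext n \<alpha> k - ext n \<beta> k / 2))"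
      by simp
  qed (use phi(1) unit_class_continuous[OF phi(1)] in \<open>auto simp: unit_class_def simp del: funpow.simps\<close>)
qed

lemma W1_frame:
  assumes n: "n \<ge> 1" and M: "M > 0" and M': "\<And>s. \<bar>nderiv q \<phi> s\<bar> < M'"
    and phi: "\<phi> \<in> unit_class (Suc q)" "bounded_by (nderiv (Suc q) \<phi>) M"
    and t: "strict_mono_on {1..2*n + 1} t" "t (2*n + 1) = t 1 + 2 * pi"
    and piece: "\<And>k. k \<in> {1..2*n} \<Longrightarrow> \<epsilon> k \<in> {1, -1} \<and>
      ideal_piece (W1 (q + 2) M) \<phi> (t k) (t (k + 1)) (\<epsilon> k) (\<alpha> k) (\<beta> k)"
    and zeros: "\<And>s. zero_rate s (2 * n) \<phi>"
  shows "spline_frame n q (knots n t) (\<lambda>k. knots n t k + ext n \<alpha> k)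
    (\<lambda>k. knots n t (Suc k)) (\<lambda>k. knots n t (Suc k)) (ext n \<epsilon>) M' M \<phi>"
proof -
  define h where "h = nderiv (Suc q) \<phi>"
  have lac: "loc_abs_cont h" unfolding h_def by (rule unit_class_loc_abs_cont[OF phi(1)])
  have per: "periodic h" unfolding h_def using phi(1)
    by (auto simp: unit_class_def simp del: funpow.simps intro: periodic_nderiv)
  have nd: "nderiv (q + 2) \<phi> = deriv h" "nderiv (q + 2 - 1) \<phi> = h"
    by (simp_all add: h_def)
  define i where "i = (\<lambda>k. 1 + k mod (2 * n))"
  have i: "i k \<in> {1..2*n}" for k unfolding i_def by (rule ext_index[OF n])
  have ext: "ext n g k = g (i k)" for g k by (simp add: ext_def i_def)
  have gap: "knots n t (Suc k) - knots n t k = t (i k + 1) - t (i k)" for k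
    using knots_Suc[of n t k, OF n t(2)] by (simp add: knots_def ext_def i_def)
  have tr: "affine_on S c (knots n t k + x) (knots n t k + y)"
    if "periodic S" "affine_on S c (t (i k) + x) (t (i k) + y)" for S c k x y
    using affine_on_translates[OF that(1), of c t k n x y] that(2) unfolding i_def by blast
  have ctr: "const_on S c (knots n t k + x) (knots n t k + y)"
    if "periodic S" "const_on S c (t (i k) + x) (t (i k) + y)" for S c k x y
    using const_on_translates[OF that(1), of c t k n x y] that(2) unfolding i_def by blast
  have P: "\<epsilon> (i k) = 1 \<or> \<epsilon> (i k) = -1" "0 \<le> \<alpha> (i k)" "\<alpha> (i k) \<le> t (i k + 1) - t (i k)"
     "const_on (deriv h) (\<epsilon> (i k)) (t (i k)) (t (i k) + \<alpha> (i k))"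
     "const_on h (\<epsilon> (i k) * M) (t (i k) + \<alpha> (i k)) (t (i k + 1))" for k
    using piece[OF i[of k]] unfolding ideal_piece.simps nd by blast+
  have tless: "t (i k) < t (i k + 1)" for k
    using strict_mono_onD[OF t(1), of "i k" "i k + 1"] i[of k] by simp
  show ?thesis
  proof (rule one_sided_spline_frame[OF n M])
    show "M' > 0" using M'[of 0] by linarith
    fix k
    show "knots n t k < knots n t (Suc k)" using gap[of k] tless[of k] by linarith
    show "knots n t k \<le> knots n t k + ext n \<alpha> k" using P(2)[of k] by (simp add: ext)
    show "knots n t k + ext n \<alpha> k \<le> knots n t (Suc k)" using gap[of k] P(3)[of k] by (simp add: ext)
    show "knots n t (k + 2 * n) = knots n t k + 2 * pi" by (rule knots_add[OF n])
    then show "knots n t (k + 2 * n) + ext n \<alpha> (k + 2 * n) = knots n t k + ext n \<alpha> k + 2 * pi"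
      by (simp add: ext_add)
    show "ext n \<epsilon> (k + 2 * n) = ext n \<epsilon> k" by (rule ext_add)
    show "ext n \<epsilon> k = 1 \<or> ext n \<epsilon> k = -1" using P(1)[of k] by (simp add: ext)
    show "affine_on (nderiv (Suc q) \<phi>) (ext n \<epsilon> k) (knots n t k) (knots n t k + ext n \<alpha> k)"
      using tr[OF per, of "\<epsilon> (i k)" k 0 "\<alpha> (i k)"] P(4)[of k]
      unfolding const_on_deriv_iff[OF lac] by (simp add: ext h_def[symmetric] del: funpow.simps)
    show "nderiv (Suc q) \<phi> s = ext n \<epsilon> k * M"
      if "knots n t k + ext n \<alpha> k < s" "s < knots n t (Suc k)" for s
      using ctr[OF per, of "\<epsilon> (i k) * M" k "\<alpha> (i k)" "t (i k + 1) - t (i k)"] P(5)[of k] that gap[of k]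
      by (simp add: ext h_def[symmetric] const_on_def algebra_simps del: funpow.simps)
    show "\<bar>nderiv (Suc q) \<phi> s\<bar> \<le> M" for s using phi(2) by (simp add: bounded_by_def del: funpow.simps)
    show "\<bar>nderiv q \<phi> s\<bar> < M'" for s by (rule M')
    show "zero_rate s (2 * n) \<phi>" for s by (rule zeros)
  qed (use phi(1) unit_class_continuous[OF phi(1)] in \<open>auto simp: unit_class_def simp del: funpow.simps\<close>)
qed

section \<open>The spaces S as splines of the frame\<close>

lemma spline_space_W12:
  assumes t: "t (2*n + 1) = t 1 + 2 * pi"
    and frame: "spline_frame n q (knots n t) (\<lambda>k. knots n t k + ext n \<beta> k / 2)
      (\<lambda>k. knots n t k + (ext n \<alpha> k - ext n \<beta> k / 2)) (\<lambda>k. knots n t k + ext n \<alpha> k) (ext n \<epsilon>) M N \<phi>"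
  shows "spline_space (W12 (q + 2) M N') n \<phi> t \<alpha> \<beta> =
    {s. spline_frame.spline n q (knots n t) (\<lambda>k. knots n t k + ext n \<beta> k / 2)
      (\<lambda>k. knots n t k + (ext n \<alpha> k - ext n \<beta> k / 2)) (\<lambda>k. knots n t k + ext n \<alpha> k) M \<phi> s}"
proof -
  interpret F: spline_frame n q "knots n t" "\<lambda>k. knots n t k + ext n \<beta> k / 2"
    "\<lambda>k. knots n t k + (ext n \<alpha> k - ext n \<beta> k / 2)" "\<lambda>k. knots n t k + ext n \<alpha> k" "ext n \<epsilon>" M N \<phi>
    by (rule frame)
  define i where "i = (\<lambda>k. 1 + k mod (2 * n))"
  have i: "i k \<in> {1..2*n}" for k unfolding i_def by (rule ext_index[OF F.n])
  have ext: "ext n g k = g (i k)" for g k by (simp add: ext_def i_def)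
  have gap: "knots n t (Suc k) = knots n t k + (t (i k + 1) - t (i k))" for k
    using knots_Suc[of n t k, OF F.n t] by (simp add: knots_def ext_def i_def)
  have kn: "knots n t k = t (i k) + 2 * pi * real (k div (2 * n))"
    "knots n t (Suc k) = t (i k + 1) + 2 * pi * real (k div (2 * n))" for k
    using knots_Suc[of n t k, OF F.n t] by (simp_all add: knots_def ext_def i_def)
  have at_knot: "g (knots n t k) = g (t (i k))" "g (knots n t (Suc k)) = g (t (i k + 1))" if "periodic g" for g k
    unfolding kn(2) by (simp only: kn(1) periodic_add_nat[OF that], rule periodic_add_nat[OF that])
  have pf: "periodic (nderiv q \<phi>)" by (rule periodic_nderiv[OF F.phi(1)])
  have fM: "\<bar>nderiv q \<phi> (t (i k + 1))\<bar> \<le> M" for k using F.bound[of k] at_knot(2)[OF pf, of k] by simp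
  define piece where "piece = (\<lambda>S c c' k. affine_on S c (t k) (t k + \<beta> k / 2) \<and>
     affine_on S c' (t k + \<alpha> k - \<beta> k / 2) (t k + \<alpha> k) \<and>
     affine_on S 0 (t k + \<beta> k / 2) (t k + \<alpha> k - \<beta> k / 2) \<and> affine_on S 0 (t k + \<alpha> k) (t (k + 1)))"
  have space: "s \<in> spline_space (W12 (q + 2) M N') n \<phi> t \<alpha> \<beta> \<longleftrightarrow>
     periodic s \<and> smooth q s \<and> (\<exists>L. L-lipschitz_on UNIV (nderiv q s)) \<and> (\<exists>c1 c2. c1 (2 * n + 1) = c1 1 \<and>
       (\<forall>k\<in>{1..2*n}. piece (nderiv q s) (c1 k) (c2 k) k \<and>
         (\<bar>nderiv q \<phi> (t k)\<bar> = M \<longrightarrow> nderiv q s (t k) = 0) \<and>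
         (\<bar>nderiv q \<phi> (t (k + 1))\<bar> < M \<longrightarrow> c2 k = c1 (k + 1))))" for s
  proof (cases "s \<in> L_inf (Suc q)")
    case True
    then have "loc_abs_cont (nderiv q s)" by (simp add: L_inf_def)
    from const_on_deriv_iff[OF this] show ?thesis
      using True unfolding L_inf_Suc_iff piece_def by (simp add: L_inf_Suc_iff conj_ac)
  qed (auto simp: L_inf_Suc_iff)
  have piece_iff: "piece S c c' (i k) \<longleftrightarrow>
     affine_on S c (knots n t k) (knots n t k + ext n \<beta> k / 2) \<and>
     affine_on S 0 (knots n t k + ext n \<beta> k / 2) (knots n t k + (ext n \<alpha> k - ext n \<beta> k / 2)) \<and>
     affine_on S c' (knots n t k + (ext n \<alpha> k - ext n \<beta> k / 2)) (knots n t k + ext n \<alpha> k) \<and>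
     affine_on S 0 (knots n t k + ext n \<alpha> k) (knots n t (Suc k))" if "periodic S" for S c c' k
  proof -
    have *: "affine_on S c (knots n t k + x) (knots n t k + y) \<longleftrightarrow> affine_on S c (t (i k) + x) (t (i k) + y)" for c x y
      using affine_on_unshift[OF that, of c "t (i k) + x" "k div (2 * n)" "t (i k) + y"]
      by (simp add: knots_def ext_def i_def algebra_simps)
    have "affine_on S c (knots n t k) (knots n t k + y) \<longleftrightarrow> affine_on S c (t (i k)) (t (i k) + y)" for y
      using *[of c 0 y] by simp
    then show ?thesis unfolding piece_def gap ext * by (auto simp: add_diff_eq)
  qed
  have sp: "spline_frame.spline n q (knots n t) (\<lambda>k. knots n t k + ext n \<beta> k / 2)
      (\<lambda>k. knots n t k + (ext n \<alpha> k - ext n \<beta> k / 2)) (\<lambda>k. knots n t k + ext n \<alpha> k) M \<phi> s \<longleftrightarrow>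
     periodic s \<and> smooth q s \<and> (\<exists>L. L-lipschitz_on UNIV (nderiv q s)) \<and>
     (\<exists>c1 c2. (\<forall>k. piece (nderiv q s) (c1 k) (c2 k) (i k) \<and>
       (if \<bar>nderiv q \<phi> (t (i k + 1))\<bar> = M then nderiv q s (t (i k + 1)) = 0 else c2 k = c1 (Suc k))) \<and> c1 (2 * n) = c1 0)" for s
  proof (cases "periodic s")
    case True
    have ps: "periodic (nderiv q s)" by (rule periodic_nderiv[OF True])
    show ?thesis
      unfolding F.spline_def F.spline_pieces_def piece_iff[OF ps] at_knot(2)[OF ps] at_knot(2)[OF pf]
      by (simp only: conj_assoc)
  qed (simp add: F.spline_def)
  have "s \<in> spline_space (W12 (q + 2) M N') n \<phi> t \<alpha> \<beta> \<longleftrightarrow> spline_frame.spline n q (knots n t) (\<lambda>k. knots n t k + ext n \<beta> k / 2)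
      (\<lambda>k. knots n t k + (ext n \<alpha> k - ext n \<beta> k / 2)) (\<lambda>k. knots n t k + ext n \<alpha> k) M \<phi> s" for s
    unfolding space sp
  proof (intro conj_cong refl iffI; elim exE conjE)
    assume "periodic s"
    then have ps: "periodic (nderiv q s)" by (rule periodic_nderiv)
    have wrap: "nderiv q s (t (2 * n + 1)) = nderiv q s (t 1)" "nderiv q \<phi> (t (2 * n + 1)) = nderiv q \<phi> (t 1)"
      using ps pf unfolding t periodic_def by blast+
    fix c1 c2 :: "nat \<Rightarrow> real"
    {
      assume c: "c1 (2 * n + 1) = c1 1" and all: "\<forall>k\<in>{1..2*n}. piece (nderiv q s) (c1 k) (c2 k) k \<and>
         (\<bar>nderiv q \<phi> (t k)\<bar> = M \<longrightarrow> nderiv q s (t k) = 0) \<and>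
         (\<bar>nderiv q \<phi> (t (k + 1))\<bar> < M \<longrightarrow> c2 k = c1 (k + 1))"
      \<comment> \<open>S has the vanishing condition at the left ends, the frame at the right ends;
        the right end of the last interval is the first knot one period later.\<close>
      have z: "nderiv q s (t (i k + 1)) = 0" if "\<bar>nderiv q \<phi> (t (i k + 1))\<bar> = M" for k
      proof (cases "i k = 2 * n")
        case True
        then show ?thesis using all[rule_format, of 1] that wrap F.n by simp
      next
        case False
        then show ?thesis using all[rule_format, of "i k + 1"] that i[of k] by simp
      qed
      have e: "ext n c1 (Suc k) = c1 (i k + 1)" for k
        using ext_Suc[of n c1 k, OF F.n c] by (simp add: i_def)
      have less: "\<bar>nderiv q \<phi> (t (i k + 1))\<bar> < M" if "\<bar>nderiv q \<phi> (t (i k + 1))\<bar> \<noteq> M" for k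
        using fM[of k] that by simp
      have "\<forall>k. piece (nderiv q s) (ext n c1 k) (ext n c2 k) (i k) \<and>
       (if \<bar>nderiv q \<phi> (t (i k + 1))\<bar> = M then nderiv q s (t (i k + 1)) = 0 else ext n c2 k = ext n c1 (Suc k))"
        using all[rule_format, OF i] z less unfolding e unfolding ext by simp
      moreover have "ext n c1 (2 * n) = ext n c1 0" by (simp add: ext_def)
      ultimately show "\<exists>c1 c2. (\<forall>k. piece (nderiv q s) (c1 k) (c2 k) (i k) \<and>
       (if \<bar>nderiv q \<phi> (t (i k + 1))\<bar> = M then nderiv q s (t (i k + 1)) = 0 else c2 k = c1 (Suc k))) \<and> c1 (2 * n) = c1 0"
        by blast
    }
    {
      assume c: "c1 (2 * n) = c1 0" and all: "\<forall>k. piece (nderiv q s) (c1 k) (c2 k) (i k) \<and>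
       (if \<bar>nderiv q \<phi> (t (i k + 1))\<bar> = M then nderiv q s (t (i k + 1)) = 0 else c2 k = c1 (Suc k))"
      have at: "piece (nderiv q s) (c1 (k - 1)) (c2 (k - 1)) k"
        "\<bar>nderiv q \<phi> (t (k + 1))\<bar> = M \<Longrightarrow> nderiv q s (t (k + 1)) = 0"
        "\<bar>nderiv q \<phi> (t (k + 1))\<bar> \<noteq> M \<Longrightarrow> c2 (k - 1) = c1 k" if "k \<in> {1..2*n}" for k
      proof -
        have "i (k - 1) = k" "Suc (k - 1) = k" using that by (auto simp: i_def)
        then show "piece (nderiv q s) (c1 (k - 1)) (c2 (k - 1)) k"
          "\<bar>nderiv q \<phi> (t (k + 1))\<bar> = M \<Longrightarrow> nderiv q s (t (k + 1)) = 0"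
          "\<bar>nderiv q \<phi> (t (k + 1))\<bar> \<noteq> M \<Longrightarrow> c2 (k - 1) = c1 k"
          using all[rule_format, of "k - 1"] by auto
      qed
      have z: "nderiv q s (t k) = 0" if "\<bar>nderiv q \<phi> (t k)\<bar> = M" "k \<in> {1..2*n}" for k
      proof (cases "k = 1")
        case True
        then show ?thesis using at(2)[of "2 * n"] that wrap F.n by simp
      next
        case False
        then have "k - 1 \<in> {1..2*n}" "k - 1 + 1 = k" using that(2) by auto
        then show ?thesis using at(2)[of "k - 1"] that(1) by simp
      qed
      show "\<exists>c1 c2. c1 (2 * n + 1) = c1 1 \<and>
       (\<forall>k\<in>{1..2*n}. piece (nderiv q s) (c1 k) (c2 k) k \<and>
         (\<bar>nderiv q \<phi> (t k)\<bar> = M \<longrightarrow> nderiv q s (t k) = 0) \<and>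
         (\<bar>nderiv q \<phi> (t (k + 1))\<bar> < M \<longrightarrow> c2 k = c1 (k + 1)))"
        \<comment> \<open>The frame numbers from 0, hence \<open>k - 1\<close>.\<close>
        by (rule exI[of _ "\<lambda>k. c1 (k - 1)"], rule exI[of _ "\<lambda>k. c2 (k - 1)"]) (use c at z in auto)
    }
  qed
  then show ?thesis by blast
qed

text \<open>For \<open>\<beta> = \<alpha>\<close> the part between the two outer ones is empty, and
  its condition holds trivially.\<close>

lemma spline_space_W2:
  "spline_space (W2 r M) n \<phi> t \<alpha> \<beta> = spline_space (W12 r M N) n \<phi> t \<alpha> \<alpha>"
proof -
  have half: "x + y - y / 2 = x + y / (2::real)" for x y by (simp add: field_simps)
  show ?thesis by (simp add: half const_on_empty)
qed

text \<open>As \<open>M'\<close> is never attained, every knot asks for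
  \<open>c2 k = c1 (Suc k)\<close>. The third part being a single point, this merely defines
  \<open>c2\<close>.\<close>

lemma spline_space_W1:
  assumes t: "t (2*n + 1) = t 1 + 2 * pi" and M': "\<And>s. \<bar>nderiv q \<phi> s\<bar> < M'"
    and frame: "spline_frame n q (knots n t) (\<lambda>k. knots n t k + ext n \<alpha> k)
      (\<lambda>k. knots n t (Suc k)) (\<lambda>k. knots n t (Suc k)) (ext n \<epsilon>) M' M \<phi>"
  shows "spline_space (W1 (q + 2) M) n \<phi> t \<alpha> \<beta> =
    {s. spline_frame.spline n q (knots n t) (\<lambda>k. knots n t k + ext n \<alpha> k)
      (\<lambda>k. knots n t (Suc k)) (\<lambda>k. knots n t (Suc k)) M' \<phi> s}"
proof -
  interpret F: spline_frame n q "knots n t" "\<lambda>k. knots n t k + ext n \<alpha> k"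
    "\<lambda>k. knots n t (Suc k)" "\<lambda>k. knots n t (Suc k)" "ext n \<epsilon>" M' M \<phi>
    by (rule frame)
  define i where "i = (\<lambda>k. 1 + k mod (2 * n))"
  have i: "i k \<in> {1..2*n}" for k unfolding i_def by (rule ext_index[OF F.n])
  have ext: "ext n g k = g (i k)" for g k by (simp add: ext_def i_def)
  have gap: "knots n t (Suc k) = knots n t k + (t (i k + 1) - t (i k))" for k
    using knots_Suc[of n t k, OF F.n t] by (simp add: knots_def ext_def i_def)
  define piece where "piece = (\<lambda>S c k. affine_on S c (t k) (t k + \<alpha> k) \<and> affine_on S 0 (t k + \<alpha> k) (t (k + 1)))"
  have space: "s \<in> spline_space (W1 (q + 2) M) n \<phi> t \<alpha> \<beta> \<longleftrightarrow>
     periodic s \<and> smooth q s \<and> (\<exists>L. L-lipschitz_on UNIV (nderiv q s)) \<and>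
       (\<forall>k\<in>{1..2*n}. \<exists>c. piece (nderiv q s) c k)" for s
  proof (cases "s \<in> L_inf (Suc q)")
    case True
    then have "loc_abs_cont (nderiv q s)" by (simp add: L_inf_def)
    from const_on_deriv_iff[OF this] show ?thesis
      using True unfolding L_inf_Suc_iff piece_def by (simp add: L_inf_Suc_iff)
  qed (auto simp: L_inf_Suc_iff)
  have piece_iff: "piece S c (i k) \<longleftrightarrow>
     affine_on S c (knots n t k) (knots n t k + ext n \<alpha> k) \<and>
     affine_on S 0 (knots n t k + ext n \<alpha> k) (knots n t (Suc k))" if "periodic S" for S c k
  proof -
    have *: "affine_on S c (knots n t k + x) (knots n t k + y) \<longleftrightarrow> affine_on S c (t (i k) + x) (t (i k) + y)" for c x y
      using affine_on_unshift[OF that, of c "t (i k) + x" "k div (2 * n)" "t (i k) + y"]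
      by (simp add: knots_def ext_def i_def algebra_simps)
    have "affine_on S c (knots n t k) (knots n t k + y) \<longleftrightarrow> affine_on S c (t (i k)) (t (i k) + y)" for y
      using *[of c 0 y] by simp
    then show ?thesis unfolding piece_def gap ext * by auto
  qed
  have triv: "affine_on S c x x" for S c x by (simp add: affine_on_def)
  have nM: "\<bar>nderiv q \<phi> s\<bar> \<noteq> M'" for s using M'[of s] by simp
  have "s \<in> spline_space (W1 (q + 2) M) n \<phi> t \<alpha> \<beta> \<longleftrightarrow> spline_frame.spline n q (knots n t) (\<lambda>k. knots n t k + ext n \<alpha> k)
      (\<lambda>k. knots n t (Suc k)) (\<lambda>k. knots n t (Suc k)) M' \<phi> s" for s
    unfolding space F.spline_def
  proof (intro conj_cong refl iffI)
    assume "periodic s"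
    then have ps: "periodic (nderiv q s)" by (rule periodic_nderiv)
    {
      assume "\<forall>k\<in>{1..2*n}. \<exists>c. piece (nderiv q s) c k"
      then obtain c where c: "\<And>k. k \<in> {1..2*n} \<Longrightarrow> piece (nderiv q s) (c k) k" by metis
      have "F.spline_pieces (nderiv q s) (ext n c) (\<lambda>k. ext n c (Suc k))"
        unfolding F.spline_pieces_def using c[OF i] nM triv by (simp add: piece_iff[OF ps] ext)
      moreover have "ext n c (2 * n) = ext n c 0" by (simp add: ext_def)
      ultimately show "\<exists>c1 c2. F.spline_pieces (nderiv q s) c1 c2 \<and> c1 (2 * n) = c1 0" by blast
    }
    {
      assume "\<exists>c1 c2. F.spline_pieces (nderiv q s) c1 c2 \<and> c1 (2 * n) = c1 0"
      then obtain c1 c2 where "F.spline_pieces (nderiv q s) c1 c2" by blast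
      then have p: "piece (nderiv q s) (c1 k) (i k)" for k
        unfolding F.spline_pieces_def piece_iff[OF ps] by blast
      show "\<forall>k\<in>{1..2*n}. \<exists>c. piece (nderiv q s) c k"
      proof
        fix k assume "k \<in> {1..2*n}"
        then have "i (k - 1) = k" by (auto simp: i_def)
        then show "\<exists>c. piece (nderiv q s) c k" using p[of "k - 1"] by auto
      qed
    }
  qed
  then show ?thesis by blast
qed

section \<open>Norm estimates and optimal recovery\<close>

lemma Lp_norm_infinity: "Lp_norm \<infinity> f = esssup (lebesgue_on {0..2*pi}) (\<lambda>t. ennreal \<bar>f t\<bar>)"
  by (simp add: Lp_norm_def)

lemma continuous_abs_measurable [measurable]:
  "continuous_on UNIV f \<Longrightarrow> (\<lambda>t. \<bar>f t :: real\<bar>) \<in> borel_measurable (lebesgue_on {0..2*pi})"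
  by (rule measurable_restrict_space1)
    (simp add: borel_measurable_continuous_onI continuous_on_rabs measurable_completion)

definition root_of :: "real \<Rightarrow> ennreal \<Rightarrow> ennreal" where
  "root_of P I = (if I = \<infinity> then \<infinity> else ennreal (enn2real I powr (1 / P)))"

definition power_integral :: "real \<Rightarrow> (real \<Rightarrow> real) \<Rightarrow> ennreal" where
  "power_integral P f = (\<integral>\<^sup>+ t. ennreal (\<bar>f t\<bar> powr P) \<partial>lebesgue_on {0..2*pi})"

lemma Lp_norm_finite: "p \<noteq> \<infinity> \<Longrightarrow> Lp_norm p f = root_of (enn2real p) (power_integral (enn2real p) f)"
  by (simp add: Lp_norm_def root_of_def power_integral_def)

lemma root_of_mono:
  assumes "P \<ge> 1" "I \<le> I'"
  shows "root_of P I \<le> root_of P I'"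
proof (cases "I' = \<infinity>")
  case False
  then have "I' < top" by (simp add: less_top)
  then have "I \<noteq> \<infinity>" "enn2real I \<le> enn2real I'" using assms(2) by (auto simp: enn2real_mono top_unique)
  then show ?thesis using False assms(1)
    by (auto simp: root_of_def intro!: ennreal_leI powr_mono2)
qed (simp add: root_of_def)

lemma enn2real_ge_one: "1 \<le> p \<Longrightarrow> p \<noteq> \<infinity> \<Longrightarrow> 1 \<le> enn2real p"
  using enn2real_mono[of 1 p] by (simp add: less_top)

lemma Lp_norm_mono:
  assumes p: "1 \<le> p" and f: "continuous_on UNIV f" and le: "\<And>t. \<bar>f t\<bar> \<le> \<bar>g t\<bar>"
  shows "Lp_norm p f \<le> Lp_norm p g"
proof (cases "p = \<infinity>")
  case True
  show ?thesis unfolding True Lp_norm_infinity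
    by (rule esssup_mono) (use f le in \<open>auto intro!: ennreal_leI\<close>)
next
  case False
  have P: "enn2real p \<ge> 1" by (rule enn2real_ge_one[OF p False])
  have "power_integral (enn2real p) f \<le> power_integral (enn2real p) g"
    unfolding power_integral_def using le P by (intro nn_integral_mono ennreal_leI powr_mono2) auto
  then show ?thesis unfolding Lp_norm_finite[OF False] by (rule root_of_mono[OF P])
qed

text \<open>Midpoint convexity of the power function. A vanishing argument is treated directly,
  convexity being used for positive arguments only.\<close>

lemma two_powr_le:
  fixes x y z P :: real
  assumes "P \<ge> 1" "2 * \<bar>x\<bar> \<le> \<bar>y\<bar> + \<bar>z\<bar>"
  shows "2 * \<bar>x\<bar> powr P \<le> \<bar>y\<bar> powr P + \<bar>z\<bar> powr P"
proof -
  have "2 * ((u + v) / 2) powr P \<le> u powr P + v powr P" if "0 \<le> u" "0 \<le> v" for u v :: real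
  proof -
    have half: "2 * (w / 2) powr P \<le> w powr P" if "0 \<le> w" for w :: real
    proof -
      have "(2::real) powr 1 \<le> 2 powr P" using assms(1) by (intro powr_mono) auto
      then have "2 * (w / 2) powr P \<le> 2 powr P * (w / 2) powr P" by (intro mult_right_mono) auto
      also have "\<dots> = w powr P" using that by (simp flip: powr_mult)
      finally show ?thesis .
    qed
    show ?thesis
    proof (cases "u = 0 \<or> v = 0")
      case True
      then show ?thesis using half[of u] half[of v] that assms(1) by auto
    next
      case False
      then have "((1 - 1/2) *\<^sub>R u + (1/2) *\<^sub>R v) powr P \<le> (1 - 1/2) * u powr P + (1/2) * v powr P"
        using that by (intro convex_onD[OF powr_convex[OF assms(1)]]) auto
      moreover have "(1 - 1/2) *\<^sub>R u + (1/2) *\<^sub>R v = (u + v) / 2" by (simp add: field_simps)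
      ultimately show ?thesis by (simp add: field_simps)
    qed
  qed
  from this[of "\<bar>y\<bar>" "\<bar>z\<bar>"] have "2 * ((\<bar>y\<bar> + \<bar>z\<bar>) / 2) powr P \<le> \<bar>y\<bar> powr P + \<bar>z\<bar> powr P" by simp
  moreover have "\<bar>x\<bar> powr P \<le> ((\<bar>y\<bar> + \<bar>z\<bar>) / 2) powr P" using assms by (intro powr_mono2) auto
  ultimately show ?thesis by linarith
qed

text \<open>f is half the difference of the two functions on the right. For finite p, convexity
  under the integral replaces the triangle inequality: the integral for f is at most the mean of the
  other two.\<close>

lemma Lp_norm_le_max:
  assumes p: "1 \<le> p" and f: "continuous_on UNIV f" and g: "continuous_on UNIV g"
  shows "Lp_norm p f \<le> max (Lp_norm p (\<lambda>t. f t - g t)) (Lp_norm p (\<lambda>t. - f t - g t))"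
proof -
  have c1: "continuous_on UNIV (\<lambda>t. f t - g t)" and c2: "continuous_on UNIV (\<lambda>t. - f t - g t)"
    using f g by (auto intro!: continuous_intros)
  have le: "2 * \<bar>f t\<bar> \<le> \<bar>f t - g t\<bar> + \<bar>- f t - g t\<bar>" for t by linarith
  show ?thesis
  proof (cases "p = \<infinity>")
    case True
    let ?E = "\<lambda>h. esssup (lebesgue_on {0..2*pi}) (\<lambda>t. ennreal \<bar>h t\<bar>)"
    have "?E f \<le> max (?E (\<lambda>t. f t - g t)) (?E (\<lambda>t. - f t - g t))"
    proof (rule esssup_I)
      show "AE t in lebesgue_on {0..2*pi}. ennreal \<bar>f t\<bar> \<le> max (?E (\<lambda>t. f t - g t)) (?E (\<lambda>t. - f t - g t))"
        using esssup_AE[of "\<lambda>t. ennreal \<bar>f t - g t\<bar>" "lebesgue_on {0..2*pi}"]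
          esssup_AE[of "\<lambda>t. ennreal \<bar>- f t - g t\<bar>" "lebesgue_on {0..2*pi}"]
      proof eventually_elim
        case (elim t)
        have "\<bar>f t\<bar> \<le> \<bar>f t - g t\<bar> \<or> \<bar>f t\<bar> \<le> \<bar>- f t - g t\<bar>" using le[of t] by linarith
        then show ?case
        proof
          assume "\<bar>f t\<bar> \<le> \<bar>f t - g t\<bar>"
          then show ?thesis using elim(1) by (meson ennreal_leI max.coboundedI1 order_trans)
        next
          assume "\<bar>f t\<bar> \<le> \<bar>- f t - g t\<bar>"
          then show ?thesis using elim(2) by (meson ennreal_leI max.coboundedI2 order_trans)
        qed
      qed
    qed (use f in auto)
    then show ?thesis unfolding True Lp_norm_infinity .
  next
    case False
    let ?P = "enn2real p"
    have P: "?P \<ge> 1" by (rule enn2real_ge_one[OF p False])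
    let ?I = "power_integral ?P"
    let ?m = "max (?I (\<lambda>t. f t - g t)) (?I (\<lambda>t. - f t - g t))"
    have meas: "(\<lambda>t. ennreal (\<bar>h t\<bar> powr ?P)) \<in> borel_measurable (lebesgue_on {0..2*pi})"
      if "continuous_on UNIV h" for h :: "real \<Rightarrow> real"
      using continuous_abs_measurable[OF that] by measurable
    have "2 * ?I f = (\<integral>\<^sup>+ t. 2 * ennreal (\<bar>f t\<bar> powr ?P) \<partial>lebesgue_on {0..2*pi})"
      unfolding power_integral_def by (rule nn_integral_cmult[symmetric, OF meas[OF f]])
    also have "\<dots> \<le> (\<integral>\<^sup>+ t. ennreal (\<bar>f t - g t\<bar> powr ?P) + ennreal (\<bar>- f t - g t\<bar> powr ?P) \<partial>lebesgue_on {0..2*pi})"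
    proof (rule nn_integral_mono)
      fix t
      have "2 * ennreal (\<bar>f t\<bar> powr ?P) = ennreal (2 * \<bar>f t\<bar> powr ?P)" by (simp add: ennreal_mult')
      also have "\<dots> \<le> ennreal (\<bar>f t - g t\<bar> powr ?P + \<bar>- f t - g t\<bar> powr ?P)"
        by (rule ennreal_leI[OF two_powr_le[OF P le]])
      finally show "2 * ennreal (\<bar>f t\<bar> powr ?P) \<le> ennreal (\<bar>f t - g t\<bar> powr ?P) + ennreal (\<bar>- f t - g t\<bar> powr ?P)"
        by (simp add: ennreal_plus)
    qed
    also have "\<dots> = ?I (\<lambda>t. f t - g t) + ?I (\<lambda>t. - f t - g t)"
      unfolding power_integral_def by (rule nn_integral_add[OF meas[OF c1] meas[OF c2]])
    also have "\<dots> \<le> 2 * ?m" by (simp add: mult_2 add_mono)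
    finally have "?I f \<le> ?m" by (subst (asm) ennreal_mult_le_mult_iff) auto
    then have "root_of ?P (?I f) \<le> root_of ?P ?m" by (rule root_of_mono[OF P])
    then show ?thesis unfolding Lp_norm_finite[OF False] by (auto simp: max_def split: if_splits)
  qed
qed

section \<open>Optimal recovery from a pointwise comparison\<close>

lemma optimal_recovery:
  fixes Xs S :: "(real \<Rightarrow> real) set"
  assumes p: "1 \<le> p"
    and XC: "Xs \<subseteq> C_per" and SC: "S \<subseteq> C_per"
    and phi: "\<phi> \<in> Xs" "(\<lambda>t. - \<phi> t) \<in> Xs" "\<And>k. k \<in> {1..2*n} \<Longrightarrow> \<phi> (u k) = 0"
    and ex: "\<And>v. \<exists>s\<in>S. \<forall>k\<in>{1..2*n}. s (u k) = v k"
    and uniq: "\<And>s s'. s \<in> S \<Longrightarrow> s' \<in> S \<Longrightarrow> (\<And>k. k \<in> {1..2*n} \<Longrightarrow> s (u k) = s' (u k)) \<Longrightarrow> s = s'"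
    and cmp: "\<And>x s \<tau>. x \<in> Xs \<Longrightarrow> s \<in> S \<Longrightarrow> (\<And>k. k \<in> {1..2*n} \<Longrightarrow> s (u k) = x (u k)) \<Longrightarrow> \<bar>x \<tau> - s \<tau>\<bar> \<le> \<bar>\<phi> \<tau>\<bar>"
  shows "best_error Xs n u (Lp_norm p) = Lp_norm p \<phi> \<and>
         interp_spline S n u \<in> recovery_methods n \<and>
         recovery_error Xs n u (interp_spline S n u) (Lp_norm p) = best_error Xs n u (Lp_norm p)"
proof -
  let ?\<Psi> = "interp_spline S n u"
  have \<Psi>: "?\<Psi> v \<in> S \<and> (\<forall>k\<in>{1..2*n}. ?\<Psi> v (u k) = v k)" for v
    unfolding interp_spline_def
  proof (rule theI'[of "\<lambda>s. s \<in> S \<and> (\<forall>k\<in>{1..2*n}. s (u k) = v k)"])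
    show "\<exists>!s. s \<in> S \<and> (\<forall>k\<in>{1..2*n}. s (u k) = v k)"
      using ex[of v] uniq by (metis (no_types, lifting))
  qed
  have cont: "continuous_on UNIV x" if "x \<in> C_per" for x using that by (simp add: C_per_def)
  have recovers: "?\<Psi> \<in> recovery_methods n" using \<Psi> SC by (auto simp: recovery_methods_def)
  have "recovery_error Xs n u ?\<Psi> (Lp_norm p) \<le> Lp_norm p \<phi>"
    unfolding recovery_error_def
  proof (rule SUP_least)
    fix x assume x: "x \<in> Xs"
    let ?s = "?\<Psi> (samples n u x)"
    have s: "?s \<in> S" "\<And>k. k \<in> {1..2*n} \<Longrightarrow> ?s (u k) = x (u k)"
      using \<Psi>[of "samples n u x"] by (auto simp: samples_def)
    show "Lp_norm p (\<lambda>\<tau>. x \<tau> - ?s \<tau>) \<le> Lp_norm p \<phi>"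
      by (rule Lp_norm_mono[OF p _ cmp[OF x s]])
        (use x s(1) XC SC cont in \<open>auto intro!: continuous_intros\<close>)
  qed
  moreover have "best_error Xs n u (Lp_norm p) \<le> recovery_error Xs n u ?\<Psi> (Lp_norm p)"
    unfolding best_error_def by (rule INF_lower[OF recovers])
  moreover have "Lp_norm p \<phi> \<le> best_error Xs n u (Lp_norm p)"
    unfolding best_error_def
  proof (rule INF_greatest)
    fix \<Phi> assume \<Phi>: "\<Phi> \<in> recovery_methods n"
    define g where "g = \<Phi> (samples n u \<phi>)"
    have same: "samples n u (\<lambda>t. - \<phi> t) = samples n u \<phi>"
      using phi(3) by (auto simp: samples_def restrict_def)
    have "samples n u \<phi> \<in> {1..2*n} \<rightarrow>\<^sub>E UNIV" by (simp add: samples_def)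
    then have "g \<in> C_per" using \<Phi> unfolding g_def recovery_methods_def by blast
    then have "Lp_norm p \<phi> \<le> max (Lp_norm p (\<lambda>t. \<phi> t - g t)) (Lp_norm p (\<lambda>t. - \<phi> t - g t))"
      using XC phi(1) by (intro Lp_norm_le_max[OF p]) (auto intro: cont)
    also have "\<dots> \<le> recovery_error Xs n u \<Phi> (Lp_norm p)"
      unfolding recovery_error_def
      using SUP_upper[OF phi(1), of "\<lambda>x. Lp_norm p (\<lambda>\<tau>. x \<tau> - \<Phi> (samples n u x) \<tau>)"]
        SUP_upper[OF phi(2), of "\<lambda>x. Lp_norm p (\<lambda>\<tau>. x \<tau> - \<Phi> (samples n u x) \<tau>)"]
      by (simp add: same flip: g_def)
    finally show "Lp_norm p \<phi> \<le> recovery_error Xs n u \<Phi> (Lp_norm p)" .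
  qed
  ultimately show ?thesis using recovers by (metis order_antisym order_trans)
qed

lemma unit_class_minus:
  assumes "x \<in> unit_class m"
  shows "(\<lambda>t. - x t) \<in> unit_class m" "k \<le> m \<Longrightarrow> nderiv k (\<lambda>t. - x t) = (\<lambda>t. - nderiv k x t)"
proof -
  have x: "periodic x" "smooth m x" "1-lipschitz_on UNIV (nderiv m x)"
    using assms by (auto simp: unit_class_def)
  have nd: "nderiv k (\<lambda>t. - x t) = (\<lambda>t. - nderiv k x t)" if "k \<le> m" for k
    using smooth_lincomb(2)[OF x(2) x(2) that, of "-1" 0] by simp
  show "k \<le> m \<Longrightarrow> nderiv k (\<lambda>t. - x t) = (\<lambda>t. - nderiv k x t)" by (rule nd)
  have "smooth m (\<lambda>t. - x t)" using smooth_lincomb(1)[OF x(2) x(2), of "-1" 0] by simp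
  moreover have "1-lipschitz_on UNIV (\<lambda>t. - nderiv m x t)" using x(3) by (rule lipschitz_on_minus)
  ultimately show "(\<lambda>t. - x t) \<in> unit_class m" using x(1) by (simp add: unit_class_def nd periodic_def)
qed

lemma L_inf_subset_C_per: "L_inf (Suc m) \<subseteq> C_per"
  using L_inf_continuous[of _ m 0] by (auto simp: C_per_def L_inf_Suc_iff)

lemma unit_class_subset_C_per: "unit_class m \<subseteq> C_per"
  using L_inf_subset_C_per unfolding unit_class_eq by blast

lemma sample_points:
  assumes u: "0 \<le> u 1" "strict_mono_on {1..m::nat} u" "u m < 2 * pi"
  shows "u ` {1..m} \<subseteq> {0..<2*pi}"
proof
  fix y assume "y \<in> u ` {1..m}"
  then obtain k where k: "k \<in> {1..m}" "y = u k" by blast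
  have "u 1 \<le> u k" using strict_mono_onD[OF u(2), of 1 k] k(1) by (cases "k = 1") auto
  moreover have "u k \<le> u m" using strict_mono_onD[OF u(2), of k m] k(1) by (cases "k = m") auto
  ultimately show "y \<in> {0..<2*pi}" using u(1,3) k(2) by simp
qed

context spline_frame
begin

text \<open>The bounds on the class are asked for only if some second part is not empty or some knot
  is a peak. This lets one statement serve classes in which one of the bounds is missing.\<close>

lemma frame_optimal_recovery:
  assumes p: "1 \<le> p" and u: "0 \<le> u 1" "strict_mono_on {1..2*n} u" "u (2*n) < 2 * pi"
    and zero: "\<And>k. k \<in> {1..2*n} \<Longrightarrow> \<phi> (u k) = 0"
    and X: "Xs \<subseteq> unit_class (Suc q)" "\<phi> \<in> Xs" "(\<lambda>t. - \<phi> t) \<in> Xs"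
    and XN: "\<And>x k t. x \<in> Xs \<Longrightarrow> a k < b k \<Longrightarrow> \<bar>nderiv (Suc q) x t\<bar> \<le> N"
    and XM: "\<And>x k t. x \<in> Xs \<Longrightarrow> \<bar>f (T (Suc k))\<bar> = M \<Longrightarrow> \<bar>nderiv q x t\<bar> \<le> M"
  shows "best_error Xs n u (Lp_norm p) = Lp_norm p \<phi> \<and>
         interp_spline {s. spline s} n u \<in> recovery_methods n \<and>
         recovery_error Xs n u (interp_spline {s. spline s} n u) (Lp_norm p) = best_error Xs n u (Lp_norm p)"
proof (rule optimal_recovery[OF p])
  have sub: "u ` {1..2*n} \<subseteq> {0..<2*pi}" by (rule sample_points[OF u])
  have U: "finite (u ` {1..2*n})" "card (u ` {1..2*n}) = 2 * n" "u ` {1..2*n} \<subseteq> {0..<2*pi}"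
    "\<And>z. z \<in> u ` {1..2*n} \<Longrightarrow> \<phi> z = 0"
    using u(2) sub zero by (auto simp: card_image strict_mono_on_imp_inj_on)
  show "\<exists>s\<in>{s. spline s}. \<forall>k\<in>{1..2*n}. s (u k) = v k" for v
    using spline_exists[OF u(2) sub zero, of v] by blast
  show "\<bar>x \<tau> - s \<tau>\<bar> \<le> \<bar>\<phi> \<tau>\<bar>" if "x \<in> Xs" "s \<in> {s. spline s}" "\<And>k. k \<in> {1..2*n} \<Longrightarrow> s (u k) = x (u k)" for x s \<tau>
    by (rule comparison[OF U]) (use that X(1) XN XM in \<open>auto simp del: funpow.simps\<close>)
  show "s = s'" if "s \<in> {s. spline s}" "s' \<in> {s. spline s}" "\<And>k. k \<in> {1..2*n} \<Longrightarrow> s (u k) = s' (u k)" for s s'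
  proof -
    have sp: "spline (\<lambda>t. 1 * s t + (-1) * s' t)" by (rule spline_lincomb) (use that in auto)
    have z: "1 * s z + (-1) * s' z = 0" if "z \<in> u ` {1..2*n}" for z
      using that \<open>\<And>k. k \<in> {1..2*n} \<Longrightarrow> s (u k) = s' (u k)\<close> by fastforce
    have "(\<lambda>t. 1 * s t + (-1) * s' t) = (\<lambda>_. 0)" by (rule spline_zero[OF U sp z])
    then show ?thesis by (auto simp: fun_eq_iff)
  qed
  show "{s. spline s} \<subseteq> C_per"
  proof
    fix s assume "s \<in> {s. spline s}"
    then have "s \<in> L_inf (Suc q)" unfolding L_inf_Suc_iff spline_def by blast
    then show "s \<in> C_per" using L_inf_subset_C_per by blast
  qed
  show "Xs \<subseteq> C_per" using X(1) unit_class_subset_C_per by blast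
qed (use X zero in auto)

end

section \<open>Application to the three classes\<close>

lemma bounded_of_periodic:
  assumes "periodic g" "continuous_on UNIV g"
  obtains B where "\<And>t. \<bar>g t\<bar> < B"
proof -
  have "compact (g ` {0..2*pi})"
    by (intro compact_continuous_image continuous_on_subset[OF assms(2)]) auto
  then obtain B where B: "\<And>y. y \<in> g ` {0..2*pi} \<Longrightarrow> norm y \<le> B" using compact_imp_bounded bounded_iff by metis
  have "\<bar>g t\<bar> < B + 1" for t
  proof -
    obtain j :: int where j: "t - 2 * pi * of_int j \<in> {0..<2*pi}" by (rule periodic_reduce)
    then have "\<bar>g (t - 2 * pi * of_int j)\<bar> \<le> B" using B by fastforce
    then show ?thesis using periodic_add_int[OF assms(1), of "t - 2 * pi * of_int j" j] by simp
  qed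
  then show thesis by (rule that)
qed

theorem mainTheorem2:
  fixes X :: fun_class and n :: nat and p :: ennreal
    and u t \<epsilon> \<alpha> \<beta> :: "nat \<Rightarrow> real" and \<phi> :: "real \<Rightarrow> real"
  assumes "admissible X"
    and "n \<ge> 1"
    and "0 \<le> u 1" and "strict_mono_on {1..2*n} u" and "u (2*n) < 2 * pi"
    and "1 \<le> p"
    and "ideal_spline X n t \<epsilon> \<alpha> \<beta> \<phi>"
    and "\<forall>k\<in>{1..2*n}. \<phi> (u k) = 0"
  defines "\<Psi> \<equiv> interp_spline (spline_space X n \<phi> t \<alpha> \<beta>) n u"
  shows "best_error (class_set X) n u (Lp_norm p) = Lp_norm p \<phi> \<and>
         \<Psi> \<in> recovery_methods n \<and>
         recovery_error (class_set X) n u \<Psi> (Lp_norm p) = best_error (class_set X) n u (Lp_norm p)"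
proof -
  note u = assms(3-5)
  have zero: "\<phi> (u k) = 0" if "k \<in> {1..2*n}" for k using assms(8) that by blast
  have ideal: "\<phi> \<in> class_set X" "strict_mono_on {1..2*n + 1} t" "t (2*n + 1) = t 1 + 2 * pi"
    "\<And>k. k \<in> {1..2*n} \<Longrightarrow> \<epsilon> k \<in> {1, -1} \<and> ideal_piece X \<phi> (t k) (t (k + 1)) (\<epsilon> k) (\<alpha> k) (\<beta> k)"
    "sign_rule X n \<epsilon>"
    using assms(7) unfolding ideal_spline_def by blast+
  have neg: "(\<lambda>t. - x t) \<in> unit_class (Suc q) \<and> bounded_by (nderiv k (\<lambda>t. - x t)) B"
    if "x \<in> unit_class (Suc q)" "bounded_by (nderiv k x) B" "k \<le> Suc q" for x q k B
    using unit_class_minus[OF that(1)] that(2,3) by (simp add: bounded_by_def)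
  show ?thesis
  proof (cases X)
    case (W1 r M)
    then obtain q where r: "r = q + 2" and M: "M > 0" using assms(1) by (auto simp: le_iff_add add.commute)
    note cls = class_set_iff(1)[OF M M, of _ q]
    have phi: "\<phi> \<in> unit_class (Suc q)" "bounded_by (nderiv (Suc q) \<phi>) M"
      using ideal(1) cls unfolding W1 r by auto
    have "continuous_on UNIV (nderiv q \<phi>)" "periodic (nderiv q \<phi>)"
      using phi(1) L_inf_continuous[of \<phi> "Suc q" q] periodic_nderiv[of \<phi> q]
      unfolding unit_class_eq by (simp_all add: L_inf_Suc_iff)
    \<comment> \<open>The bound is strict, so no knot of this frame is a peak; it depends on \<phi>
      and not on the class.\<close>
    then obtain M' where M': "\<And>s. \<bar>nderiv q \<phi> s\<bar> < M'" by (metis bounded_of_periodic)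
    have sub: "u ` {1..2*n} \<subseteq> {0..<0 + 2*pi}" using sample_points[OF u] by simp
    have "periodic \<phi>" using phi(1) by (simp add: unit_class_def)
    then have "zero_rate s (card (u ` {1..2*n})) \<phi>" for s
    proof (rule zero_rateI[OF _ _ _ sub])
      show "\<phi> z = 0" if "z \<in> u ` {1..2*n}" for z using that zero by blast
    qed (use assms(2) in simp_all)
    then have zr: "zero_rate s (2 * n) \<phi>" for s
      using strict_mono_on_imp_inj_on[OF u(2)] by (simp add: card_image)
    have frame: "spline_frame n q (knots n t) (\<lambda>k. knots n t k + ext n \<alpha> k)
      (\<lambda>k. knots n t (Suc k)) (\<lambda>k. knots n t (Suc k)) (ext n \<epsilon>) M' M \<phi>"
      by (rule W1_frame[where \<beta> = \<beta>, OF assms(2) M M' phi ideal(2,3) ideal(4)[unfolded W1 r] zr])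
    interpret F: spline_frame n q "knots n t" "\<lambda>k. knots n t k + ext n \<alpha> k"
      "\<lambda>k. knots n t (Suc k)" "\<lambda>k. knots n t (Suc k)" "ext n \<epsilon>" M' M \<phi> by (rule frame)
    show ?thesis
      unfolding \<Psi>_def W1 r spline_space_W1[OF ideal(3) M' frame]
    proof (rule F.frame_optimal_recovery[OF assms(6) u zero])
      show "(\<lambda>t. - \<phi> t) \<in> class_set (W1 (q + 2) M)" using neg[OF phi] cls by blast
      show "\<bar>nderiv (Suc q) x s\<bar> \<le> M" if "x \<in> class_set (W1 (q + 2) M)" for x s
        using that cls by (simp add: bounded_by_def del: funpow.simps)
      show "\<bar>nderiv q x s\<bar> \<le> M'" if "\<bar>nderiv q \<phi> (knots n t (Suc k))\<bar> = M'" for x s k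
        using that M' by (metis less_irrefl)
    qed (use ideal(1) cls W1 r in auto)
  next
    case (W2 r M)
    then obtain q where r: "r = q + 2" and M: "M > 0" using assms(1) by (auto simp: le_iff_add add.commute dest: spec)
    note cls = class_set_iff(2)[OF M M, of _ q]
    have phi: "\<phi> \<in> unit_class (Suc q)" "bounded_by (nderiv q \<phi>) M"
      using ideal(1) cls unfolding W2 r by auto
    have half: "x + y - y / 2 = x + y / (2::real)" for x y by (simp add: field_simps)
    \<comment> \<open>\<open>W2\<close> is treated as \<open>W12\<close> with
      \<open>\<beta> = \<alpha>\<close>. The second part of each interval is then empty, so any
      positive number, here 1, can stand for N.\<close>
    have frame: "spline_frame n q (knots n t) (\<lambda>k. knots n t k + ext n \<alpha> k / 2)
      (\<lambda>k. knots n t k + (ext n \<alpha> k - ext n \<alpha> k / 2)) (\<lambda>k. knots n t k + ext n \<alpha> k) (ext n \<epsilon>) M 1 \<phi>"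
    proof (rule W12_frame[OF assms(2) M zero_less_one phi ideal(2,3)])
      show "\<epsilon> k \<in> {1, -1} \<and> ideal_piece (W12 (q + 2) M 1) \<phi> (t k) (t (k + 1)) (\<epsilon> k) (\<alpha> k) (\<alpha> k)" if "k \<in> {1..2*n}" for k
        using ideal(4)[OF that] unfolding W2 r ideal_piece.simps half by (simp add: const_on_empty)
      show "\<epsilon> (k + 1) = - \<epsilon> k" if "k \<in> {1..<2*n}" for k using ideal(5) that unfolding W2 by simp
    qed
    interpret F: spline_frame n q "knots n t" "\<lambda>k. knots n t k + ext n \<alpha> k / 2"
      "\<lambda>k. knots n t k + (ext n \<alpha> k - ext n \<alpha> k / 2)" "\<lambda>k. knots n t k + ext n \<alpha> k" "ext n \<epsilon>" M 1 \<phi> by (rule frame)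
    show ?thesis
      unfolding \<Psi>_def W2 r spline_space_W2[of _ M n \<phi> t \<alpha> \<beta> 1] spline_space_W12[OF ideal(3) frame]
    proof (rule F.frame_optimal_recovery[OF assms(6) u zero])
      show "(\<lambda>t. - \<phi> t) \<in> class_set (W2 (q + 2) M)" using neg[OF phi] cls by simp
      show "\<bar>nderiv (Suc q) x s\<bar> \<le> 1"
        if "knots n t k + ext n \<alpha> k / 2 < knots n t k + (ext n \<alpha> k - ext n \<alpha> k / 2)" for x s k
        using that by simp
      show "\<bar>nderiv q x s\<bar> \<le> M" if "x \<in> class_set (W2 (q + 2) M)" for x s
        using that cls by (simp add: bounded_by_def)
    qed (use ideal(1) cls W2 r in auto)
  next
    case (W12 r M N)
    then obtain q where r: "r = q + 2" and M: "M > 0" and N: "N > 0"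
      using assms(1) by (auto simp: le_iff_add add.commute dest: spec)
    note cls = class_set_iff(3)[OF M N, of _ q]
    have phi: "\<phi> \<in> unit_class (Suc q)" "bounded_by (nderiv q \<phi>) M" "bounded_by (nderiv (Suc q) \<phi>) N"
      using ideal(1) cls unfolding W12 r by auto
    have frame: "spline_frame n q (knots n t) (\<lambda>k. knots n t k + ext n \<beta> k / 2)
      (\<lambda>k. knots n t k + (ext n \<alpha> k - ext n \<beta> k / 2)) (\<lambda>k. knots n t k + ext n \<alpha> k) (ext n \<epsilon>) M N \<phi>"
    proof (rule W12_frame[OF assms(2) M N phi(1,2) ideal(2,3)])
      show "\<epsilon> k \<in> {1, -1} \<and> ideal_piece (W12 (q + 2) M N) \<phi> (t k) (t (k + 1)) (\<epsilon> k) (\<alpha> k) (\<beta> k)" if "k \<in> {1..2*n}" for k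
        using ideal(4)[OF that] unfolding W12 r .
      show "\<epsilon> (k + 1) = - \<epsilon> k" if "k \<in> {1..<2*n}" for k using ideal(5) that unfolding W12 by simp
    qed
    interpret F: spline_frame n q "knots n t" "\<lambda>k. knots n t k + ext n \<beta> k / 2"
      "\<lambda>k. knots n t k + (ext n \<alpha> k - ext n \<beta> k / 2)" "\<lambda>k. knots n t k + ext n \<alpha> k" "ext n \<epsilon>" M N \<phi> by (rule frame)
    show ?thesis
      unfolding \<Psi>_def W12 r spline_space_W12[OF ideal(3) frame]
    proof (rule F.frame_optimal_recovery[OF assms(6) u zero])
      show "(\<lambda>t. - \<phi> t) \<in> class_set (W12 (q + 2) M N)"
        using neg[OF phi(1,2)] neg[OF phi(1,3)] cls by simp
      show "\<bar>nderiv (Suc q) x s\<bar> \<le> N" "\<bar>nderiv q x s\<bar> \<le> M" if "x \<in> class_set (W12 (q + 2) M N)" for x s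
        using that cls by (simp_all add: bounded_by_def del: funpow.simps)
    qed (use ideal(1) cls W12 r in auto)
  qed
qed

end
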